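(* Let $W$ be an irreducible finite complex (pseudo-)reflection group which is not a 2-reflection group. The Lie algebras $\mathcal{H}$ and $\mathcal{H}(\underline{\boldsymbol{\lambda}})$ are reductive for all $\underline{\boldsymbol{\lambda}}\in\mathbb{A}(W)$. Moreover, there exists a hyperplane complement $\mathbb{A}(W)^\times\subset\mathbb{A}(W)$ (the complement of a finite union of linear hyperplanes) such that, for all $\underline{\boldsymbol{\lambda}}\in\mathbb{A}(W)^\times$, $\mathcal{H}(\underline{\boldsymbol{\lambda}})$ has a center of dimension $|\mathcal{S}/W|$ and semisimple part $\mathcal{H}(\underline{\boldsymbol{\lambda}})'=\mathcal{H}'$.
   Context: Let $V$ be a finite-dimensional complex vector space and $W<\mathrm{GL}(V)$ a finite group generated by (pseudo-)reflections, i.e. invertible endomorphisms $\neq 1$ fixing some hyperplane pointwise. $\mathcal{R}$ is the set of (pseudo-)reflections of $W$; $W$ is a 2-reflection group if $s^2=1$ for all $s\in\mathcal{R}$. $\mathbf{k}$ is a field of characteristic 0 over which every irreducible representation of $W$ is realizable. The algebra $\mathbf{k}W$ is a Lie algebra for $[x,y]=xy-yx$, and $\mathfrak{g}'=[\mathfrak{g},\mathfrak{g}]$ for a Lie subalgebra $\mathfrak{g}$. Let $\mathcal{S}\subset\mathcal{R}$ be a subset stable under $W$-conjugation, generating $W$, and such that $s\mapsto\mathrm{Ker}(s-1)$ is a bijection from $\mathcal{S}$ onto the set of reflecting hyperplanes (for instance the distinguished reflections). $\mathcal{S}/W$ is the set of conjugacy classes in $\mathcal{S}$. For a conjugacy class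 $c\subset\mathcal{S}$, $e_c$ is the order of its elements; $\mathcal{S}=\mathcal{S}_+\sqcup\mathcal{S}_0$, where $\mathcal{S}_0$ consists of the elements of order 2 and $\mathcal{S}_+$ of those of order $>2$. $\mathcal{C}_+$ is the set of conjugacy classes in $\mathcal{S}_+$, and $\mathbb{A}(W)=\prod_{c\in\mathcal{C}_+}\mathbf{k}^{e_c-1}$, with elements $\underline{\boldsymbol{\lambda}}=(\underline{\lambda}^c)_{c\in\mathcal{C}_+}$, $\underline{\lambda}^c=(\lambda^c_1,\dots,\lambda^c_{e_c-1})$. $\mathcal{H}$ is the Lie subalgebra of $\mathbf{k}W$ generated by $\mathcal{R}$. $\mathcal{H}(\underline{\boldsymbol{\lambda}})$ is the Lie subalgebra of $\mathbf{k}W$ generated by $\mathcal{S}_0$ and the elements $\lambda^c_1s+\dots+\lambda^c_{e_c-1}s^{e_c-1}$ for $s\in c\subset\mathcal{S}_+$. *)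

theory Defs
  imports
    Complex_Main
    "HOL-Library.Poly_Mapping"
    "HOL-Algebra.Generated_Groups"
    "HOL-Algebra.Multiplicative_Group"
    "HOL-Algebra.Algebraic_Closure_Type"
    "Jordan_Normal_Form.Matrix"
begin

section \<open>Complex reflection groups\<close>

text \<open>
  \<open>V\<close> is the whole type \<open>'v\<close>, with scalar multiplication \<open>sc\<close>; endomorphisms are functions
  \<open>'v \<Rightarrow> 'v\<close>.
\<close>

definition GL :: "(complex \<Rightarrow> 'v \<Rightarrow> 'v) \<Rightarrow> ('v::ab_group_add \<Rightarrow> 'v) monoid" where
  "GL sc = \<lparr>carrier = {f. Vector_Spaces.linear sc sc f \<and> bij f}, monoid.mult = (\<circ>), one = id\<rparr>"

definition hyperplane_of :: "('f::field \<Rightarrow> 'a \<Rightarrow> 'a) \<Rightarrow> 'a::ab_group_add set \<Rightarrow> 'a set \<Rightarrow> bool" where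
  "hyperplane_of sc A H \<longleftrightarrow>
     module.subspace sc H \<and> H \<subseteq> A \<and> vector_space.dim sc H + 1 = vector_space.dim sc A"

definition pseudo_reflection :: "(complex \<Rightarrow> 'v \<Rightarrow> 'v) \<Rightarrow> ('v::ab_group_add \<Rightarrow> 'v) \<Rightarrow> bool" where
  "pseudo_reflection sc s \<longleftrightarrow>
     s \<in> carrier (GL sc) \<and> s \<noteq> id \<and> (\<exists>H. hyperplane_of sc UNIV H \<and> (\<forall>v\<in>H. s v = v))"

definition reflections ::
    "(complex \<Rightarrow> 'v \<Rightarrow> 'v) \<Rightarrow> ('v::ab_group_add \<Rightarrow> 'v) set \<Rightarrow> ('v \<Rightarrow> 'v) set" where
  "reflections sc W = {s \<in> W. pseudo_reflection sc s}"

definition reflection_group :: "(complex \<Rightarrow> 'v \<Rightarrow> 'v) \<Rightarrow> ('v::ab_group_add \<Rightarrow> 'v) set \<Rightarrow> bool" where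
  "reflection_group sc W \<longleftrightarrow>
     subgroup W (GL sc) \<and> finite W \<and> generate (GL sc) (reflections sc W) = W"

definition irreducible_on ::
    "(complex \<Rightarrow> 'v \<Rightarrow> 'v) \<Rightarrow> ('v::ab_group_add \<Rightarrow> 'v) set \<Rightarrow> bool" where
  "irreducible_on sc W \<longleftrightarrow>
     (UNIV :: 'v set) \<noteq> {0} \<and>
     (\<forall>U. module.subspace sc U \<and> (\<forall>w\<in>W. w ` U \<subseteq> U) \<longrightarrow> U = {0} \<or> U = UNIV)"

definition two_reflection_group ::
    "(complex \<Rightarrow> 'v \<Rightarrow> 'v) \<Rightarrow> ('v::ab_group_add \<Rightarrow> 'v) set \<Rightarrow> bool" where
  "two_reflection_group sc W \<longleftrightarrow> reflection_group sc W \<and> (\<forall>s\<in>reflections sc W. s \<circ> s = id)"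

definition fixed_space :: "('v \<Rightarrow> 'v) \<Rightarrow> 'v set" where
  "fixed_space s = {v. s v = v}"

definition conj_class :: "('v \<Rightarrow> 'v) set \<Rightarrow> ('v \<Rightarrow> 'v) \<Rightarrow> ('v \<Rightarrow> 'v) set" where
  "conj_class W s = (\<lambda>w. w \<circ> s \<circ> inv_into UNIV w) ` W"

definition reflection_system ::
    "(complex \<Rightarrow> 'v \<Rightarrow> 'v) \<Rightarrow> ('v::ab_group_add \<Rightarrow> 'v) set \<Rightarrow> ('v \<Rightarrow> 'v) set \<Rightarrow> bool" where
  "reflection_system sc W S \<longleftrightarrow>
     S \<subseteq> reflections sc W \<and>
     (\<forall>s\<in>S. conj_class W s \<subseteq> S) \<and>
     generate (GL sc) S = W \<and>
     bij_betw fixed_space S (fixed_space ` reflections sc W)"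

definition conj_classes :: "('v \<Rightarrow> 'v) set \<Rightarrow> ('v \<Rightarrow> 'v) set \<Rightarrow> ('v \<Rightarrow> 'v) set set" where
  "conj_classes W S = conj_class W ` S"

definition S_zero :: "(complex \<Rightarrow> 'v \<Rightarrow> 'v) \<Rightarrow> ('v::ab_group_add \<Rightarrow> 'v) set \<Rightarrow> ('v \<Rightarrow> 'v) set" where
  "S_zero sc S = {s \<in> S. group.ord (GL sc) s = 2}"

definition S_plus :: "(complex \<Rightarrow> 'v \<Rightarrow> 'v) \<Rightarrow> ('v::ab_group_add \<Rightarrow> 'v) set \<Rightarrow> ('v \<Rightarrow> 'v) set" where
  "S_plus sc S = {s \<in> S. group.ord (GL sc) s > 2}"

definition C_plus ::
    "(complex \<Rightarrow> 'v \<Rightarrow> 'v) \<Rightarrow> ('v::ab_group_add \<Rightarrow> 'v) set \<Rightarrow> ('v \<Rightarrow> 'v) set \<Rightarrow> ('v \<Rightarrow> 'v) set set"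
  where "C_plus sc W S = conj_classes W (S_plus sc S)"

text \<open>The common order \<open>e\<^sub>c\<close> of the elements of a conjugacy class \<open>c\<close>.\<close>

definition class_order :: "(complex \<Rightarrow> 'v \<Rightarrow> 'v) \<Rightarrow> ('v::ab_group_add \<Rightarrow> 'v) set \<Rightarrow> nat" where
  "class_order sc c = the_elem (group.ord (GL sc) ` c)"


section \<open>Realizability of the irreducible representations\<close>

definition matrix_rep :: "('v \<Rightarrow> 'v) set \<Rightarrow> nat \<Rightarrow> (('v \<Rightarrow> 'v) \<Rightarrow> 'f::field mat) \<Rightarrow> bool" where
  "matrix_rep W n \<rho> \<longleftrightarrow>
     (\<forall>w\<in>W. \<rho> w \<in> carrier_mat n n) \<and> \<rho> id = 1\<^sub>m n \<and> (\<forall>u\<in>W. \<forall>w\<in>W. \<rho> (u \<circ> w) = \<rho> u * \<rho> w)"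

definition irreducible_rep :: "('v \<Rightarrow> 'v) set \<Rightarrow> nat \<Rightarrow> (('v \<Rightarrow> 'v) \<Rightarrow> 'f::field mat) \<Rightarrow> bool" where
  "irreducible_rep W n \<rho> \<longleftrightarrow>
     matrix_rep W n \<rho> \<and> n > 0 \<and>
     (\<forall>U \<subseteq> carrier_vec n.
        0\<^sub>v n \<in> U \<and> (\<forall>x\<in>U. \<forall>y\<in>U. x + y \<in> U) \<and> (\<forall>a. \<forall>x\<in>U. a \<cdot>\<^sub>v x \<in> U) \<and>
        (\<forall>w\<in>W. \<forall>x\<in>U. \<rho> w *\<^sub>v x \<in> U)
        \<longrightarrow> U = {0\<^sub>v n} \<or> U = carrier_vec n)"

text \<open>
  Since \<open>'k\<close> need not be a subfield of the complex numbers, the irreducible representations are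
  taken over its algebraic closure; each is required to be the extension of scalars, up to
  isomorphism, of a representation over \<open>'k\<close>.
\<close>

definition all_irreps_realizable :: "'k::field itself \<Rightarrow> ('v \<Rightarrow> 'v) set \<Rightarrow> bool" where
  "all_irreps_realizable _ W \<longleftrightarrow>
     (\<forall>n (\<rho> :: ('v \<Rightarrow> 'v) \<Rightarrow> 'k alg_closure mat). irreducible_rep W n \<rho> \<longrightarrow>
        (\<exists>(\<sigma> :: ('v \<Rightarrow> 'v) \<Rightarrow> 'k mat) P Q. matrix_rep W n \<sigma> \<and>
           (\<forall>w\<in>W. similar_mat_wit (\<rho> w) (map_mat to_ac (\<sigma> w)) P Q)))"


section \<open>The group algebra as a Lie algebra\<close>

text \<open>
  Finitely supported functions \<open>'g \<Rightarrow>\<^sub>0 'k\<close> are the free \<open>'k\<close>-vector space on \<open>'g\<close>.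
\<close>

definition fscale :: "'k::field \<Rightarrow> ('g \<Rightarrow>\<^sub>0 'k) \<Rightarrow> ('g \<Rightarrow>\<^sub>0 'k)" where
  "fscale a x = Poly_Mapping.map ((*) a) x"

lemma lookup_fscale [simp]: "Poly_Mapping.lookup (fscale a x) g = a * Poly_Mapping.lookup x g"
  by (simp add: fscale_def Poly_Mapping.map.rep_eq when_def)

interpretation free: vector_space "fscale :: 'k::field \<Rightarrow> ('g \<Rightarrow>\<^sub>0 'k) \<Rightarrow> ('g \<Rightarrow>\<^sub>0 'k)"
  by unfold_locales (auto intro!: poly_mapping_eqI simp: lookup_add algebra_simps)

definition gmult ::
    "(('v \<Rightarrow> 'v) \<Rightarrow>\<^sub>0 'k::field) \<Rightarrow> (('v \<Rightarrow> 'v) \<Rightarrow>\<^sub>0 'k) \<Rightarrow> (('v \<Rightarrow> 'v) \<Rightarrow>\<^sub>0 'k)" where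
  "gmult x y = (\<Sum>g\<in>Poly_Mapping.keys x. \<Sum>h\<in>Poly_Mapping.keys y.
     Poly_Mapping.single (g \<circ> h) (Poly_Mapping.lookup x g * Poly_Mapping.lookup y h))"

definition group_algebra :: "('v \<Rightarrow> 'v) set \<Rightarrow> (('v \<Rightarrow> 'v) \<Rightarrow>\<^sub>0 'k::field) set" where
  "group_algebra W = {x. Poly_Mapping.keys x \<subseteq> W}"

definition lie_bracket ::
    "(('v \<Rightarrow> 'v) \<Rightarrow>\<^sub>0 'k::field) \<Rightarrow> (('v \<Rightarrow> 'v) \<Rightarrow>\<^sub>0 'k) \<Rightarrow> (('v \<Rightarrow> 'v) \<Rightarrow>\<^sub>0 'k)" where
  "lie_bracket x y = gmult x y - gmult y x"

definition lie_subalgebra ::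
    "(('v \<Rightarrow> 'v) \<Rightarrow>\<^sub>0 'k::field) set \<Rightarrow> (('v \<Rightarrow> 'v) \<Rightarrow>\<^sub>0 'k) set \<Rightarrow> bool" where
  "lie_subalgebra L A \<longleftrightarrow>
     L \<subseteq> A \<and> free.subspace L \<and> (\<forall>x\<in>L. \<forall>y\<in>L. lie_bracket x y \<in> L)"

definition lie_generated ::
    "(('v \<Rightarrow> 'v) \<Rightarrow>\<^sub>0 'k::field) set \<Rightarrow> (('v \<Rightarrow> 'v) \<Rightarrow>\<^sub>0 'k) set \<Rightarrow> (('v \<Rightarrow> 'v) \<Rightarrow>\<^sub>0 'k) set" where
  "lie_generated A T = \<Inter>{L. lie_subalgebra L A \<and> T \<subseteq> L}"

definition lie_derived ::
    "(('v \<Rightarrow> 'v) \<Rightarrow>\<^sub>0 'k::field) set \<Rightarrow> (('v \<Rightarrow> 'v) \<Rightarrow>\<^sub>0 'k) set" where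
  "lie_derived L = free.span {lie_bracket x y | x y. x \<in> L \<and> y \<in> L}"

definition lie_center ::
    "(('v \<Rightarrow> 'v) \<Rightarrow>\<^sub>0 'k::field) set \<Rightarrow> (('v \<Rightarrow> 'v) \<Rightarrow>\<^sub>0 'k) set" where
  "lie_center L = {x \<in> L. \<forall>y\<in>L. lie_bracket x y = 0}"

definition lie_ideal ::
    "(('v \<Rightarrow> 'v) \<Rightarrow>\<^sub>0 'k::field) set \<Rightarrow> (('v \<Rightarrow> 'v) \<Rightarrow>\<^sub>0 'k) set \<Rightarrow> bool" where
  "lie_ideal I L \<longleftrightarrow> I \<subseteq> L \<and> free.subspace I \<and> (\<forall>x\<in>L. \<forall>y\<in>I. lie_bracket x y \<in> I)"

definition lie_solvable :: "(('v \<Rightarrow> 'v) \<Rightarrow>\<^sub>0 'k::field) set \<Rightarrow> bool" where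
  "lie_solvable L \<longleftrightarrow> (\<exists>n. (lie_derived ^^ n) L = {0})"

text \<open>In finite dimension the sum of all solvable ideals is the largest solvable ideal.\<close>

definition lie_radical ::
    "(('v \<Rightarrow> 'v) \<Rightarrow>\<^sub>0 'k::field) set \<Rightarrow> (('v \<Rightarrow> 'v) \<Rightarrow>\<^sub>0 'k) set" where
  "lie_radical L = free.span (\<Union>{I. lie_ideal I L \<and> lie_solvable I})"

definition lie_reductive :: "(('v \<Rightarrow> 'v) \<Rightarrow>\<^sub>0 'k::field) set \<Rightarrow> bool" where
  "lie_reductive L \<longleftrightarrow> lie_radical L = lie_center L"


section \<open>The Lie algebras generated by reflections\<close>

abbreviation basis_elem :: "('v \<Rightarrow> 'v) \<Rightarrow> (('v \<Rightarrow> 'v) \<Rightarrow>\<^sub>0 'k::field)" where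
  "basis_elem g \<equiv> Poly_Mapping.single g 1"

definition hecke_lie ::
    "(complex \<Rightarrow> 'v \<Rightarrow> 'v) \<Rightarrow> ('v::ab_group_add \<Rightarrow> 'v) set \<Rightarrow> (('v \<Rightarrow> 'v) \<Rightarrow>\<^sub>0 'k::field) set" where
  "hecke_lie sc W = lie_generated (group_algebra W) (basis_elem ` reflections sc W)"

text \<open>
  A family \<open>(\<lambda>\<^sup>c\<^sub>i)\<close>, with \<open>c\<close> in \<open>C_plus\<close> and \<open>1 \<le> i \<le> e\<^sub>c - 1\<close>, is encoded as a finitely
  supported function on pairs \<open>(c, i)\<close> that vanishes outside this index set.
\<close>

definition param_space ::
    "(complex \<Rightarrow> 'v \<Rightarrow> 'v) \<Rightarrow> ('v::ab_group_add \<Rightarrow> 'v) set \<Rightarrow> ('v \<Rightarrow> 'v) set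
       \<Rightarrow> (('v \<Rightarrow> 'v) set \<times> nat \<Rightarrow>\<^sub>0 'k::field) set" where
  "param_space sc W S =
     {lam. Poly_Mapping.keys lam \<subseteq> (SIGMA c:C_plus sc W S. {1..class_order sc c - 1})}"

definition hecke_lie_param ::
    "(complex \<Rightarrow> 'v \<Rightarrow> 'v) \<Rightarrow> ('v::ab_group_add \<Rightarrow> 'v) set \<Rightarrow> ('v \<Rightarrow> 'v) set
       \<Rightarrow> (('v \<Rightarrow> 'v) set \<times> nat \<Rightarrow>\<^sub>0 'k::field) \<Rightarrow> (('v \<Rightarrow> 'v) \<Rightarrow>\<^sub>0 'k) set" where
  "hecke_lie_param sc W S lam = lie_generated (group_algebra W)
     (basis_elem ` S_zero sc S \<union>
      {\<Sum>i = 1..class_order sc c - 1. fscale (Poly_Mapping.lookup lam (c, i)) (basis_elem (s ^^ i))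
        | c s. c \<in> C_plus sc W S \<and> s \<in> c})"

end

theory Submission
  imports Defs
begin

text \<open>
  The Lie algebra \<open>H\<close> generated by the reflections and the Lie algebras of the parameters are stable
  under conjugation by \<open>W\<close>, and their reductivity comes from this stability.  If a commutator \<open>[x, y]\<close> commutes with \<open>y\<close>, then it is nilpotent
  (\<open>nilpotent_commutator\<close>).  If the adjoint action of a stable Lie algebra \<open>L\<close> preserves a family
  of commuting nilpotent elements, they kill every simple \<open>L\<close>-submodule of the group algebra; these
  submodules span a left ideal, which by Maschke's theorem has a complement, and the complement
  contains no simple submodule.  So they span everything, and the nilpotent elements vanish
  (\<open>normalized_nilpotents_vanish\<close>).  Applied to commutators, this makes abelian ideals central and
  then, along the derived series, all solvable ideals.

  For the second half, let \<open>s \<in> S\<close> have order \<open>e\<close> and let \<open>x\<^sub>s\<close> be the generator that belongs to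
  it.  Over the algebraic closure the group algebra is a sum of common eigenspaces of the left and
  right multiplications by \<open>s\<close>, with eigenvalues \<open>\<alpha>\<close> and \<open>\<beta>\<close>, and on such an eigenspace the adjoint
  action of \<open>x\<^sub>s\<close> is a scalar \<open>\<mu>(\<alpha>) - \<mu>(\<beta>)\<close>.  If these scalars are distinct for distinct pairs
  with \<open>\<alpha> \<noteq> \<beta>\<close>, interpolation writes \<open>y \<mapsto> [s\<^sup>i, y] s\<^sup>l\<close> as a polynomial without constant term in
  the adjoint action of \<open>x\<^sub>s\<close> (\<open>power_operator_is_polynomial_in_adjoint\<close>).  A coincidence between
  two of the scalars is a nontrivial linear condition on the coefficients; the hyperplanes to be
  avoided come from these conditions.

  Let \<open>L\<close> be the Lie algebra of a generic parameter and \<open>D\<close> its derived algebra.  By the previous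
  paragraph, \<open>[H, L] \<subseteq> D\<close>, conjugation by \<open>W\<close> is trivial on \<open>L/D\<close>, and an element that commutes with
  all generators \<open>x\<^sub>s\<close> is central in the group algebra.  Hence \<open>L\<close> is the sum of \<open>D\<close> and the span \<open>Z\<close>
  of the class sums of the generators.  The class sums have disjoint supports, and the sum is direct
  because a central element that is a sum of commutators vanishes; so \<open>Z\<close> is the centre and has the
  required dimension.

  It remains to compare \<open>D\<close> with \<open>H'\<close>.  The form that maps \<open>(x, y)\<close> to the coefficient of the
  identity in \<open>xy\<close> is nondegenerate on \<open>H\<close> (\<open>trace_form_nondegenerate\<close>), because \<open>H\<close> is defined
  over the rational numbers and there the form is a sum of squares, up to inversion of the group
  elements.  The radical of the form on the ideal \<open>D\<close> of \<open>H\<close> is an abelian ideal of \<open>H\<close>, hence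
  zero.  Every reflection is therefore the sum of an element of \<open>D\<close> and an element of \<open>H\<close>
  orthogonal to \<open>D\<close>.  The latter commutes with \<open>D\<close> and \<open>Z\<close>, so it is central, and \<open>H' = [H, H]\<close> is
  contained in \<open>D\<close>.

  This uses that every reflection is a power of an element of \<open>S\<close> (\<open>reflection_is_power\<close>).  It
  follows from the linear character of \<open>W\<close> through which \<open>W\<close> acts on the product of the equations
  of the hyperplanes in one orbit.
\<close>

section \<open>Linear algebra\<close>

lemma (in vector_space) exists_functional:
  assumes "v \<noteq> 0"
  obtains \<phi> where "\<And>x y. \<phi> (x + y) = \<phi> x + \<phi> y" "\<And>a x. \<phi> (scale a x) = a * \<phi> x" "\<phi> v = 1"
proof -
  have ind: "independent {v}" using assms by simp
  define B where "B = extend_basis {v}"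
  have B: "independent B" "span B = UNIV" "v \<in> B"
    using independent_extend_basis[OF ind] span_extend_basis[OF ind] extend_basis_superset[OF ind]
    by (auto simp: B_def)
  show ?thesis
  proof
    fix x y a
    show "representation B (x + y) v = representation B x v + representation B y v"
      by (subst representation_add) (use B in auto)
    show "representation B (scale a x) v = a * representation B x v"
      by (subst representation_scale) (use B in auto)
    show "representation B v v = 1"
      by (subst representation_basis) (use B in auto)
  qed
qed

lemma (in vector_space) finite_basis_of_subspace:
  assumes "subspace U" "U \<subseteq> span A" "finite A"
  obtains B where "finite B" "B \<subseteq> U" "independent B" "span B = U" "card B = dim U"
proof -
  obtain B where B: "B \<subseteq> U" "independent B" "U \<subseteq> span B" "card B = dim U"
    using basis_exists by blast
  moreover have "finite B"
    using independent_span_bound[of A B] assms B by blast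
  moreover have "span B = U"
    using B assms(1) span_minimal by blast
  ultimately show ?thesis using that by blast
qed

lemma (in vector_space) subspace_eq_if_dim_le:
  assumes "subspace U" "subspace V" "U \<subseteq> V" "V \<subseteq> span A" "finite A" "dim V \<le> dim U"
  shows "U = V"
proof (rule ccontr)
  assume "U \<noteq> V"
  then obtain v where v: "v \<in> V" "v \<notin> U" using assms by blast
  obtain B where B: "finite B" "B \<subseteq> U" "independent B" "span B = U" "card B = dim U"
    using finite_basis_of_subspace[of U A] assms by blast
  obtain C where C: "finite C" "C \<subseteq> V" "independent C" "span C = V" "card C = dim V"
    using finite_basis_of_subspace[of V A] assms by blast
  have "independent (insert v B)" using B v by (simp add: independent_insertI)
  moreover have "insert v B \<subseteq> span C" using B C v assms by auto
  ultimately have "card (insert v B) \<le> card C"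
    using independent_span_bound[of C "insert v B"] C by blast
  moreover have "v \<notin> B" using v B by blast
  ultimately show False using B C assms by simp
qed

lemma (in vector_space) linear_relation_of_sequence:
  fixes v :: "nat \<Rightarrow> 'b"
  assumes "range v \<subseteq> span A" "finite A"
  obtains n c where "(\<Sum>i<n. scale (c i) (v i)) = 0" "\<exists>i<n. c i \<noteq> 0"
proof (cases "inj v")
  case True
  define n where "n = Suc (card A)"
  have "card (v ` {..<n}) = n" using True by (simp add: card_image inj_on_subset)
  hence "dependent (v ` {..<n})"
    using independent_span_bound[of A "v ` {..<n}"] assms by (auto simp: n_def)
  then obtain u where u: "(\<Sum>x\<in>v ` {..<n}. scale (u x) x) = 0" "\<exists>x\<in>v ` {..<n}. u x \<noteq> 0"
    by (auto simp: dependent_finite)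
  have "inj_on v {..<n}" using True by (rule inj_on_subset) simp
  hence "(\<Sum>i<n. scale (u (v i)) (v i)) = 0"
    using u(1) by (simp add: sum.reindex)
  moreover have "\<exists>i<n. u (v i) \<noteq> 0" using u(2) by auto
  ultimately show ?thesis using that[where n = n and c = "\<lambda>i. u (v i)"] by blast
next
  case False
  then obtain i j where ij: "i < j" "v i = v j" by (metis injI linorder_neqE_nat)
  define c where "c = (\<lambda>l. if l = i then 1 else if l = j then - 1 else 0 :: 'a)"
  have "(\<Sum>l<Suc j. scale (c l) (v l)) = (\<Sum>l\<in>{i,j}. scale (c l) (v l))"
    using ij by (intro sum.mono_neutral_right) (auto simp: c_def)
  also have "\<dots> = 0" using ij by (simp add: c_def)
  finally show ?thesis using that[where n = "Suc j" and c = c] ij by (force simp: c_def)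
qed

section \<open>The multiplication of the group algebra\<close>

type_synonym ('v, 'k) group_ring = "('v \<Rightarrow> 'v) \<Rightarrow>\<^sub>0 'k"

type_synonym ('v, 'k) parameter = "('v \<Rightarrow> 'v) set \<times> nat \<Rightarrow>\<^sub>0 'k"


lemma gmult_eq_sum:
  assumes "finite A" "finite B" "Poly_Mapping.keys x \<subseteq> A" "Poly_Mapping.keys y \<subseteq> B"
  shows "gmult x y = (\<Sum>g\<in>A. \<Sum>h\<in>B. Poly_Mapping.single (g \<circ> h) (Poly_Mapping.lookup x g * Poly_Mapping.lookup y h))"
proof -
  have "gmult x y = (\<Sum>g\<in>Poly_Mapping.keys x. \<Sum>h\<in>B. Poly_Mapping.single (g \<circ> h) (Poly_Mapping.lookup x g * Poly_Mapping.lookup y h))"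
    unfolding gmult_def using assms
    by (intro sum.cong refl sum.mono_neutral_left) (auto simp: in_keys_iff)
  also have "\<dots> = (\<Sum>g\<in>A. \<Sum>h\<in>B. Poly_Mapping.single (g \<circ> h) (Poly_Mapping.lookup x g * Poly_Mapping.lookup y h))"
    using assms by (intro sum.mono_neutral_left) (auto simp: in_keys_iff)
  finally show ?thesis .
qed

lemma gmult_add_left: "gmult (x + y) z = gmult x z + gmult y z"
proof -
  let ?A = "Poly_Mapping.keys x \<union> Poly_Mapping.keys y"
  have "Poly_Mapping.keys (x + y) \<subseteq> ?A" by (rule keys_add)
  thus ?thesis
    by (subst (1 2 3) gmult_eq_sum[of ?A "Poly_Mapping.keys z"])
      (auto simp: lookup_add distrib_right single_add sum.distrib)
qed

lemma gmult_add_right: "gmult z (x + y) = gmult z x + gmult z y"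
proof -
  let ?A = "Poly_Mapping.keys x \<union> Poly_Mapping.keys y"
  have "Poly_Mapping.keys (x + y) \<subseteq> ?A" by (rule keys_add)
  thus ?thesis
    by (subst (1 2 3) gmult_eq_sum[of "Poly_Mapping.keys z" ?A])
      (auto simp: lookup_add distrib_left single_add sum.distrib)
qed

lemma keys_fscale: "Poly_Mapping.keys (fscale a x) \<subseteq> Poly_Mapping.keys x"
  by (auto simp: in_keys_iff)

lemma fscale_single [simp]: "fscale a (Poly_Mapping.single g b) = Poly_Mapping.single g (a * b)"
  by (rule poly_mapping_eqI) (simp add: lookup_single when_def)

lemma fscale_sum: "fscale a (sum f A) = (\<Sum>i\<in>A. fscale a (f i))"
  by (rule free.scale_sum_right)

lemma gmult_fscale_left [simp]: "gmult (fscale a x) y = fscale a (gmult x y)"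
  using keys_fscale[of a x]
  by (subst (1 2) gmult_eq_sum[of "Poly_Mapping.keys x" "Poly_Mapping.keys y"]) (auto simp: fscale_sum mult.assoc)

lemma gmult_fscale_right [simp]: "gmult x (fscale a y) = fscale a (gmult x y)"
  using keys_fscale[of a y]
  by (subst (1 2) gmult_eq_sum[of "Poly_Mapping.keys x" "Poly_Mapping.keys y"]) (auto simp: fscale_sum mult.left_commute)

lemma gmult_zero_left [simp]: "gmult 0 x = 0" and gmult_zero_right [simp]: "gmult x 0 = 0"
  by (simp_all add: gmult_def)

lemma gmult_minus_left [simp]: "gmult (- x) y = - gmult x y"
  by (metis add_eq_0_iff gmult_add_left gmult_zero_left)

lemma gmult_minus_right [simp]: "gmult x (- y) = - gmult x y"
  by (metis add_eq_0_iff gmult_add_right gmult_zero_right)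

lemma gmult_diff_left: "gmult (x - y) z = gmult x z - gmult y z"
  using gmult_add_left[of x "- y" z] by simp

lemma gmult_diff_right: "gmult z (x - y) = gmult z x - gmult z y"
  using gmult_add_right[of z x "- y"] by simp

lemma gmult_sum_left: "gmult (sum f A) y = (\<Sum>i\<in>A. gmult (f i) y)"
  by (induction A rule: infinite_finite_induct) (auto simp: gmult_add_left)

lemma gmult_sum_right: "gmult y (sum f A) = (\<Sum>i\<in>A. gmult y (f i))"
  by (induction A rule: infinite_finite_induct) (auto simp: gmult_add_right)

lemma gmult_single [simp]:
  "gmult (Poly_Mapping.single g a) (Poly_Mapping.single h b) = Poly_Mapping.single (g \<circ> h) (a * b)"
  by (subst gmult_eq_sum[of "{g}" "{h}"]) auto

lemma sum_monomials: "(\<Sum>g\<in>Poly_Mapping.keys x. fscale (Poly_Mapping.lookup x g) (basis_elem g)) = (x :: _ \<Rightarrow>\<^sub>0 'k::field)"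
  by (rule poly_mapping_eqI)
    (simp add: lookup_sum lookup_single when_def in_keys_iff)

lemma group_algebra_eq_span:
  "group_algebra W = (free.span (basis_elem ` W) :: (_ \<Rightarrow>\<^sub>0 'a::field) set)"
proof
  show "group_algebra W \<subseteq> (free.span (basis_elem ` W) :: (_ \<Rightarrow>\<^sub>0 'a) set)"
  proof
    fix x :: "_ \<Rightarrow>\<^sub>0 'a" assume "x \<in> group_algebra W"
    thus "x \<in> free.span (basis_elem ` W)"
      by (subst sum_monomials[of x, symmetric])
        (intro free.span_sum free.span_scale free.span_base, auto simp: group_algebra_def)
  qed
  show "free.span (basis_elem ` W) \<subseteq> (group_algebra W :: (_ \<Rightarrow>\<^sub>0 'a) set)"
  proof (rule free.span_minimal)
    show "free.subspace (group_algebra W :: (_ \<Rightarrow>\<^sub>0 'a) set)"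
    proof (rule free.subspaceI)
      show "x + y \<in> group_algebra W" if "x \<in> group_algebra W" "y \<in> group_algebra W"
        for x y :: "_ \<Rightarrow>\<^sub>0 'a"
        using that keys_add[of x y] unfolding group_algebra_def by simp (meson Un_least subset_trans)
      show "fscale c x \<in> group_algebra W" if "x \<in> group_algebra W" for c and x :: "_ \<Rightarrow>\<^sub>0 'a"
        using that keys_fscale[of c x] unfolding group_algebra_def by simp
    qed (simp add: group_algebra_def)
  qed (auto simp: group_algebra_def)
qed

lemma subspace_group_algebra [simp]: "free.subspace (group_algebra W)"
  by (simp add: group_algebra_eq_span)

lemma group_algebra_induct [consumes 1, case_names basis zero add scale]:
  assumes "x \<in> group_algebra W"
    and "\<And>w. w \<in> W \<Longrightarrow> P (basis_elem w)" "P 0" "\<And>x y. P x \<Longrightarrow> P y \<Longrightarrow> P (x + y)"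
    and "\<And>a x. P x \<Longrightarrow> P (fscale a x)"
  shows "P x"
  using assms(1) unfolding group_algebra_eq_span
  by (induction rule: free.span_induct) (use assms in \<open>auto simp: free.subspace_def\<close>)

lemma basis_elem_induct [case_names basis zero add scale]:
  assumes "\<And>w. P (basis_elem w)" "P 0" "\<And>x y. P x \<Longrightarrow> P y \<Longrightarrow> P (x + y)"
    and "\<And>a x. P x \<Longrightarrow> P (fscale a x)"
  shows "P x"
  by (rule group_algebra_induct[of x UNIV]) (use assms in \<open>auto simp: group_algebra_def\<close>)

lemma gmult_assoc: "gmult (gmult x y) z = gmult x (gmult y z)"
proof (induction x rule: basis_elem_induct)
  case (basis u)
  show ?case
  proof (induction y rule: basis_elem_induct)
    case (basis v)
    show ?case
      by (induction z rule: basis_elem_induct) (auto simp: gmult_add_right comp_assoc)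
  qed (auto simp: gmult_add_right gmult_add_left)
qed (auto simp: gmult_add_left)

lemma gmult_id_left [simp]: "gmult (basis_elem id) x = x"
  by (induction x rule: basis_elem_induct) (simp_all add: gmult_add_right comp_def)

lemma gmult_id_right [simp]: "gmult x (basis_elem id) = x"
  by (induction x rule: basis_elem_induct) (simp_all add: gmult_add_left comp_def)

lemmas gmult_distrib = gmult_add_left gmult_add_right gmult_diff_left gmult_diff_right

definition gpow :: "(('v, 'k::field) group_ring) \<Rightarrow> nat \<Rightarrow> (('v, 'k) group_ring)" where
  "gpow x n = (gmult x ^^ n) (basis_elem id)"

lemma gpow_0 [simp]: "gpow x 0 = basis_elem id" by (simp add: gpow_def)

lemma gpow_Suc: "gpow x (Suc n) = gmult x (gpow x n)" by (simp add: gpow_def)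

lemma gpow_add: "gpow x (m + n) = gmult (gpow x m) (gpow x n)"
  by (induction m) (auto simp: gpow_Suc gmult_assoc)

lemma gpow_commute:
  assumes "gmult x y = gmult y x"
  shows "gmult (gpow x n) y = gmult y (gpow x n)"
proof (induction n)
  case (Suc n)
  have "gmult (gpow x (Suc n)) y = gmult x (gmult y (gpow x n))"
    by (simp add: gpow_Suc gmult_assoc Suc)
  also have "\<dots> = gmult y (gpow x (Suc n))"
    by (metis assms gmult_assoc gpow_Suc)
  finally show ?case .
qed simp

section \<open>The commutator bracket\<close>

lemma lie_bracket_add_left: "lie_bracket (x + y) z = lie_bracket x z + lie_bracket y z"
  and lie_bracket_add_right: "lie_bracket z (x + y) = lie_bracket z x + lie_bracket z y"
  and lie_bracket_diff_left: "lie_bracket (x - y) z = lie_bracket x z - lie_bracket y z"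
  and lie_bracket_diff_right: "lie_bracket z (x - y) = lie_bracket z x - lie_bracket z y"
  by (simp_all add: lie_bracket_def gmult_distrib)

lemma lie_bracket_zero [simp]: "lie_bracket 0 x = 0" "lie_bracket x 0 = 0"
  by (simp_all add: lie_bracket_def)

lemma lie_bracket_fscale [simp]:
  "lie_bracket (fscale a x) y = fscale a (lie_bracket x y)"
  "lie_bracket x (fscale a y) = fscale a (lie_bracket x y)"
  by (simp_all add: lie_bracket_def free.scale_right_diff_distrib)

lemma lie_bracket_sum_right: "lie_bracket y (sum f A) = (\<Sum>i\<in>A. lie_bracket y (f i))"
  by (simp add: lie_bracket_def gmult_sum_left gmult_sum_right sum_subtractf)

lemma lie_bracket_minus_swap: "lie_bracket y x = - lie_bracket x y"
  by (simp add: lie_bracket_def)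

lemma lie_bracket_eq_0_iff: "lie_bracket x y = 0 \<longleftrightarrow> gmult x y = gmult y x"
  by (simp add: lie_bracket_def)

lemma lie_bracket_jacobi:
  "lie_bracket x (lie_bracket y z) = lie_bracket (lie_bracket x y) z + lie_bracket y (lie_bracket x z)"
  by (simp add: lie_bracket_def gmult_distrib gmult_assoc)

lemma lie_bracket_leibniz:
  "lie_bracket x (gmult y z) = gmult (lie_bracket x y) z + gmult y (lie_bracket x z)"
  by (simp add: lie_bracket_def gmult_distrib gmult_assoc)

section \<open>Lie subalgebras\<close>

lemma lie_subalgebra_lie_generated:
  assumes "T \<subseteq> A" "lie_subalgebra A A"
  shows "lie_subalgebra (lie_generated A T) A"
  using assms unfolding lie_subalgebra_def lie_generated_def
  by (auto intro!: free.subspace_Inter)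

lemma lie_generated_superset: "T \<subseteq> lie_generated A T"
  by (auto simp: lie_generated_def)

lemma lie_generated_minimal: "lie_subalgebra L A \<Longrightarrow> T \<subseteq> L \<Longrightarrow> lie_generated A T \<subseteq> L"
  by (auto simp: lie_generated_def)

lemma subspace_lie_derived [simp]: "free.subspace (lie_derived L)"
  by (simp add: lie_derived_def)

lemma lie_bracket_in_derived: "x \<in> L \<Longrightarrow> y \<in> L \<Longrightarrow> lie_bracket x y \<in> lie_derived L"
  unfolding lie_derived_def by (rule free.span_base) blast

lemma lie_derived_subset:
  assumes "free.subspace M" "\<And>x y. x \<in> L \<Longrightarrow> y \<in> L \<Longrightarrow> lie_bracket x y \<in> M"
  shows "lie_derived L \<subseteq> M"
  unfolding lie_derived_def by (rule free.span_minimal) (use assms in auto)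

lemma lie_derived_mono: "L \<subseteq> M \<Longrightarrow> lie_derived L \<subseteq> lie_derived M"
  by (rule lie_derived_subset) (auto intro: lie_bracket_in_derived)

text \<open>Closure under brackets is the Jacobi identity; it can be applied because \<open>D \<subseteq> L\<close>.\<close>

lemma lie_subalgebra_transporter:
  assumes A: "lie_subalgebra A A" and "free.subspace D" "D \<subseteq> L"
  shows "lie_subalgebra {x \<in> A. \<forall>y\<in>L. lie_bracket x y \<in> D} A"
proof -
  have "lie_bracket (lie_bracket x y) z \<in> D"
    if "\<forall>z\<in>L. lie_bracket x z \<in> D" "\<forall>z\<in>L. lie_bracket y z \<in> D" "z \<in> L" for x y z
  proof -
    have "lie_bracket (lie_bracket x y) z
        = lie_bracket x (lie_bracket y z) - lie_bracket y (lie_bracket x z)"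
      by (simp add: lie_bracket_jacobi[of x y z])
    also have "\<dots> \<in> D" using that assms by (intro free.subspace_diff) blast+
    finally show ?thesis .
  qed
  thus ?thesis using assms unfolding lie_subalgebra_def
    by (auto simp: free.subspace_def lie_bracket_add_left)
qed

section \<open>Nilpotent commutators\<close>

lemma lie_bracket_gpow:
  assumes "gmult (lie_bracket x y) y = gmult y (lie_bracket x y)"
  shows "lie_bracket x (gpow y n) = fscale (of_nat n) (gmult (gpow y (n - 1)) (lie_bracket x y))"
proof (induction n)
  case 0
  show ?case by (simp add: lie_bracket_def)
next
  case (Suc n)
  let ?z = "lie_bracket x y"
  have "gmult ?z (gpow y n) = gmult (gpow y n) ?z"
    using gpow_commute[of y ?z n] assms by simp
  hence "lie_bracket x (gpow y (Suc n))
      = gmult (gpow y n) ?z + fscale (of_nat n) (gmult (gmult y (gpow y (n - 1))) ?z)"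
    by (simp add: gpow_Suc lie_bracket_leibniz Suc gmult_assoc)
  also have "gmult y (gpow y (n - 1)) = gpow y n" if "n > 0"
    using that by (metis Suc_pred' gpow_Suc)
  hence "fscale (of_nat n) (gmult (gmult y (gpow y (n - 1))) ?z) = fscale (of_nat n) (gmult (gpow y n) ?z)"
    by (cases "n = 0") auto
  finally show ?case by (simp add: free.scale_left_distrib add.commute)
qed

text \<open>The derivation \<open>ad x\<close> maps \<open>y\<^sup>i\<close> to \<open>i y\<^sup>i\<^sup>-\<^sup>1 z\<close>, so it lowers the degree in \<open>y\<close> of the
  relation \<open>P z\<^sup>m = 0\<close>.  It also produces the term \<open>P [x, z\<^sup>m]\<close>, where \<open>x\<close> and \<open>z\<close> need not commute;
  multiplying by \<open>z\<^sup>m\<close> from the left removes this term, since \<open>z\<^sup>m P = P z\<^sup>m = 0\<close>.  In characteristic 0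
  the descent ends with a nonzero multiple of a power of \<open>z\<close>.\<close>

lemma nilpotent_commutator_of_relation:
  fixes x y :: "('v, 'k::field_char_0) group_ring"
  defines "z \<equiv> lie_bracket x y"
  assumes comm: "gmult z y = gmult y z"
    and rel: "(\<Sum>i<n. fscale (c i) (gmult (gpow y i) (gpow z m))) = 0" and nz: "\<exists>i<n. c i \<noteq> 0"
  shows "\<exists>j. gpow z j = 0"
  using rel nz
proof (induction n arbitrary: c m)
  case 0
  thus ?case by simp
next
  case (Suc n)
  define c' where "c' i = of_nat (Suc i) * c (Suc i)" for i
  define P where "P = (\<Sum>i<Suc n. fscale (c i) (gpow y i))"
  define P' where "P' = (\<Sum>i<n. fscale (c' i) (gpow y i))"
  have P0: "gmult P (gpow z m) = 0"
    using Suc.prems(1) by (simp add: P_def gmult_sum_left del: sum.lessThan_Suc)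
  have zy: "gmult (gpow z m) (gpow y i) = gmult (gpow y i) (gpow z m)" for i
    by (intro gpow_commute) (metis gpow_commute comm)
  have zP: "gmult (gpow z m) P = gmult P (gpow z m)"
    unfolding P_def gmult_sum_left gmult_sum_right
    by (simp only: gmult_fscale_left gmult_fscale_right zy)
  have zP': "gmult (gpow z m) P' = gmult P' (gpow z m)"
    unfolding P'_def gmult_sum_left gmult_sum_right
    by (simp only: gmult_fscale_left gmult_fscale_right zy)
  have "lie_bracket x P = (\<Sum>i<Suc n. fscale (c i * of_nat i) (gmult (gpow y (i - 1)) z))"
    using comm by (simp add: P_def lie_bracket_sum_right lie_bracket_gpow z_def del: sum.lessThan_Suc)
  also have "\<dots> = gmult P' z"
    by (subst sum.lessThan_Suc_shift) (simp add: P'_def c'_def gmult_sum_left mult.commute)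
  finally have DP: "lie_bracket x P = gmult P' z" .
  have "0 = gmult (gpow z m) (lie_bracket x (gmult P (gpow z m)))"
    by (simp add: P0)
  also have "\<dots> = gmult (gmult (gpow z m) P') (gmult z (gpow z m))
      + gmult (gmult (gpow z m) P) (lie_bracket x (gpow z m))"
    by (simp add: lie_bracket_leibniz gmult_distrib DP gmult_assoc)
  also have "\<dots> = gmult P' (gpow z (m + Suc m))"
    by (simp only: zP zP' P0 gpow_add gpow_Suc gmult_assoc gmult_zero_left add_0_right)
  finally have "(\<Sum>i<n. fscale (c' i) (gmult (gpow y i) (gpow z (m + Suc m)))) = 0"
    by (simp add: P'_def gmult_sum_left)
  note IH = Suc.IH[OF this]
  show ?case
  proof (cases "\<exists>i<n. c' i \<noteq> 0")
    case True
    thus ?thesis by (rule IH)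
  next
    case False
    hence c0: "c (Suc i) = 0" if "i < n" for i using that by (auto simp: c'_def simp del: of_nat_Suc)
    have c: "c 0 \<noteq> 0" using Suc.prems(2) c0 by (metis Suc_less_eq not0_implies_Suc)
    have "fscale (c 0) (gpow z m) = 0"
      using Suc.prems(1) by (subst (asm) sum.lessThan_Suc_shift) (simp add: c0)
    thus ?thesis using c by auto
  qed
qed

section \<open>Finite groups of transformations and their group algebras\<close>

abbreviation invf :: "('v \<Rightarrow> 'v) \<Rightarrow> ('v \<Rightarrow> 'v)" where
  "invf w \<equiv> inv_into UNIV w"

definition conj_by :: "('v \<Rightarrow> 'v) \<Rightarrow> (('v, 'k::field) group_ring) \<Rightarrow> (('v, 'k) group_ring)" where
  "conj_by w x = gmult (basis_elem w) (gmult x (basis_elem (invf w)))"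

lemma conj_by_linear [simp]:
  "conj_by w (x + y) = conj_by w x + conj_by w y"
  "conj_by w (x - y) = conj_by w x - conj_by w y"
  "conj_by w (fscale a x) = fscale a (conj_by w x)"
  "conj_by w 0 = 0"
  by (simp_all add: conj_by_def gmult_distrib)

lemma conj_by_sum: "conj_by w (sum f A) = (\<Sum>i\<in>A. conj_by w (f i))"
  by (simp add: conj_by_def gmult_sum_left gmult_sum_right)

locale transformation_group =
  fixes W :: "('v \<Rightarrow> 'v) set"
  assumes finite_W: "finite W" and id_in_W: "id \<in> W"
    and comp_in_W: "\<And>u w. u \<in> W \<Longrightarrow> w \<in> W \<Longrightarrow> u \<circ> w \<in> W"
    and ex_inverse: "\<And>w. w \<in> W \<Longrightarrow> \<exists>w'\<in>W. w \<circ> w' = id \<and> w' \<circ> w = id"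
begin

lemma basis_elem_comp: "basis_elem (g \<circ> h) = gmult (basis_elem g) (basis_elem h)"
  by simp

lemma bij_W: "w \<in> W \<Longrightarrow> bij w"
  using ex_inverse[of w] by (auto intro: o_bij)

lemma comp_inv: "w \<in> W \<Longrightarrow> w \<circ> invf w = id"
  by (drule bij_W, drule bij_is_surj) (simp only: surj_iff)

lemma inv_comp: "w \<in> W \<Longrightarrow> invf w \<circ> w = id"
  by (drule bij_W, drule bij_is_inj) (simp only: inj_iff)

lemma inv_in_W:
  assumes "w \<in> W" shows "invf w \<in> W"
proof -
  obtain w' where w': "w' \<in> W" "w \<circ> w' = id" "w' \<circ> w = id"
    using ex_inverse[OF assms] by blast
  show ?thesis using inv_unique_comp[OF w'(2,3)] w'(1) by simp
qed

lemma card_W_pos: "card W > 0"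
  using finite_W id_in_W card_gt_0_iff by blast

lemma basis_elem_in: "w \<in> W \<Longrightarrow> basis_elem w \<in> group_algebra W"
  by (simp add: group_algebra_def)

lemma group_algebra_finite_span:
  "group_algebra W \<subseteq> (free.span (basis_elem ` W) :: (_ \<Rightarrow>\<^sub>0 'k::field) set)" "finite (basis_elem ` W)"
  using finite_W by (auto simp: group_algebra_eq_span)

lemma gmult_in:
  assumes "x \<in> group_algebra W" "y \<in> group_algebra W"
  shows "gmult x y \<in> group_algebra W"
  using assms(1)
proof (induction x rule: group_algebra_induct)
  case (basis u)
  show ?case using assms(2)
  proof (induction y rule: group_algebra_induct)
    case (basis v)
    thus ?case using \<open>u \<in> W\<close> by (simp add: basis_elem_in comp_in_W)
  qed (auto simp: gmult_add_right intro: free.subspace_add free.subspace_scale free.subspace_0)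
qed (auto simp: gmult_add_left intro: free.subspace_add free.subspace_scale free.subspace_0)

lemma lie_subalgebra_group_algebra: "lie_subalgebra (group_algebra W) (group_algebra W)"
  by (auto simp: lie_subalgebra_def lie_bracket_def intro!: free.subspace_diff gmult_in)

lemma gpow_in: "x \<in> group_algebra W \<Longrightarrow> gpow x n \<in> group_algebra W"
  by (induction n) (auto simp: gpow_Suc id_in_W basis_elem_in intro: gmult_in)

lemma basis_elem_inverse:
  fixes x :: "('v, 'k::field) group_ring"
  assumes "w \<in> W"
  shows "gmult (basis_elem w) (gmult (basis_elem (invf w)) x) = x"
    and "gmult (basis_elem (invf w)) (gmult (basis_elem w) x) = x"
proof -
  have "gmult (basis_elem w) (basis_elem (invf w)) = (basis_elem id :: ('v, 'k) group_ring)"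
    and "gmult (basis_elem (invf w)) (basis_elem w) = (basis_elem id :: ('v, 'k) group_ring)"
    by (simp_all only: gmult_single comp_inv[OF assms] inv_comp[OF assms] mult_1)
  thus "gmult (basis_elem w) (gmult (basis_elem (invf w)) x) = x"
    and "gmult (basis_elem (invf w)) (gmult (basis_elem w) x) = x"
    by (simp_all only: gmult_assoc[symmetric] gmult_id_left)
qed

lemma conj_by_gmult:
  assumes "w \<in> W"
  shows "conj_by w (gmult x y) = gmult (conj_by w x) (conj_by w y)"
  using assms by (simp add: conj_by_def gmult_assoc basis_elem_inverse)

lemma conj_by_bracket:
  assumes "w \<in> W"
  shows "conj_by w (lie_bracket x y) = lie_bracket (conj_by w x) (conj_by w y)"
  using assms by (simp add: lie_bracket_def conj_by_gmult)

lemma inv_inv_W: "w \<in> W \<Longrightarrow> invf (invf w) = w"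
  by (simp add: bij_W inv_inv_eq)

lemma inv_comp_W: "u \<in> W \<Longrightarrow> w \<in> W \<Longrightarrow> invf (u \<circ> w) = invf w \<circ> invf u"
  by (simp add: bij_W o_inv_distrib)

lemma conj_by_basis_elem: "conj_by w (basis_elem g) = basis_elem (w \<circ> g \<circ> invf w)"
  by (simp add: conj_by_def comp_assoc)

lemma conj_by_conj_by:
  "u \<in> W \<Longrightarrow> w \<in> W \<Longrightarrow> conj_by u (conj_by w x) = conj_by (u \<circ> w) x"
  by (simp add: conj_by_def inv_comp_W gmult_assoc basis_elem_comp del: gmult_single)

lemma conj_by_id [simp]: "conj_by id x = x"
  by (simp add: conj_by_def)

lemma left_mult_bij:
  assumes "g \<in> W" shows "bij_betw (\<lambda>w. g \<circ> w) W W"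
proof (rule bij_betwI[where g = "\<lambda>w. invf g \<circ> w"])
  show "invf g \<circ> (g \<circ> w) = w" "g \<circ> (invf g \<circ> w) = w" for w
    using assms by (simp_all add: o_assoc comp_inv inv_comp)
qed (use assms in \<open>auto intro: comp_in_W inv_in_W\<close>)

lemma central_if_commutes_with_group:
  assumes "\<And>w. w \<in> W \<Longrightarrow> lie_bracket x (basis_elem w) = 0" "y \<in> group_algebra W"
  shows "lie_bracket x y = 0"
  using assms(2)
  by (induction y rule: group_algebra_induct) (auto simp: assms(1) lie_bracket_add_right)

text \<open>Jacobson's lemma: the powers of \<open>y\<close> satisfy a linear relation because the group algebra is
  finite-dimensional.\<close>

lemma nilpotent_commutator:
  fixes x y :: "('v, 'k::field_char_0) group_ring"
  assumes "y \<in> group_algebra W" "gmult (lie_bracket x y) y = gmult y (lie_bracket x y)"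
  shows "\<exists>j. gpow (lie_bracket x y) j = 0"
proof -
  have "range (gpow y) \<subseteq> free.span (basis_elem ` W)"
    using gpow_in[OF assms(1)] group_algebra_finite_span(1) by blast
  then obtain n c where "(\<Sum>i<n. fscale (c i) (gpow y i)) = 0" "\<exists>i<n. c i \<noteq> 0"
    using free.linear_relation_of_sequence group_algebra_finite_span(2) by metis
  thus ?thesis using nilpotent_commutator_of_relation[where x = x and y = y and n = n and c = c and m = 0] assms(2) by simp
qed

section \<open>Maschke's theorem\<close>

text \<open>The average over \<open>W\<close> of a linear projection onto \<open>U\<close> is a projection that commutes with left
  multiplication by \<open>W\<close>; its kernel is the complement.\<close>

lemma maschke:
  fixes U :: "(('v, 'k::field_char_0) group_ring) set"
  assumes U: "free.subspace U" "U \<subseteq> group_algebra W"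
    and stable: "\<And>w u. w \<in> W \<Longrightarrow> u \<in> U \<Longrightarrow> gmult (basis_elem w) u \<in> U"
  obtains M where "free.subspace M" "M \<subseteq> group_algebra W"
    "\<And>w u. w \<in> W \<Longrightarrow> u \<in> M \<Longrightarrow> gmult (basis_elem w) u \<in> M"
    "U \<inter> M = {0}" "\<And>x. x \<in> group_algebra W \<Longrightarrow> \<exists>u\<in>U. x - u \<in> M"
proof -
  interpret pair: vector_space_pair "fscale :: 'k \<Rightarrow> (('v, 'k) group_ring) \<Rightarrow> _"
    "fscale :: 'k \<Rightarrow> (('v, 'k) group_ring) \<Rightarrow> _" ..
  obtain p where p: "range p \<subseteq> U" "Vector_Spaces.linear fscale fscale p" "\<And>v. v \<in> U \<Longrightarrow> p v = v"
    using pair.linear_exists_left_inverse_on[OF free.linear_ident U(1)] by auto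
  interpret p: Vector_Spaces.linear "fscale :: 'k \<Rightarrow> (('v, 'k) group_ring) \<Rightarrow> _" fscale p by fact
  \<comment> \<open>\<open>P\<close> is the averaged projection multiplied by the order of \<open>W\<close>.\<close>
  define P where "P x = (\<Sum>w\<in>W. gmult (basis_elem w) (p (gmult (basis_elem (invf w)) x)))" for x
  have P_add: "P (x + y) = P x + P y" and P_scale: "P (fscale a x) = fscale a (P x)"
    and P_diff: "P (x - y) = P x - P y" for x y a
    by (simp_all add: P_def gmult_distrib p.add p.scale p.diff sum.distrib fscale_sum sum_subtractf)
  have P_in: "P x \<in> U" for x
    unfolding P_def using p(1) by (intro free.subspace_sum U stable) auto
  have P_U: "P u = fscale (of_nat (card W)) u" if "u \<in> U" for u
  proof -
    have "P u = (\<Sum>w\<in>W. u)"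
      unfolding P_def using that by (intro sum.cong) (auto simp: p(3) stable inv_in_W basis_elem_inverse)
    thus ?thesis by (simp add: free.sum_constant_scale)
  qed
  have P_W: "P (gmult (basis_elem g) x) = gmult (basis_elem g) (P x)" if g: "g \<in> W" for g x
  proof -
    have "P (gmult (basis_elem g) x)
        = (\<Sum>w\<in>W. gmult (basis_elem (g \<circ> w)) (p (gmult (basis_elem (invf (g \<circ> w))) (gmult (basis_elem g) x))))"
      unfolding P_def by (rule sum.reindex_bij_betw[OF left_mult_bij[OF g], symmetric])
    also have "\<dots> = (\<Sum>w\<in>W. gmult (basis_elem g) (gmult (basis_elem w) (p (gmult (basis_elem (invf w)) x))))"
    proof (rule sum.cong)
      fix w assume w: "w \<in> W"
      have "gmult (basis_elem (invf (g \<circ> w))) (gmult (basis_elem g) x) = gmult (basis_elem (invf w)) x"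
        using basis_elem_inverse(2)[OF g, of x] g w
        by (simp add: inv_comp_W gmult_assoc basis_elem_comp del: gmult_single)
      thus "gmult (basis_elem (g \<circ> w)) (p (gmult (basis_elem (invf (g \<circ> w))) (gmult (basis_elem g) x)))
         = gmult (basis_elem g) (gmult (basis_elem w) (p (gmult (basis_elem (invf w)) x)))"
        by (simp add: gmult_assoc basis_elem_comp del: gmult_single)
    qed simp
    finally show ?thesis by (simp add: P_def gmult_sum_right)
  qed
  define M where "M = {x \<in> group_algebra W. P x = 0}"
  show ?thesis
  proof
    show "free.subspace M"
      using subspace_group_algebra[of W] P_scale[of 0]
      by (auto simp: M_def free.subspace_def P_add P_scale)
    show "M \<subseteq> group_algebra W" by (auto simp: M_def)
    show "gmult (basis_elem w) u \<in> M" if "w \<in> W" "u \<in> M" for w u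
      using that by (simp add: M_def P_W gmult_in basis_elem_in)
    have "u = 0" if "u \<in> U" "P u = 0" for u
      using that P_U[of u] card_W_pos by simp
    thus "U \<inter> M = {0}"
      using U free.subspace_0[OF \<open>free.subspace M\<close>] free.subspace_0[OF U(1)] by (auto simp: M_def)
    show "\<exists>u\<in>U. x - u \<in> M" if x: "x \<in> group_algebra W" for x
    proof
      let ?u = "fscale (1 / of_nat (card W)) (P x)"
      show u: "?u \<in> U" using P_in U free.subspace_scale by blast
      have "P (x - ?u) = 0" using P_U[OF P_in[of x]] card_W_pos by (simp add: P_diff P_scale)
      thus "x - ?u \<in> M" using x u U by (auto simp: M_def intro!: free.subspace_diff)
    qed
  qed
qed

section \<open>Reductivity\<close>

definition simple_submodule where
  "simple_submodule L N \<longleftrightarrow> free.subspace N \<and> N \<subseteq> group_algebra W \<and> N \<noteq> {0} \<and>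
     (\<forall>x\<in>L. \<forall>v\<in>N. gmult x v \<in> N) \<and>
     (\<forall>Y. free.subspace Y \<and> Y \<subseteq> N \<and> Y \<noteq> {0} \<and> (\<forall>x\<in>L. \<forall>v\<in>Y. gmult x v \<in> Y) \<longrightarrow> Y = N)"

lemma simple_submoduleD:
  assumes "simple_submodule L N"
  shows "free.subspace N" "N \<subseteq> group_algebra W" "N \<noteq> {0}" "x \<in> L \<Longrightarrow> v \<in> N \<Longrightarrow> gmult x v \<in> N"
    "\<lbrakk>free.subspace Y; Y \<subseteq> N; Y \<noteq> {0}; \<And>x v. x \<in> L \<Longrightarrow> v \<in> Y \<Longrightarrow> gmult x v \<in> Y\<rbrakk> \<Longrightarrow> Y = N"
  using assms unfolding simple_submodule_def by blast+

lemma exists_simple_submodule: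
  fixes N :: "(('v, 'k::field) group_ring) set"
  assumes "free.subspace N" "N \<subseteq> group_algebra W" "N \<noteq> {0}" "\<And>x v. x \<in> L \<Longrightarrow> v \<in> N \<Longrightarrow> gmult x v \<in> N"
  obtains Y where "simple_submodule L Y" "Y \<subseteq> N"
proof -
  let ?Q = "\<lambda>Y. free.subspace Y \<and> Y \<subseteq> N \<and> Y \<noteq> {0} \<and> (\<forall>x\<in>L. \<forall>v\<in>Y. gmult x v \<in> Y)"
  have "?Q N" using assms by blast
  then obtain Y where Y: "?Q Y" and min: "\<And>Z. ?Q Z \<Longrightarrow> free.dim Y \<le> free.dim Z"
    using ex_has_least_nat[of ?Q N free.dim] by blast
  have "Z = Y" if "free.subspace Z" "Z \<subseteq> Y" "Z \<noteq> {0}" "\<forall>x\<in>L. \<forall>v\<in>Z. gmult x v \<in> Z" for Z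
  proof (rule free.subspace_eq_if_dim_le[of Z Y "basis_elem ` W"])
    show "free.dim Y \<le> free.dim Z" using that Y by (intro min) auto
    show "Y \<subseteq> free.span (basis_elem ` W)" using Y assms(2) group_algebra_finite_span(1) by blast
  qed (use that Y group_algebra_finite_span(2) in auto)
  thus ?thesis using Y assms(2) by (intro that[of Y]) (auto simp: simple_submodule_def)
qed

text \<open>On a minimal \<open>K\<close>-stable subspace the kernel of an element of \<open>K\<close> is nonzero by nilpotency and
  \<open>K\<close>-stable by commutativity, so it is the whole subspace.\<close>

lemma commuting_nilpotents_common_kernel:
  fixes N :: "(('v, 'k::field) group_ring) set"
  assumes "free.subspace N" "N \<subseteq> group_algebra W" "N \<noteq> {0}" "\<And>x v. x \<in> K \<Longrightarrow> v \<in> N \<Longrightarrow> gmult x v \<in> N"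
    and comm: "\<And>x y. x \<in> K \<Longrightarrow> y \<in> K \<Longrightarrow> gmult x y = gmult y x"
    and nil: "\<And>x. x \<in> K \<Longrightarrow> \<exists>j. gpow x j = 0"
  obtains v where "v \<in> N" "v \<noteq> 0" "\<And>k. k \<in> K \<Longrightarrow> gmult k v = 0"
proof -
  obtain Y where Y: "simple_submodule K Y" "Y \<subseteq> N"
    using exists_simple_submodule[OF assms(1-4)] by blast
  obtain v where v: "v \<in> Y" "v \<noteq> 0"
    using simple_submoduleD(1,3)[OF Y(1)] free.subspace_0 by blast
  have "gmult k v = 0" if k: "k \<in> K" for k
  proof -
    define Z where "Z = {u \<in> Y. gmult k u = 0}"
    have pow_in: "gmult (gpow k i) v \<in> Y" for i
      by (induction i) (use v simple_submoduleD(4)[OF Y(1) k] in \<open>auto simp: gpow_Suc gmult_assoc\<close>)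
    have "\<exists>j. gmult (gpow k j) v = 0" using nil[OF k] by (metis gmult_zero_left)
    then obtain j where j: "gmult (gpow k j) v = 0" "\<And>i. i < j \<Longrightarrow> gmult (gpow k i) v \<noteq> 0"
      using exists_least_iff[of "\<lambda>j. gmult (gpow k j) v = 0"] by blast
    have "j \<noteq> 0" using j(1) v by (cases j) auto
    then obtain i where i: "j = Suc i" by (cases j) auto
    have "gmult (gpow k i) v \<in> Z" "gmult (gpow k i) v \<noteq> 0"
      using j pow_in by (auto simp: Z_def i gpow_Suc gmult_assoc)
    hence "Z \<noteq> {0}" by auto
    moreover have "free.subspace Z"
      using simple_submoduleD(1)[OF Y(1)] by (auto simp: Z_def free.subspace_def gmult_add_right)
    moreover have "gmult x u \<in> Z" if "x \<in> K" "u \<in> Z" for x u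
    proof -
      have "gmult k (gmult x u) = gmult x (gmult k u)"
        using comm[OF that(1) k] by (simp flip: gmult_assoc)
      thus ?thesis using that simple_submoduleD(4)[OF Y(1)] by (auto simp: Z_def)
    qed
    ultimately have "Z = Y"
      by (intro simple_submoduleD(5)[OF Y(1)]) (auto simp: Z_def)
    thus ?thesis using v by (auto simp: Z_def)
  qed
  thus ?thesis using that v Y by blast
qed

lemma subspace_left_mult_image:
  assumes "free.subspace Y" shows "free.subspace (gmult c ` Y)"
proof (rule free.subspaceI)
  show "0 \<in> gmult c ` Y" using free.subspace_0[OF assms] by (rule rev_image_eqI) simp
  show "x + y \<in> gmult c ` Y" if "x \<in> gmult c ` Y" "y \<in> gmult c ` Y" for x y
    using that free.subspace_add[OF assms] by (auto simp flip: gmult_add_right)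
  show "fscale a x \<in> gmult c ` Y" if "x \<in> gmult c ` Y" for a x
    using that free.subspace_scale[OF assms] by (auto simp flip: gmult_fscale_right)
qed

text \<open>Translation by \<open>w\<close> turns the action of \<open>x\<close> into that of its conjugate by the inverse of \<open>w\<close>.\<close>

lemma simple_submodule_translate:
  fixes N :: "(('v, 'k::field) group_ring) set"
  assumes N: "simple_submodule L N" and w: "w \<in> W"
    and conj: "\<And>w x. w \<in> W \<Longrightarrow> x \<in> L \<Longrightarrow> conj_by w x \<in> L"
  shows "simple_submodule L (gmult (basis_elem w) ` N)"
proof -
  have stable: "gmult x v \<in> gmult (basis_elem u) ` Y"
    if "\<And>x v. x \<in> L \<Longrightarrow> v \<in> Y \<Longrightarrow> gmult x v \<in> Y" "u \<in> W" "x \<in> L" "v \<in> gmult (basis_elem u) ` Y" for u Y x and v :: "('v, 'k) group_ring"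
  proof -
    from that(4) obtain y where y: "y \<in> Y" "v = gmult (basis_elem u) y" by blast
    have "gmult x v = gmult (basis_elem u) (gmult (conj_by (invf u) x) y)"
      using that by (simp add: y conj_by_def inv_inv_W gmult_assoc basis_elem_inverse)
    thus ?thesis using that y conj inv_in_W by blast
  qed
  have image_inv: "gmult (basis_elem (invf w)) ` gmult (basis_elem w) ` Y = Y"
    "gmult (basis_elem w) ` gmult (basis_elem (invf w)) ` Y = Y" for Y :: "(('v, 'k) group_ring) set"
    by (simp_all only: image_image basis_elem_inverse[OF w] image_ident)
  have zero: "gmult (basis_elem u) ` {0} = ({0} :: (('v, 'k) group_ring) set)" for u by simp
  have "Y = gmult (basis_elem w) ` N"
    if Y: "free.subspace Y" "Y \<subseteq> gmult (basis_elem w) ` N" "Y \<noteq> {0}"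
      "\<And>x v. x \<in> L \<Longrightarrow> v \<in> Y \<Longrightarrow> gmult x v \<in> Y" for Y
  proof -
    have "gmult (basis_elem (invf w)) ` Y = N"
    proof (rule simple_submoduleD(5)[OF N])
      show "gmult (basis_elem (invf w)) ` Y \<subseteq> N" using Y(2) image_inv(1) by blast
      show "gmult (basis_elem (invf w)) ` Y \<noteq> {0}" using Y(3) image_inv(2)[of Y] zero by metis
    qed (use subspace_left_mult_image stable inv_in_W w Y in auto)
    thus ?thesis using image_inv(2) by blast
  qed
  moreover have "gmult (basis_elem w) ` N \<noteq> {0}"
    using image_inv(1)[of N] zero simple_submoduleD(3)[OF N] by metis
  moreover have "gmult (basis_elem w) ` N \<subseteq> group_algebra W"
    using simple_submoduleD(2)[OF N] w by (auto intro!: gmult_in basis_elem_in)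
  moreover have "\<forall>x\<in>L. \<forall>v\<in>gmult (basis_elem w) ` N. gmult x v \<in> gmult (basis_elem w) ` N"
    using stable[of N w, OF simple_submoduleD(4)[OF N] w] by simp
  ultimately show ?thesis
    using subspace_left_mult_image[OF simple_submoduleD(1)[OF N]] unfolding simple_submodule_def by simp
qed

text \<open>The subspace of a simple submodule that is killed by \<open>K\<close> is nonzero, and it is \<open>L\<close>-stable
  because \<open>k x = x k - [x, k]\<close>; so \<open>K\<close> kills every simple submodule.  As in Clifford's theorem, the
  span of the simple submodules is stable under \<open>W\<close>.  A nonzero complementary left ideal would be
  \<open>L\<close>-stable and contain a simple submodule again.\<close>

lemma normalized_nilpotents_vanish:
  fixes K L :: "(('v, 'k::field_char_0) group_ring) set"
  assumes L: "L \<subseteq> group_algebra W" and conj: "\<And>w x. w \<in> W \<Longrightarrow> x \<in> L \<Longrightarrow> conj_by w x \<in> L"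
    and K: "K \<subseteq> L" "\<And>x k. x \<in> L \<Longrightarrow> k \<in> K \<Longrightarrow> lie_bracket x k \<in> K"
    and comm: "\<And>x y. x \<in> K \<Longrightarrow> y \<in> K \<Longrightarrow> gmult x y = gmult y x"
    and nil: "\<And>x. x \<in> K \<Longrightarrow> \<exists>j. gpow x j = 0"
    and k: "k \<in> K"
  shows "k = 0"
proof -
  have kill: "gmult k v = 0" if N: "simple_submodule L N" and "v \<in> N" "k \<in> K" for N v k
  proof -
    define Y where "Y = {v \<in> N. \<forall>k\<in>K. gmult k v = 0}"
    obtain u where "u \<in> Y" "u \<noteq> 0"
      using commuting_nilpotents_common_kernel[of N K, OF simple_submoduleD(1-3)[OF N] _ comm nil]
        simple_submoduleD(4)[OF N] K(1) unfolding Y_def by (smt (verit) mem_Collect_eq subsetD)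
    moreover have "gmult x u \<in> Y" if "x \<in> L" "u \<in> Y" for x u
    proof -
      have "gmult k (gmult x u) = 0" if "k \<in> K" for k
      proof -
        have "gmult k (gmult x u) = gmult x (gmult k u) - gmult (lie_bracket x k) u"
          by (simp add: lie_bracket_def gmult_distrib gmult_assoc)
        thus ?thesis using \<open>u \<in> Y\<close> that K(2)[OF \<open>x \<in> L\<close> that] by (simp add: Y_def)
      qed
      thus ?thesis using that simple_submoduleD(4)[OF N] by (simp add: Y_def)
    qed
    moreover have "free.subspace Y"
      using simple_submoduleD(1)[OF N] by (auto simp: Y_def free.subspace_def gmult_add_right)
    ultimately have "Y = N" by (intro simple_submoduleD(5)[OF N]) (auto simp: Y_def)
    thus ?thesis using that by (auto simp: Y_def)
  qed
  define U where "U = free.span (\<Union>{N. simple_submodule L N})"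
  have U: "free.subspace U" "U \<subseteq> group_algebra W"
    unfolding U_def by (rule free.subspace_span, rule free.span_minimal)
      (auto dest: simple_submoduleD(2))
  have U_stable: "gmult (basis_elem w) u \<in> U" if w: "w \<in> W" and u: "u \<in> U" for w u
    using u unfolding U_def
  proof (induction rule: free.span_induct)
    case (step x)
    then obtain N where "simple_submodule L N" "x \<in> N" by auto
    hence "gmult (basis_elem w) x \<in> \<Union>{N. simple_submodule L N}"
      using simple_submodule_translate[OF _ w conj] by blast
    thus ?case by (auto intro: free.span_base)
  next
    case base
    show ?case
      by (auto simp: free.subspace_def gmult_add_right intro: free.span_add free.span_scale free.span_zero)
  qed
  obtain M where M: "free.subspace M" "M \<subseteq> group_algebra W" "\<And>w u. w \<in> W \<Longrightarrow> u \<in> M \<Longrightarrow> gmult (basis_elem w) u \<in> M"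
      "U \<inter> M = {0}" "\<And>x. x \<in> group_algebra W \<Longrightarrow> \<exists>u\<in>U. x - u \<in> M"
    using maschke[OF U U_stable] by metis
  have "M = {0}"
  proof (rule ccontr)
    assume "M \<noteq> {0}"
    moreover have "gmult x v \<in> M" if "x \<in> L" "v \<in> M" for x v
    proof -
      have "x \<in> group_algebra W" using that L by blast
      thus ?thesis
      proof (induction x rule: group_algebra_induct)
        case (basis w) thus ?case using M(3) that by blast
      qed (use M(1) in \<open>auto simp: gmult_add_left intro: free.subspace_add free.subspace_scale free.subspace_0\<close>)
    qed
    ultimately obtain N where N: "simple_submodule L N" "N \<subseteq> M"
      using exists_simple_submodule M by metis
    have "N \<subseteq> U" unfolding U_def using N by (meson Union_upper free.span_superset mem_Collect_eq subset_trans)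
    thus False using N M(4) simple_submoduleD(1,3)[OF N(1)] free.subspace_0 by blast
  qed
  hence "basis_elem id \<in> U" using M(5)[of "basis_elem id"] basis_elem_in[OF id_in_W] by auto
  moreover have "gmult k u = 0" if "u \<in> U" for u
    using that unfolding U_def
    by (induction rule: free.span_induct) (use kill k in \<open>auto simp: free.subspace_def gmult_add_right\<close>)
  ultimately show "k = 0" by (metis gmult_id_right)
qed

text \<open>A commutator \<open>[a, b]\<close> with \<open>b \<in> I\<close> lies in \<open>I\<close>, hence commutes with \<open>b\<close> and is nilpotent.\<close>

lemma abelian_ideal_central:
  fixes L :: "(('v, 'k::field_char_0) group_ring) set"
  assumes L: "L \<subseteq> group_algebra W" and conj: "\<And>w x. w \<in> W \<Longrightarrow> x \<in> L \<Longrightarrow> conj_by w x \<in> L"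
    and I: "lie_ideal I L" and ab: "\<And>x y. x \<in> I \<Longrightarrow> y \<in> I \<Longrightarrow> lie_bracket x y = 0"
  shows "I \<subseteq> lie_center L"
proof -
  have I_closed: "lie_bracket x y \<in> I" if "x \<in> L" "y \<in> I" for x y
    using I that by (auto simp: lie_ideal_def)
  have IL: "I \<subseteq> L" using I by (auto simp: lie_ideal_def)
  define K where "K = {lie_bracket x y | x y. x \<in> L \<and> y \<in> I}"
  have KI: "K \<subseteq> I" using I_closed by (auto simp: K_def)
  have "k = 0" if "k \<in> K" for k
  proof (rule normalized_nilpotents_vanish[OF L conj, where K = K])
    show "K \<subseteq> L" using KI IL by blast
    show "lie_bracket x k \<in> K" if "x \<in> L" "k \<in> K" for x k
      using that KI unfolding K_def by blast
    show "gmult x y = gmult y x" if "x \<in> K" "y \<in> K" for x y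
      using ab[of x y] that KI by (auto simp: lie_bracket_eq_0_iff)
    show "\<exists>j. gpow x j = 0" if "x \<in> K" for x
    proof -
      from that obtain a b where x: "x = lie_bracket a b" "a \<in> L" "b \<in> I" by (auto simp: K_def)
      have "lie_bracket (lie_bracket a b) b = 0" using x I_closed by (intro ab) auto
      thus ?thesis using nilpotent_commutator[of b a] x IL L by (auto simp: lie_bracket_eq_0_iff)
    qed
  qed (use that in auto)
  hence "lie_bracket x y = 0" if "x \<in> L" "y \<in> I" for x y using that by (auto simp: K_def)
  hence "lie_bracket y x = 0" if "x \<in> L" "y \<in> I" for x y
    using that lie_bracket_minus_swap[of x y] by simp
  thus ?thesis using IL by (auto simp: lie_center_def)
qed

text \<open>A single commutator, being central in \<open>L\<close>, already forms a family normalized by \<open>L\<close>; the zero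
  vector is added to make the family closed under the adjoint action.\<close>

lemma ideal_with_central_commutators_abelian:
  fixes L :: "(('v, 'k::field_char_0) group_ring) set"
  assumes L: "L \<subseteq> group_algebra W" and conj: "\<And>w x. w \<in> W \<Longrightarrow> x \<in> L \<Longrightarrow> conj_by w x \<in> L"
    and I: "lie_ideal I L" and z: "0 \<in> L" "\<And>x y. x \<in> I \<Longrightarrow> y \<in> I \<Longrightarrow> lie_bracket x y \<in> lie_center L"
    and xy: "x \<in> I" "y \<in> I"
  shows "lie_bracket x y = 0"
proof (rule normalized_nilpotents_vanish[OF L conj, where K = "{0, lie_bracket x y}"])
  let ?z = "lie_bracket x y"
  have c: "lie_bracket ?z u = 0" if "u \<in> L" for u
    using z(2)[OF xy] that by (auto simp: lie_center_def)
  have zL: "?z \<in> L" using z(2)[OF xy] by (auto simp: lie_center_def)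
  have yL: "y \<in> L" using I xy by (auto simp: lie_ideal_def)
  show "{0, ?z} \<subseteq> L" using zL z by auto
  show "lie_bracket u k \<in> {0, ?z}" if "u \<in> L" "k \<in> {0, ?z}" for u k
    using that c[of u] lie_bracket_minus_swap[of u ?z] by auto
  show "gmult u v = gmult v u" if "u \<in> {0, ?z}" "v \<in> {0, ?z}" for u v using that by auto
  show "\<exists>j. gpow u j = 0" if "u \<in> {0, ?z}" for u
  proof (cases "u = 0")
    case True
    thus ?thesis by (auto intro!: exI[of _ "Suc 0"] simp: gpow_Suc)
  next
    case False
    hence "u = ?z" using that by simp
    thus ?thesis using nilpotent_commutator[of y x] c[OF yL] yL L by (auto simp: lie_bracket_eq_0_iff)
  qed
qed auto

lemma lie_ideal_derived:
  assumes L: "lie_subalgebra L A" and I: "lie_ideal I L"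
  shows "lie_ideal (lie_derived I) L"
  unfolding lie_ideal_def
proof (intro conjI ballI)
  have I': "I \<subseteq> L" "free.subspace I" "\<And>x y. x \<in> L \<Longrightarrow> y \<in> I \<Longrightarrow> lie_bracket x y \<in> I"
    using I by (auto simp: lie_ideal_def)
  show "lie_derived I \<subseteq> L"
  proof (rule lie_derived_subset)
    show "free.subspace L" using L by (auto simp: lie_subalgebra_def)
    show "lie_bracket x y \<in> L" if "x \<in> I" "y \<in> I" for x y
      using I'(1) I'(3)[of x y] that by blast
  qed
  show "free.subspace (lie_derived I)" by simp
  show "lie_bracket x y \<in> lie_derived I" if x: "x \<in> L" and "y \<in> lie_derived I" for x y
    using that(2) unfolding lie_derived_def
  proof (induction rule: free.span_induct)
    case (step y)
    then obtain a b where "y = lie_bracket a b" "a \<in> I" "b \<in> I" by auto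
    thus ?case unfolding lie_derived_def[symmetric]
      by (auto simp: lie_bracket_jacobi[of x] intro!: free.subspace_add lie_bracket_in_derived I'(3) x)
  next
    case base
    show ?case by (auto simp: free.subspace_def lie_bracket_add_right
        intro: free.span_add free.span_scale free.span_zero)
  qed
qed

text \<open>Induction on the derived length.  The derived ideal is central by induction, which makes \<open>I\<close>
  abelian, and abelian ideals are central.\<close>

lemma solvable_ideal_central:
  fixes L :: "(('v, 'k::field_char_0) group_ring) set"
  assumes L: "lie_subalgebra L (group_algebra W)" and conj: "\<And>w x. w \<in> W \<Longrightarrow> x \<in> L \<Longrightarrow> conj_by w x \<in> L"
    and "lie_ideal I L" "(lie_derived ^^ n) I = {0}"
  shows "I \<subseteq> lie_center L"
  using assms(3,4)
proof (induction n arbitrary: I)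
  case 0
  thus ?case by (auto simp: lie_center_def lie_ideal_def)
next
  case (Suc n)
  have L': "L \<subseteq> group_algebra W" "0 \<in> L" using L free.subspace_0 by (auto simp: lie_subalgebra_def)
  have "lie_derived I \<subseteq> lie_center L"
    using Suc.IH[OF lie_ideal_derived[OF L Suc.prems(1)]] Suc.prems(2) by (simp add: funpow_swap1)
  hence "lie_bracket x y \<in> lie_center L" if "x \<in> I" "y \<in> I" for x y
    using that lie_bracket_in_derived by blast
  hence "lie_bracket x y = 0" if "x \<in> I" "y \<in> I" for x y
    using ideal_with_central_commutators_abelian[OF L'(1) conj Suc.prems(1) L'(2) _ that] by blast
  thus ?case using abelian_ideal_central[OF L'(1) conj Suc.prems(1)] by blast
qed

theorem reductive_if_conj_stable:
  fixes L :: "(('v, 'k::field_char_0) group_ring) set"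
  assumes L: "lie_subalgebra L (group_algebra W)" and conj: "\<And>w x. w \<in> W \<Longrightarrow> x \<in> L \<Longrightarrow> conj_by w x \<in> L"
  shows "lie_reductive L"
proof -
  have L': "free.subspace L" using L by (auto simp: lie_subalgebra_def)
  have Z: "free.subspace (lie_center L)"
    using L' by (auto simp: lie_center_def free.subspace_def lie_bracket_add_left)
  have "lie_bracket x y = 0" if "x \<in> lie_center L" "y \<in> lie_center L" for x y
    using that by (auto simp: lie_center_def)
  hence "lie_derived (lie_center L) \<subseteq> {0}"
    by (intro lie_derived_subset) (auto simp: free.subspace_single_0)
  hence "lie_derived (lie_center L) = {0}"
    using free.subspace_0[OF subspace_lie_derived] by fast
  hence "lie_solvable (lie_center L)"
    unfolding lie_solvable_def by (intro exI[of _ 1]) simp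
  moreover have "lie_ideal (lie_center L) L"
    unfolding lie_ideal_def
  proof (intro conjI ballI Z)
    show "lie_center L \<subseteq> L" by (auto simp: lie_center_def)
    show "lie_bracket x y \<in> lie_center L" if "x \<in> L" "y \<in> lie_center L" for x y
      using that free.subspace_0[OF Z] lie_bracket_minus_swap[of x y] by (simp add: lie_center_def)
  qed
  ultimately have "lie_center L \<subseteq> lie_radical L"
    unfolding lie_radical_def by (intro subset_trans[OF _ free.span_superset]) blast
  moreover have "lie_radical L \<subseteq> lie_center L"
    unfolding lie_radical_def
    using solvable_ideal_central[OF L conj] Z by (intro free.span_minimal) (auto simp: lie_solvable_def)
  ultimately show ?thesis by (auto simp: lie_reductive_def)
qed

end

section \<open>Change of coefficients\<close>

lemma lookup_map_zero: "h 0 = 0 \<Longrightarrow> Poly_Mapping.lookup (Poly_Mapping.map h x) g = h (Poly_Mapping.lookup x g)"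
  by (simp add: Poly_Mapping.map.rep_eq when_def)

lemma single_add_induct [case_names zero single add]:
  fixes x :: "('v, 'k::field) group_ring"
  assumes "P 0" "\<And>g a. P (Poly_Mapping.single g a)" "\<And>x y. P x \<Longrightarrow> P y \<Longrightarrow> P (x + y)"
  shows "P x"
proof -
  have "P (\<Sum>g\<in>A. fscale (Poly_Mapping.lookup x g) (basis_elem g))" for A
    by (induction A rule: infinite_finite_induct) (use assms in auto)
  thus ?thesis using sum_monomials[of x] by metis
qed

text \<open>An embedding of fields, used below for the rational numbers in \<open>'k\<close> and for \<open>'k\<close> in its
  algebraic closure.\<close>

locale coefficient_extension =
  fixes h :: "'f::field \<Rightarrow> 'k::field"
  assumes h_one: "h 1 = 1" and h_add: "h (a + b) = h a + h b" and h_mult: "h (a * b) = h a * h b"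
begin

lemma h_zero: "h 0 = 0"
  by (metis add_cancel_right_right h_add)

abbreviation extend :: "('g \<Rightarrow>\<^sub>0 'f) \<Rightarrow> ('g \<Rightarrow>\<^sub>0 'k)" where
  "extend \<equiv> Poly_Mapping.map h"

lemma extend_linear:
  "extend (x + y) = extend x + extend y" "extend (fscale a x) = fscale (h a) (extend x)"
  "extend (Poly_Mapping.single g a) = Poly_Mapping.single g (h a)" "extend 0 = 0"
  by (auto intro!: poly_mapping_eqI simp: lookup_map_zero h_zero lookup_add h_add h_mult lookup_single when_def)

lemma extend_gmult: "extend (gmult x y) = gmult (extend x) (extend y)"
proof (induction x rule: single_add_induct)
  case (single g a)
  show ?case
    by (induction y rule: single_add_induct) (auto simp: gmult_add_right extend_linear h_mult)
qed (auto simp: gmult_add_left extend_linear)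

lemma extend_diff: "extend (x - y) = extend x - extend y"
  by (metis extend_linear(1) add_diff_cancel_right' diff_add_cancel)

lemma extend_bracket: "extend (lie_bracket x y) = lie_bracket (extend x) (extend y)"
  by (simp add: lie_bracket_def extend_diff extend_gmult)

lemma exists_semilinear_functional:
  assumes "v \<noteq> 0"
  obtains \<psi> where "\<And>x y. \<psi> (x + y) = \<psi> x + \<psi> y" "\<And>a x. \<psi> (h a * x) = a * \<psi> x" "\<psi> v = 1"
proof -
  interpret V: vector_space "\<lambda>a x. h a * x"
    by unfold_locales (auto simp: h_one h_add h_mult algebra_simps)
  show ?thesis using V.exists_functional[OF assms] that by metis
qed

end

text \<open>An \<open>'f\<close>-linear functional on \<open>'k\<close>, applied to all coefficients, carries identities back from \<open>'k\<close> to
  \<open>'f\<close>: it commutes with multiplication by elements whose coefficients lie in \<open>'f\<close>.\<close>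

locale coefficient_functional = coefficient_extension h for h :: "'f::field \<Rightarrow> 'k::field" +
  fixes \<psi> :: "'k \<Rightarrow> 'f"
  assumes \<psi>_add: "\<psi> (x + y) = \<psi> x + \<psi> y" and \<psi>_scale: "\<psi> (h a * x) = a * \<psi> x"
begin

lemma \<psi>_zero: "\<psi> 0 = 0"
  by (metis add_cancel_right_right \<psi>_add)

abbreviation descend :: "('g \<Rightarrow>\<^sub>0 'k) \<Rightarrow> ('g \<Rightarrow>\<^sub>0 'f)" where
  "descend \<equiv> Poly_Mapping.map \<psi>"

lemma descend_linear:
  "descend (x + y) = descend x + descend y" "descend 0 = 0"
  "descend (Poly_Mapping.single g b) = Poly_Mapping.single g (\<psi> b)"
  "descend (fscale b (extend z)) = fscale (\<psi> b) z"
  using \<psi>_scale[of _ b]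
  by (auto intro!: poly_mapping_eqI
      simp: lookup_map_zero \<psi>_zero h_zero lookup_add \<psi>_add lookup_single when_def mult.commute[of b]
        mult.commute[of "\<psi> b"])

lemma descend_sum: "descend (sum f A) = (\<Sum>i\<in>A. descend (f i))"
  by (induction A rule: infinite_finite_induct) (auto simp: descend_linear)

lemma descend_gmult_extend: "descend (gmult x (extend y)) = gmult (descend x) y"
proof (induction x rule: single_add_induct)
  case (single g a)
  show ?case
  proof (induction y rule: single_add_induct)
    case (single g' b)
    thus ?case using \<psi>_scale[of b a] by (simp add: descend_linear extend_linear mult.commute)
  qed (auto simp: gmult_add_right descend_linear extend_linear)
qed (auto simp: gmult_add_left descend_linear)

lemma lookup_descend: "Poly_Mapping.lookup (descend x) g = \<psi> (Poly_Mapping.lookup x g)"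
  by (simp add: lookup_map_zero \<psi>_zero)

end

section \<open>The trace form\<close>

text \<open>Multiplied by the order of the group, this is the trace of the multiplication by \<open>xy\<close>.\<close>

definition trace_form :: "(('v, 'k::field) group_ring) \<Rightarrow> (('v, 'k) group_ring) \<Rightarrow> 'k" where
  "trace_form x y = Poly_Mapping.lookup (gmult x y) id"

lemma trace_form_linear [simp]:
  "trace_form (x + y) z = trace_form x z + trace_form y z"
  "trace_form z (x + y) = trace_form z x + trace_form z y"
  "trace_form (x - y) z = trace_form x z - trace_form y z"
  "trace_form z (x - y) = trace_form z x - trace_form z y"
  "trace_form (fscale a x) y = a * trace_form x y"
  "trace_form x (fscale a y) = a * trace_form x y"
  "trace_form 0 x = 0" "trace_form x 0 = 0"
  by (simp_all add: trace_form_def gmult_distrib lookup_add lookup_minus)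

lemma lie_subalgebra_span:
  assumes A: "lie_subalgebra A A" and G: "G \<subseteq> A"
    and br: "\<And>x y. x \<in> G \<Longrightarrow> y \<in> G \<Longrightarrow> lie_bracket x y \<in> free.span G"
  shows "lie_subalgebra (free.span G) A"
  unfolding lie_subalgebra_def
proof (intro conjI ballI)
  show "free.span G \<subseteq> A" using A G by (intro free.span_minimal) (auto simp: lie_subalgebra_def)
  show "free.subspace (free.span G)" by simp
  fix x y assume x: "x \<in> free.span G" and y: "y \<in> free.span G"
  show "lie_bracket x y \<in> free.span G"
    using x
  proof (induction rule: free.span_induct)
    case base
    show ?case by (auto simp: free.subspace_def lie_bracket_add_left
        intro: free.span_add free.span_scale free.span_zero)
  next
    case (step x)
    show ?case using y
    proof (induction rule: free.span_induct)
      case base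
      show ?case by (auto simp: free.subspace_def lie_bracket_add_right
          intro: free.span_add free.span_scale free.span_zero)
    qed (rule br[OF step])
  qed
qed

context transformation_group
begin

lemma trace_form_basis_inverse:
  assumes "x \<in> group_algebra W" "w \<in> W"
  shows "trace_form x (basis_elem (invf w)) = Poly_Mapping.lookup x w"
  using assms(1)
proof (induction x rule: group_algebra_induct)
  case (basis u)
  have "u \<circ> invf w = id \<longleftrightarrow> u = w"
    using comp_inv[OF assms(2)] inv_comp[OF assms(2)] by (metis comp_assoc comp_id id_comp)
  thus ?case by (simp add: trace_form_def lookup_single when_def)
qed (auto simp: lookup_add)

lemma trace_form_commute:
  assumes "x \<in> group_algebra W" "y \<in> group_algebra W"
  shows "trace_form x y = trace_form y x"
  using assms(1)
proof (induction x rule: group_algebra_induct)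
  case (basis u)
  show ?case using assms(2)
  proof (induction y rule: group_algebra_induct)
    case (basis v)
    have "u \<circ> v = id \<longleftrightarrow> v \<circ> u = id"
      using \<open>u \<in> W\<close> basis ex_inverse by (metis comp_assoc comp_id id_comp)
    thus ?case by (simp add: trace_form_def lookup_single when_def)
  qed auto
qed auto

lemma trace_form_invariant:
  assumes "x \<in> group_algebra W" "y \<in> group_algebra W" "z \<in> group_algebra W"
  shows "trace_form (lie_bracket x y) z = trace_form x (lie_bracket y z)"
proof -
  have "trace_form (gmult y x) z = trace_form (gmult x z) y"
    using trace_form_commute[OF assms(2) gmult_in[OF assms(1,3)]] by (simp add: trace_form_def gmult_assoc)
  hence "trace_form (gmult y x) z = trace_form x (gmult z y)"
    by (simp add: trace_form_def gmult_assoc)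
  thus ?thesis by (simp add: lie_bracket_def) (simp add: trace_form_def gmult_assoc)
qed

text \<open>The anti-automorphism that inverts the group elements.\<close>

definition star :: "(('v, 'k::field) group_ring) \<Rightarrow> (('v, 'k) group_ring)" where
  "star x = (\<Sum>w\<in>W. fscale (Poly_Mapping.lookup x w) (basis_elem (invf w)))"

lemma star_linear: "star (x + y) = star x + star y" "star (fscale a x) = fscale a (star x)" "star 0 = 0"
  "star (x - y) = star x - star y"
  by (simp_all add: star_def lookup_add lookup_minus free.scale_left_distrib sum.distrib fscale_sum single_add
      single_diff sum_subtractf)

lemma star_basis_elem:
  assumes "w \<in> W" shows "star (basis_elem w) = basis_elem (invf w)"
proof -
  have "star (basis_elem w) = (\<Sum>u\<in>W. if u = w then basis_elem (invf w) else 0)"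
    unfolding star_def by (intro sum.cong) (auto simp: lookup_single when_def)
  thus ?thesis using assms finite_W by simp
qed

lemma star_gmult:
  assumes "x \<in> group_algebra W" "y \<in> group_algebra W"
  shows "star (gmult x y) = gmult (star y) (star x)"
  using assms(1)
proof (induction x rule: group_algebra_induct)
  case (basis u)
  show ?case using assms(2)
  proof (induction y rule: group_algebra_induct)
    case (basis v)
    thus ?case using \<open>u \<in> W\<close> by (simp add: star_basis_elem comp_in_W inv_comp_W)
  qed (auto simp: star_linear gmult_distrib)
qed (auto simp: star_linear gmult_distrib)

lemma trace_form_star:
  assumes "x \<in> group_algebra W"
  shows "trace_form x (star x) = (\<Sum>w\<in>W. Poly_Mapping.lookup x w * Poly_Mapping.lookup x w)"
proof -
  have "trace_form x (star x) = (\<Sum>w\<in>W. Poly_Mapping.lookup x w * trace_form x (basis_elem (invf w)))"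
    by (simp add: star_def trace_form_def gmult_sum_right lookup_sum del: fscale_single)
  thus ?thesis using assms by (simp add: trace_form_basis_inverse)
qed

lemma star_stable_lie_generated:
  assumes R: "R \<subseteq> W" "\<And>r. r \<in> R \<Longrightarrow> invf r \<in> R"
    and x: "x \<in> lie_generated (group_algebra W) (basis_elem ` R)"
  shows "star x \<in> lie_generated (group_algebra W) (basis_elem ` R)"
proof -
  let ?G = "group_algebra W :: (('v \<Rightarrow> 'v) \<Rightarrow>\<^sub>0 'a) set"
  let ?H = "lie_generated ?G (basis_elem ` R)"
  have H: "lie_subalgebra ?H ?G"
    using R by (intro lie_subalgebra_lie_generated lie_subalgebra_group_algebra) (auto intro: basis_elem_in)
  have "lie_subalgebra {x \<in> ?G. star x \<in> ?H} ?G"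
    using H lie_subalgebra_group_algebra subspace_group_algebra[of W] unfolding lie_subalgebra_def
  proof (intro conjI ballI)
    fix x y assume xy: "x \<in> {x \<in> ?G. star x \<in> ?H}" "y \<in> {x \<in> ?G. star x \<in> ?H}"
    hence "star (lie_bracket x y) = lie_bracket (star y) (star x)"
      by (simp add: lie_bracket_def star_linear star_gmult)
    thus "lie_bracket x y \<in> {x \<in> ?G. star x \<in> ?H}"
      using xy H lie_subalgebra_group_algebra by (auto simp: lie_subalgebra_def)
  qed (auto simp: free.subspace_def star_linear)
  moreover have "basis_elem ` R \<subseteq> {x \<in> ?G. star x \<in> ?H}"
    using R lie_generated_superset[of "basis_elem ` R" ?G]
    by (auto simp: star_basis_elem subset_iff intro: basis_elem_in)
  ultimately show ?thesis using lie_generated_minimal x by blast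
qed

text \<open>Let \<open>\<psi>\<close> be a rational linear functional on \<open>'k\<close>.  Since \<open>H\<close> is spanned by its rational
  elements, applying \<open>\<psi>\<close> to the coefficients of \<open>x\<close> gives an element of the rational form of \<open>H\<close>
  that is again orthogonal to this rational form.  In particular it is orthogonal to its own image
  under \<open>star\<close>, so the sum of the squares of its coefficients is 0.  Choosing \<open>\<psi>\<close> not to vanish at a
  nonzero coefficient of \<open>x\<close> gives a contradiction.\<close>

theorem trace_form_nondegenerate:
  fixes x :: "('v, 'k::field_char_0) group_ring"
  assumes R: "R \<subseteq> W" "\<And>r. r \<in> R \<Longrightarrow> invf r \<in> R"
    and x: "x \<in> lie_generated (group_algebra W) (basis_elem ` R)"
    and orth: "\<And>y. y \<in> lie_generated (group_algebra W) (basis_elem ` R) \<Longrightarrow> trace_form x y = 0"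
  shows "x = 0"
proof (rule ccontr)
  assume "x \<noteq> 0"
  then obtain g where g: "Poly_Mapping.lookup x g \<noteq> 0"
    by (metis lookup_zero poly_mapping_eqI)
  interpret coefficient_extension "of_rat :: rat \<Rightarrow> 'k"
    by unfold_locales (auto simp: of_rat_add of_rat_mult)
  obtain \<psi> :: "'k \<Rightarrow> rat" where \<psi>: "\<And>x y. \<psi> (x + y) = \<psi> x + \<psi> y" "\<And>a x. \<psi> (of_rat a * x) = a * \<psi> x"
      "\<psi> (Poly_Mapping.lookup x g) = 1"
    using exists_semilinear_functional[OF g] by metis
  interpret coefficient_functional of_rat \<psi>
    by unfold_locales (fact \<psi>)+
  let ?G = "group_algebra W :: (('v, 'k) group_ring) set" and ?GQ = "group_algebra W :: (('v, rat) group_ring) set"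
  define H where "H = lie_generated ?G (basis_elem ` R)"
  define HQ where "HQ = lie_generated ?GQ (basis_elem ` R)"
  have H: "lie_subalgebra H ?G" and HQ: "lie_subalgebra HQ ?GQ"
    unfolding H_def HQ_def
    using R by (auto intro!: lie_subalgebra_lie_generated lie_subalgebra_group_algebra basis_elem_in)
  have R_H: "basis_elem ` R \<subseteq> H" and R_HQ: "basis_elem ` R \<subseteq> HQ"
    unfolding H_def HQ_def by (rule lie_generated_superset)+
  have HQ_H: "extend y \<in> H" if "y \<in> HQ" for y
  proof -
    have "lie_subalgebra {y \<in> ?GQ. extend y \<in> H} ?GQ"
      using H lie_subalgebra_group_algebra unfolding lie_subalgebra_def
      by (auto simp: free.subspace_def extend_linear extend_bracket)
    moreover have "basis_elem ` R \<subseteq> {y \<in> ?GQ. extend y \<in> H}"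
      using R R_H by (auto simp: extend_linear intro: basis_elem_in)
    ultimately have "HQ \<subseteq> {y \<in> ?GQ. extend y \<in> H}"
      unfolding HQ_def by (rule lie_generated_minimal)
    thus ?thesis using that by blast
  qed
  have "lie_subalgebra (free.span (extend ` HQ)) ?G"
  proof (rule lie_subalgebra_span[OF lie_subalgebra_group_algebra])
    show "extend ` HQ \<subseteq> ?G" using HQ_H H by (auto simp: lie_subalgebra_def)
    show "lie_bracket x y \<in> free.span (extend ` HQ)" if "x \<in> extend ` HQ" "y \<in> extend ` HQ" for x y
      using that HQ by (auto simp: lie_subalgebra_def simp flip: extend_bracket intro!: free.span_base)
  qed
  moreover have "basis_elem ` R \<subseteq> free.span (extend ` HQ)"
  proof
    fix y :: "('v, 'k) group_ring" assume "y \<in> basis_elem ` R"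
    then obtain r where r: "r \<in> R" "y = basis_elem r" by auto
    hence "y = extend (basis_elem r)" "basis_elem r \<in> HQ" using R_HQ by (auto simp: extend_linear)
    thus "y \<in> free.span (extend ` HQ)" using free.span_base by blast
  qed
  ultimately have H_span: "H \<subseteq> free.span (extend ` HQ)"
    unfolding H_def by (rule lie_generated_minimal)
  have "descend y \<in> HQ" if "y \<in> free.span (extend ` HQ)" for y
    using that
  proof (induction rule: free.span_induct_alt)
    case base
    show ?case using HQ free.subspace_0 by (auto simp: descend_linear lie_subalgebra_def)
  next
    case (step c y z)
    then obtain u where "y = extend u" "u \<in> HQ" by auto
    thus ?case using step HQ
      by (auto simp: descend_linear lie_subalgebra_def intro!: free.subspace_add free.subspace_scale)
  qed
  hence dx: "descend x \<in> HQ" using x H_span unfolding H_def by blast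
  have "trace_form (descend x) y = 0" if "y \<in> HQ" for y
  proof -
    have "trace_form (descend x) y = \<psi> (trace_form x (extend y))"
      by (simp add: trace_form_def lookup_descend flip: descend_gmult_extend)
    thus ?thesis using orth HQ_H[OF that] by (simp add: H_def \<psi>_zero)
  qed
  moreover have "star (descend x) \<in> HQ"
    using star_stable_lie_generated[OF R] dx unfolding HQ_def by blast
  ultimately have "trace_form (descend x) (star (descend x)) = 0" by blast
  moreover have xG: "x \<in> ?G" using x H by (auto simp: H_def lie_subalgebra_def)
  have "descend x \<in> ?GQ" using dx HQ by (auto simp: lie_subalgebra_def)
  ultimately have "\<forall>w\<in>W. Poly_Mapping.lookup (descend x) w * Poly_Mapping.lookup (descend x) w = 0"
    using finite_W by (simp add: trace_form_star sum_nonneg_eq_0_iff del: mult_eq_0_iff)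
  moreover have "g \<in> W" using g xG by (auto simp: group_algebra_def in_keys_iff)
  ultimately show False using \<psi>(3) by (simp add: lookup_descend)
qed

text \<open>Send \<open>d\<close> to the tuple of its products with a basis of \<open>D\<close>.  By nondegeneracy the basis has linearly
  independent images, and their number is the dimension of the target, so the tuple of \<open>x\<close> is also
  attained on \<open>D\<close>.\<close>

lemma orthogonal_projection:
  fixes D :: "(('v, 'k::field) group_ring) set"
  assumes D: "free.subspace D" "D \<subseteq> group_algebra W"
    and nondeg: "\<And>d. d \<in> D \<Longrightarrow> (\<And>d'. d' \<in> D \<Longrightarrow> trace_form d d' = 0) \<Longrightarrow> d = 0"
  obtains d where "d \<in> D" "\<And>d'. d' \<in> D \<Longrightarrow> trace_form (x - d) d' = 0"
proof -
  obtain B where B: "finite B" "B \<subseteq> D" "free.independent B" "free.span B = D"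
    using free.finite_basis_of_subspace[OF D(1) subset_trans[OF D(2) group_algebra_finite_span(1)]
      group_algebra_finite_span(2)] by metis
  define f where "f d = (\<Sum>b\<in>B. Poly_Mapping.single b (trace_form d b))" for d
  have lookup_f: "Poly_Mapping.lookup (f d) b = (if b \<in> B then trace_form d b else 0)" for d b
    using B(1) by (simp add: f_def lookup_sum lookup_single when_def)
  interpret f: Vector_Spaces.linear fscale fscale f
    by unfold_locales (auto intro!: poly_mapping_eqI simp: lookup_f lookup_add)
  have zero: "d' \<in> D \<Longrightarrow> trace_form d d' = 0" if "f d = 0" for d d'
  proof -
    assume "d' \<in> D"
    hence "d' \<in> free.span B" using B by simp
    moreover have "trace_form d b = 0" if "b \<in> B" for b
      using lookup_f[of d b] that \<open>f d = 0\<close> by simp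
    ultimately show ?thesis
      by (induction rule: free.span_induct) (auto simp: free.subspace_def)
  qed
  have inj: "inj_on f (free.span B)"
    unfolding B(4)
  proof (rule inj_onI)
    fix a b assume ab: "a \<in> D" "b \<in> D" "f a = f b"
    have "a - b = 0" using ab by (intro nondeg zero free.subspace_diff D) (auto simp: f.diff)
    thus "a = b" by simp
  qed
  have ind: "free.independent (f ` B)" by (rule f.independent_injective_image[OF B(3) inj])
  have "f x \<in> free.span (f ` B)"
  proof (rule ccontr)
    assume not: "f x \<notin> free.span (f ` B)"
    have span: "f y \<in> free.span ((\<lambda>b. Poly_Mapping.single b 1) ` B)" for y
    proof -
      have f: "f y = (\<Sum>b\<in>B. fscale (trace_form y b) (Poly_Mapping.single b 1))" by (simp add: f_def)
      show ?thesis
        unfolding f by (rule free.span_sum, rule free.span_scale, rule free.span_base, erule imageI)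
    qed
    have "card (insert (f x) (f ` B)) \<le> card ((\<lambda>b. Poly_Mapping.single b 1) ` B :: (_ \<Rightarrow>\<^sub>0 'k) set)"
      using free.independent_span_bound[OF _ free.independent_insertI[OF not ind], of "(\<lambda>b. Poly_Mapping.single b 1) ` B"] B(1) span
      by auto
    also have "\<dots> \<le> card B" using B(1) by (rule card_image_le)
    also have "\<dots> = card (f ` B)"
      using inj free.span_superset[of B] by (metis card_image inj_on_subset)
    finally have "f x \<in> f ` B" using B(1) by (simp add: card_insert_if split: if_splits)
    thus False using not free.span_base by blast
  qed
  then obtain d where d: "d \<in> D" "f x = f d" unfolding f.span_image B(4) by auto
  show ?thesis
    by (rule that[OF d(1)]) (rule zero, use d in \<open>simp_all add: f.diff\<close>)
qed

end

section \<open>Roots of unity\<close>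

lemma card_roots_of_unity:
  assumes "e > 0"
  shows "finite {z :: 'a::{alg_closed_field,field_char_0}. z ^ e = 1}"
    and "card {z :: 'a. z ^ e = 1} = e"
proof -
  define p :: "'a poly" where "p = Polynomial.monom 1 e - 1"
  have deg: "Polynomial.degree p = e"
  proof (rule antisym)
    show "Polynomial.degree p \<le> e"
      unfolding p_def by (intro Polynomial.degree_diff_le) (auto simp: degree_monom_le)
    show "e \<le> Polynomial.degree p"
      using assms by (intro le_degree) (simp add: p_def)
  qed
  have p0: "p \<noteq> 0" using deg assms by auto
  have roots: "{z. poly p z = 0} = {z. z ^ e = 1}"
    by (simp add: p_def poly_monom)
  have "\<not> (poly p z = 0 \<and> poly (pderiv p) z = 0)" for z
  proof
    assume z: "poly p z = 0 \<and> poly (pderiv p) z = 0"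
    hence "of_nat e * z ^ (e - 1) = 0" by (simp add: p_def pderiv_diff pderiv_monom poly_monom)
    hence "z = 0" using assms by (simp split: if_splits)
    thus False using z assms by (simp add: p_def poly_monom power_0_left)
  qed
  hence sf: "rsquarefree p" by (simp add: rsquarefree_roots)
  obtain A where A: "size A = Polynomial.degree p" "p = smult (lead_coeff p) (\<Prod>x\<in>#A. [:- x, 1:])"
    using alg_closed_imp_factorization[OF p0] by blast
  have "proots p = proots (\<Prod>x\<in>#A. [:- x, 1:])"
    using p0 by (subst A(2)) simp
  also have "\<dots> = A"
  proof (induction A)
    case (add x A)
    have "(\<Prod>x\<in>#A. [:- x, 1:]) \<noteq> 0" by (auto simp: prod_mset_zero_iff)
    thus ?case using add proots_linear_factor[of "- x"]
      by (simp only: image_mset_add_mset prod_mset.add_mset) (subst proots_mult, auto)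
  qed simp
  finally have A': "proots p = A" .
  have le: "count A z \<le> 1" for z
    using sf p0 unfolding rsquarefree_def by (metis A' count_proots le_numeral_extra(4) zero_le_one)
  have "sum (count A) (set_mset A) = (\<Sum>z\<in>set_mset A. 1)"
    by (intro sum.cong refl antisym le) (simp add: Suc_le_eq)
  hence "size A = card (set_mset A)"
    by (simp add: size_multiset_overloaded_eq)
  thus "card {z :: 'a. z ^ e = 1} = e" "finite {z :: 'a. z ^ e = 1}"
    using A(1) A' deg poly_roots_finite[OF p0] p0 roots set_count_proots[OF p0] by auto
qed

lemma sum_powers_root_of_unity:
  fixes u :: "'a::field"
  assumes "u ^ e = 1"
  shows "(\<Sum>i<e. u ^ i) = (if u = 1 then of_nat e else 0)"
  using assms geometric_sum[of u e] by (cases "u = 1") auto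

text \<open>Multiplication by a root of unity \<open>u\<close> permutes the index set and multiplies the sum by a power
  of \<open>u\<close>.  This power is different from 1 for some \<open>u\<close>, as there are only \<open>j\<close> roots of unity of
  exponent \<open>j\<close>.\<close>

lemma sum_roots_of_unity_powers:
  fixes e :: nat
  defines "Z \<equiv> {z :: 'a::{alg_closed_field,field_char_0}. z ^ e = 1}"
  assumes j: "0 < j" "j < e"
  shows "(\<Sum>z\<in>Z. inverse z ^ j) = 0"
proof -
  have Z: "finite Z" "card Z = e" using card_roots_of_unity[of e] j by (auto simp: Z_def)
  have "\<not> Z \<subseteq> {z. z ^ j = 1}"
  proof
    assume "Z \<subseteq> {z. z ^ j = 1}"
    hence "card Z \<le> card {z :: 'a. z ^ j = 1}"
      by (intro card_mono card_roots_of_unity j)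
    thus False using card_roots_of_unity(2)[where 'a = 'a, of j] j Z by simp
  qed
  then obtain u where u: "u \<in> Z" "u ^ j \<noteq> 1" by blast
  have u0: "u \<noteq> 0" using u j by (auto simp: Z_def power_0_left)
  have "bij_betw (\<lambda>z. inverse u * z) Z Z"
    by (rule bij_betwI[where g = "\<lambda>z. u * z"])
      (use u u0 in \<open>auto simp: Z_def power_mult_distrib field_simps\<close>)
  hence "(\<Sum>z\<in>Z. inverse z ^ j) = (\<Sum>z\<in>Z. inverse (inverse u * z) ^ j)"
    by (rule sum.reindex_bij_betw[symmetric])
  also have "\<dots> = u ^ j * (\<Sum>z\<in>Z. inverse z ^ j)"
    by (simp add: power_mult_distrib sum_distrib_left)
  finally show ?thesis using u by (metis mult_cancel_right1)
qed

lemma exists_interpolating_polynomial: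
  fixes A :: "'a::field set"
  assumes "finite A"
  shows "\<exists>q. \<forall>x\<in>A. poly q x = v x"
  using assms
proof (induction A rule: finite_induct)
  case (insert a A)
  then obtain q where q: "\<forall>x\<in>A. poly q x = v x" by blast
  define p where "p = (\<Prod>x\<in>A. [:- x, 1:])"
  have p: "poly p x = 0 \<longleftrightarrow> x \<in> A" for x
    using insert(1) by (auto simp: p_def poly_prod)
  have "\<forall>x\<in>insert a A. poly (q + smult ((v a - poly q a) / poly p a) p) x = v x"
    using p q insert(2) by auto
  thus ?case by blast
qed auto

text \<open>The equation also holds for the exponent 0, hence for all characters of the cyclic group of
  order \<open>e\<close>.  By orthogonality of characters the formal combination \<open>\<alpha> - \<beta> - \<gamma> + \<delta>\<close> of group
  elements is zero.\<close>

lemma root_of_unity_difference_pattern: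
  fixes \<alpha> \<beta> \<gamma> \<delta> :: "'a::field_char_0"
  assumes e: "e > 0" "\<alpha> ^ e = 1" "\<beta> ^ e = 1" "\<gamma> ^ e = 1" "\<delta> ^ e = 1"
    and "\<alpha> \<noteq> \<beta>" and zero: "\<And>i. i \<in> {1..e - 1} \<Longrightarrow> \<alpha> ^ i - \<beta> ^ i - \<gamma> ^ i + \<delta> ^ i = 0"
  shows "\<alpha> = \<gamma> \<and> \<beta> = \<delta>"
proof -
  let ?d = "\<lambda>u z. if z = u then of_nat e else 0 :: 'a"
  have nz: "z \<noteq> 0" if "z ^ e = 1" for z :: 'a using that e by (auto simp: power_0_left)
  have orth: "(\<Sum>i<e. inverse u ^ i * z ^ i) = ?d u z" if "u ^ e = 1" "z ^ e = 1" for u z :: 'a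
    using sum_powers_root_of_unity[of "inverse u * z" e] that nz[of u]
    by (simp add: power_mult_distrib power_inverse field_simps split: if_splits)
  have all: "\<alpha> ^ i - \<beta> ^ i - \<gamma> ^ i + \<delta> ^ i = 0" if "i < e" for i
    using zero[of i] that by (cases "i = 0") auto
  have "?d u \<alpha> - ?d u \<beta> - ?d u \<gamma> + ?d u \<delta> = 0" if u: "u ^ e = 1" for u
  proof -
    have "0 = (\<Sum>i<e. inverse u ^ i * (\<alpha> ^ i - \<beta> ^ i - \<gamma> ^ i + \<delta> ^ i))"
      using all by simp
    also have "\<dots> = (\<Sum>i<e. inverse u ^ i * \<alpha> ^ i) - (\<Sum>i<e. inverse u ^ i * \<beta> ^ i)
        - (\<Sum>i<e. inverse u ^ i * \<gamma> ^ i) + (\<Sum>i<e. inverse u ^ i * \<delta> ^ i)"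
      by (simp add: sum.distrib sum_subtractf ring_distribs)
    finally show ?thesis using e u by (simp add: orth)
  qed
  from this[OF e(2)] this[OF e(3)] e(1) \<open>\<alpha> \<noteq> \<beta>\<close> show ?thesis
    by (auto split: if_splits)
qed

section \<open>The adjoint action of a polynomial in a group element\<close>

text \<open>If \<open>s\<^sup>e = 1\<close> and \<open>\<alpha>\<^sup>e = 1\<close>, this is the idempotent that projects onto the eigenspace of \<open>s\<close> for the
  eigenvalue \<open>\<alpha>\<close>.\<close>

definition eigenidem :: "nat \<Rightarrow> ('v \<Rightarrow> 'v) \<Rightarrow> 'k::field \<Rightarrow> (('v, 'k) group_ring)" where
  "eigenidem e s \<alpha> = (\<Sum>j<e. fscale (inverse (of_nat e) * inverse \<alpha> ^ j) (basis_elem (s ^^ j)))"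

lemma sum_lessThan_cyclic:
  fixes f :: "nat \<Rightarrow> 'a::ab_group_add"
  assumes "f e = f 0" shows "(\<Sum>j<e. f (Suc j)) = (\<Sum>j<e. f j)"
  using sum.lessThan_Suc_shift[of f e] assms by (simp add: add.commute)

lemma eigenidem_eigenvector:
  assumes "e > 0" "s ^^ e = id" "\<alpha> ^ e = 1"
  shows "gmult (basis_elem s) (eigenidem e s \<alpha>) = fscale \<alpha> (eigenidem e s \<alpha>)"
    and "gmult (eigenidem e s \<alpha>) (basis_elem s) = fscale \<alpha> (eigenidem e s \<alpha>)"
proof -
  have nz: "\<alpha> \<noteq> 0" using assms by (auto simp: power_0_left)
  have cancel: "\<alpha> * (inverse \<alpha> * c) = c" for c
    using nz by (simp flip: mult.assoc)
  define f where "f j = fscale (inverse (of_nat e) * inverse \<alpha> ^ j) (basis_elem (s ^^ j))" for j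
  have E: "eigenidem e s \<alpha> = (\<Sum>j<e. f j)" by (simp only: eigenidem_def f_def)
  have "(\<Sum>j<e. f (Suc j)) = eigenidem e s \<alpha>"
    unfolding E by (rule sum_lessThan_cyclic) (use assms in \<open>simp add: f_def power_inverse\<close>)
  moreover have "gmult (basis_elem s) (f j) = fscale \<alpha> (f (Suc j))"
      "gmult (f j) (basis_elem s) = fscale \<alpha> (f (Suc j))" for j
    by (simp_all add: f_def mult_ac funpow_swap1 comp_def cancel)
  ultimately show "gmult (basis_elem s) (eigenidem e s \<alpha>) = fscale \<alpha> (eigenidem e s \<alpha>)"
    "gmult (eigenidem e s \<alpha>) (basis_elem s) = fscale \<alpha> (eigenidem e s \<alpha>)"
    by (simp_all only: E gmult_sum_left gmult_sum_right flip: fscale_sum)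
qed

lemma eigenidem_power:
  assumes "e > 0" "s ^^ e = id" "\<alpha> ^ e = 1"
  shows "gmult (basis_elem (s ^^ i)) (eigenidem e s \<alpha>) = fscale (\<alpha> ^ i) (eigenidem e s \<alpha>)"
    and "gmult (eigenidem e s \<alpha>) (basis_elem (s ^^ i)) = fscale (\<alpha> ^ i) (eigenidem e s \<alpha>)"
proof (induction i)
  case (Suc i)
  have eq: "basis_elem (s ^^ Suc i) = gmult (basis_elem s) (basis_elem (s ^^ i) :: (_ \<Rightarrow>\<^sub>0 'b))"
    by simp
  case 1
  show ?case using Suc by (simp only: eq gmult_assoc) (simp add: eigenidem_eigenvector[OF assms] mult.commute)
  case 2
  show ?case using Suc
    by (simp only: eq gmult_assoc[symmetric] eigenidem_eigenvector[OF assms]) (simp add: mult.commute)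
qed simp_all

lemma sum_eigenidem:
  fixes s :: "'v \<Rightarrow> 'v"
  assumes "e > 0"
  shows "(\<Sum>\<alpha>\<in>{z :: 'k::{alg_closed_field,field_char_0}. z ^ e = 1}. eigenidem e s \<alpha>) = basis_elem id"
proof -
  let ?Z = "{z :: 'k. z ^ e = 1}"
  have "(\<Sum>\<alpha>\<in>?Z. eigenidem e s \<alpha>)
      = (\<Sum>j<e. fscale (inverse (of_nat e) * (\<Sum>\<alpha>\<in>?Z. inverse \<alpha> ^ j)) (basis_elem (s ^^ j)))"
    unfolding eigenidem_def by (subst sum.swap)
      (simp add: free.scale_sum_left[symmetric] sum_distrib_left del: fscale_single)
  also have "\<dots> = (\<Sum>j<e. if j = 0 then basis_elem id else 0)"
    using sum_roots_of_unity_powers[where 'a = 'k, of _ e] card_roots_of_unity[where 'a = 'k, of e] assms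
    by (intro sum.cong) (auto simp: id_def)
  also have "\<dots> = basis_elem id" using assms by simp
  finally show ?thesis .
qed

definition cyclic_element :: "nat \<Rightarrow> (nat \<Rightarrow> 'k::field) \<Rightarrow> ('v \<Rightarrow> 'v) \<Rightarrow> (('v, 'k) group_ring)" where
  "cyclic_element e a s = (\<Sum>i = 1..e - 1. fscale (a i) (basis_elem (s ^^ i)))"

definition cyclic_eigenvalue :: "nat \<Rightarrow> (nat \<Rightarrow> 'k::field) \<Rightarrow> 'k alg_closure \<Rightarrow> 'k alg_closure" where
  "cyclic_eigenvalue e a \<alpha> = (\<Sum>i = 1..e - 1. to_ac (a i) * \<alpha> ^ i)"

text \<open>The differences of the eigenvalues tell the pairs \<open>(\<alpha>, \<beta>)\<close> with \<open>\<alpha> \<noteq> \<beta>\<close> apart; the case \<open>\<gamma> = \<delta>\<close>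
  says that they do not vanish.\<close>

definition generic_coefficients :: "nat \<Rightarrow> (nat \<Rightarrow> 'k::field) \<Rightarrow> bool" where
  "generic_coefficients e a \<longleftrightarrow> (\<forall>\<alpha> \<beta> \<gamma> \<delta>. \<alpha> ^ e = 1 \<and> \<beta> ^ e = 1 \<and> \<gamma> ^ e = 1 \<and> \<delta> ^ e = 1 \<and> \<alpha> \<noteq> \<beta> \<and>
     cyclic_eigenvalue e a \<alpha> - cyclic_eigenvalue e a \<beta> = cyclic_eigenvalue e a \<gamma> - cyclic_eigenvalue e a \<delta>
     \<longrightarrow> \<alpha> = \<gamma> \<and> \<beta> = \<delta>)"

lemma extend_funpow_bracket:
  assumes "coefficient_extension h"
  shows "Poly_Mapping.map h ((lie_bracket x ^^ m) y)
       = (lie_bracket (Poly_Mapping.map h x) ^^ m) (Poly_Mapping.map h y)"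
  by (induction m) (auto simp: coefficient_extension.extend_bracket[OF assms])

lemma funpow_bracket_sum:
  "(lie_bracket x ^^ m) (sum f A) = (\<Sum>i\<in>A. (lie_bracket x ^^ m) (f i))"
  by (induction m) (auto simp: lie_bracket_sum_right)

text \<open>Over the algebraic closure, \<open>y\<close> is the sum of the components \<open>e\<^sub>\<alpha> y e\<^sub>\<beta>\<close>, where \<open>e\<^sub>\<alpha>\<close> are the
  eigenidempotents of \<open>s\<close>.  On such a component \<open>ad x\<close> is the scalar \<open>\<mu>(\<alpha>) - \<mu>(\<beta>)\<close>, and
  \<open>y \<mapsto> [s\<^sup>i, y] s\<^sup>l\<close> is the scalar \<open>(\<alpha>\<^sup>i - \<beta>\<^sup>i) \<beta>\<^sup>l\<close>, which vanishes for \<open>\<alpha> = \<beta>\<close>.  An interpolating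
  polynomial maps the former to the latter, and a linear functional on the algebraic closure maps
  its coefficients to \<open>'k\<close> without changing the identity.\<close>

lemma power_operator_is_polynomial_in_adjoint:
  fixes a :: "nat \<Rightarrow> 'k::field_char_0" and s :: "'v \<Rightarrow> 'v"
  assumes e: "e > 0" "s ^^ e = id" and gen: "generic_coefficients e a"
  obtains n r where "r 0 = 0"
    "\<And>y. gmult (lie_bracket (basis_elem (s ^^ i)) y) (basis_elem (s ^^ l))
        = (\<Sum>m\<le>n. fscale (r m) ((lie_bracket (cyclic_element e a s) ^^ m) y))"
proof -
  let ?Z = "{z :: 'k alg_closure. z ^ e = 1}"
  let ?\<mu> = "cyclic_eigenvalue e a"
  have Z: "finite ?Z" by (rule card_roots_of_unity[OF e(1)])
  interpret coefficient_extension "to_ac :: 'k \<Rightarrow> 'k alg_closure"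
    by unfold_locales auto
  obtain \<psi> :: "'k alg_closure \<Rightarrow> 'k" where \<psi>: "\<And>x y. \<psi> (x + y) = \<psi> x + \<psi> y"
      "\<And>a x. \<psi> (to_ac a * x) = a * \<psi> x" "\<psi> 1 = 1"
    using exists_semilinear_functional[of 1] by (metis one_neq_zero)
  interpret coefficient_functional to_ac \<psi>
    by unfold_locales (fact \<psi>)+

  define target where "target \<alpha> \<beta> = (\<alpha> ^ i - \<beta> ^ i) * \<beta> ^ l" for \<alpha> \<beta> :: "'k alg_closure"
  \<comment> \<open>The value to interpolate at the node \<open>x\<close>.  A node other than 0 comes from a single pair; the
    node 0 comes from the pairs on the diagonal, for which \<open>target\<close> is 0.\<close>
  define v where "v x = (case SOME p. p \<in> ?Z \<times> ?Z \<and> x = ?\<mu> (fst p) - ?\<mu> (snd p) of (\<alpha>, \<beta>) \<Rightarrow> target \<alpha> \<beta>)" for x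
  have v: "v (?\<mu> \<alpha> - ?\<mu> \<beta>) = target \<alpha> \<beta>" if "\<alpha> \<in> ?Z" "\<beta> \<in> ?Z" for \<alpha> \<beta>
  proof -
    define p where "p = (SOME p. p \<in> ?Z \<times> ?Z \<and> ?\<mu> \<alpha> - ?\<mu> \<beta> = ?\<mu> (fst p) - ?\<mu> (snd p))"
    have p: "p \<in> ?Z \<times> ?Z \<and> ?\<mu> \<alpha> - ?\<mu> \<beta> = ?\<mu> (fst p) - ?\<mu> (snd p)"
      unfolding p_def by (rule someI[of _ "(\<alpha>, \<beta>)"]) (use that in auto)
    obtain \<gamma> \<delta> where pp: "p = (\<gamma>, \<delta>)" by (cases p)
    have "target \<gamma> \<delta> = target \<alpha> \<beta>"
    proof (cases "\<alpha> = \<beta> \<and> \<gamma> = \<delta>")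
      case True
      thus ?thesis by (simp add: target_def)
    next
      case False
      have pZ: "\<gamma> ^ e = 1" "\<delta> ^ e = 1" and eq: "?\<mu> \<alpha> - ?\<mu> \<beta> = ?\<mu> \<gamma> - ?\<mu> \<delta>"
        using p by (simp_all add: pp)
      have \<alpha>\<beta>: "\<alpha> ^ e = 1" "\<beta> ^ e = 1" using that by simp_all
      have "\<alpha> = \<gamma> \<and> \<beta> = \<delta>"
        using False gen[unfolded generic_coefficients_def, rule_format, of \<alpha> \<beta> \<gamma> \<delta>]
          gen[unfolded generic_coefficients_def, rule_format, of \<gamma> \<delta> \<alpha> \<beta>] pZ eq \<alpha>\<beta> eq[symmetric] by blast
      thus ?thesis by simp
    qed
    thus ?thesis unfolding v_def p_def[symmetric] by (simp add: pp)
  qed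
  define A where "A = {?\<mu> \<alpha> - ?\<mu> \<beta> | \<alpha> \<beta>. \<alpha> \<in> ?Z \<and> \<beta> \<in> ?Z}"
  have "finite A" unfolding A_def by (rule finite_image_set2) (use Z in auto)
  then obtain q where q': "\<forall>x\<in>A. poly q x = v x"
    using exists_interpolating_polynomial by blast
  have q: "poly q (?\<mu> \<alpha> - ?\<mu> \<beta>) = target \<alpha> \<beta>" if "\<alpha> \<in> ?Z" "\<beta> \<in> ?Z" for \<alpha> \<beta>
  proof -
    have "?\<mu> \<alpha> - ?\<mu> \<beta> \<in> A" unfolding A_def using that by blast
    thus ?thesis using q' v[OF that] by simp
  qed
  \<comment> \<open>The diagonal pair \<open>(1, 1)\<close> makes 0 a node with value 0.\<close>
  have q0: "Polynomial.coeff q 0 = 0"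
    using q[of 1 1] e(1) by (simp add: target_def poly_0_coeff_0)

  let ?x = "cyclic_element e a s"
  define E :: "'k alg_closure \<Rightarrow> ('v \<Rightarrow> 'v) \<Rightarrow>\<^sub>0 'k alg_closure" where "E = eigenidem e s"
  have extend_x: "extend ?x = (\<Sum>i = 1..e - 1. fscale (to_ac (a i)) (basis_elem (s ^^ i)))"
  proof -
    have "extend (\<Sum>i\<in>I. fscale (a i) (basis_elem (s ^^ i)))
        = (\<Sum>i\<in>I. fscale (to_ac (a i)) (basis_elem (s ^^ i)))" for I
      by (induction I rule: infinite_finite_induct) (auto simp: extend_linear)
    thus ?thesis by (simp only: cyclic_element_def)
  qed
  have x_left: "gmult (extend ?x) (E \<alpha>) = fscale (?\<mu> \<alpha>) (E \<alpha>)"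
    and x_right: "gmult (E \<alpha>) (extend ?x) = fscale (?\<mu> \<alpha>) (E \<alpha>)" if "\<alpha> \<in> ?Z" for \<alpha>
    using that
    by (simp_all add: extend_x E_def gmult_sum_left gmult_sum_right eigenidem_power[OF e]
        cyclic_eigenvalue_def free.scale_sum_left del: fscale_single)
  define C where "C y \<alpha> \<beta> = gmult (E \<alpha>) (gmult y (E \<beta>))" for y \<alpha> \<beta>
  have decomp: "(\<Sum>\<alpha>\<in>?Z. \<Sum>\<beta>\<in>?Z. C y \<alpha> \<beta>) = y" for y
    using sum_eigenidem[OF e(1), where 'k = "'k alg_closure", of s]
    by (simp add: C_def E_def flip: gmult_sum_left gmult_sum_right)
  have ad_C: "lie_bracket (extend ?x) (C y \<alpha> \<beta>) = fscale (?\<mu> \<alpha> - ?\<mu> \<beta>) (C y \<alpha> \<beta>)"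
    if "\<alpha> \<in> ?Z" "\<beta> \<in> ?Z" for y \<alpha> \<beta>
  proof -
    have "gmult (extend ?x) (C y \<alpha> \<beta>) = fscale (?\<mu> \<alpha>) (C y \<alpha> \<beta>)"
      unfolding C_def by (subst gmult_assoc[symmetric]) (simp add: x_left[OF that(1)])
    moreover have "gmult (C y \<alpha> \<beta>) (extend ?x) = fscale (?\<mu> \<beta>) (C y \<alpha> \<beta>)"
      unfolding C_def by (simp add: gmult_assoc x_right[OF that(2)])
    ultimately show ?thesis by (simp add: lie_bracket_def free.scale_left_diff_distrib)
  qed
  have ad_pow_C: "(lie_bracket (extend ?x) ^^ m) (C y \<alpha> \<beta>) = fscale ((?\<mu> \<alpha> - ?\<mu> \<beta>) ^ m) (C y \<alpha> \<beta>)"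
    if "\<alpha> \<in> ?Z" "\<beta> \<in> ?Z" for y \<alpha> \<beta> m
    by (induction m) (auto simp: ad_C[OF that] mult.commute)
  define T :: "(('v \<Rightarrow> 'v) \<Rightarrow>\<^sub>0 'k alg_closure) \<Rightarrow> _" where
    "T y = gmult (lie_bracket (basis_elem (s ^^ i)) y) (basis_elem (s ^^ l))" for y
  have T_C: "T (C y \<alpha> \<beta>) = fscale (target \<alpha> \<beta>) (C y \<alpha> \<beta>)" if "\<alpha> \<in> ?Z" "\<beta> \<in> ?Z" for y \<alpha> \<beta>
  proof -
    have left: "gmult (basis_elem (s ^^ j)) (C y \<alpha> \<beta>) = fscale (\<alpha> ^ j) (C y \<alpha> \<beta>)"
      and right: "gmult (C y \<alpha> \<beta>) (basis_elem (s ^^ j)) = fscale (\<beta> ^ j) (C y \<alpha> \<beta>)" for j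
      unfolding C_def E_def using that
      by (simp_all add: gmult_assoc eigenidem_power[OF e])
        (simp add: eigenidem_power[OF e] flip: gmult_assoc)
    show ?thesis
      by (simp add: T_def lie_bracket_def gmult_distrib left right target_def
          left_diff_distrib free.scale_left_diff_distrib)
  qed
  have T_sum: "T (sum f A) = (\<Sum>i\<in>A. T (f i))" for f and A :: "'k alg_closure set"
    by (simp add: T_def lie_bracket_sum_right gmult_sum_left)
  have T_poly: "T y = (\<Sum>m\<le>Polynomial.degree q. fscale (Polynomial.coeff q m) ((lie_bracket (extend ?x) ^^ m) y))" for y
  proof -
    have "T y = (\<Sum>\<alpha>\<in>?Z. \<Sum>\<beta>\<in>?Z. T (C y \<alpha> \<beta>))"
      by (subst decomp[of y, symmetric]) (simp only: T_sum)
    also have "\<dots> = (\<Sum>\<alpha>\<in>?Z. \<Sum>\<beta>\<in>?Z. \<Sum>m\<le>Polynomial.degree q.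
        fscale (Polynomial.coeff q m) ((lie_bracket (extend ?x) ^^ m) (C y \<alpha> \<beta>)))"
      by (intro sum.cong refl)
        (simp add: T_C ad_pow_C poly_altdef free.scale_sum_left flip: q)
    also have "\<dots> = (\<Sum>m\<le>Polynomial.degree q. \<Sum>\<alpha>\<in>?Z. \<Sum>\<beta>\<in>?Z.
        fscale (Polynomial.coeff q m) ((lie_bracket (extend ?x) ^^ m) (C y \<alpha> \<beta>)))"
      by (subst sum.swap[of _ _ ?Z], subst sum.swap[of _ _ ?Z]) (rule refl)
    also have "\<dots> = (\<Sum>m\<le>Polynomial.degree q. fscale (Polynomial.coeff q m) ((lie_bracket (extend ?x) ^^ m) y))"
      by (subst (2) decomp[of y, symmetric]) (simp only: funpow_bracket_sum fscale_sum)
    finally show ?thesis .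
  qed
  show ?thesis
  proof (rule that[where r = "\<lambda>m. \<psi> (Polynomial.coeff q m)" and n = "Polynomial.degree q"])
    show "\<psi> (Polynomial.coeff q 0) = 0" by (simp add: q0 \<psi>_zero)
    fix y :: "('v, 'k) group_ring"
    let ?t = "gmult (lie_bracket (basis_elem (s ^^ i)) y) (basis_elem (s ^^ l))"
    have "?t = fscale (\<psi> 1) ?t" by (subst \<psi>(3)) (rule free.scale_one[symmetric])
    also have "\<dots> = descend (fscale 1 (extend ?t))" by (rule descend_linear(4)[symmetric])
    also have "fscale 1 (extend ?t) = T (extend y)"
      by (simp add: T_def extend_gmult extend_bracket extend_linear)
    also have "T (extend y) = (\<Sum>m\<le>Polynomial.degree q. fscale (Polynomial.coeff q m) (extend ((lie_bracket ?x ^^ m) y)))"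
      by (simp only: T_poly extend_funpow_bracket[OF coefficient_extension_axioms])
    also have "descend (\<Sum>m\<le>Polynomial.degree q. fscale (Polynomial.coeff q m) (extend ((lie_bracket ?x ^^ m) y)))
        = (\<Sum>m\<le>Polynomial.degree q. fscale (\<psi> (Polynomial.coeff q m)) ((lie_bracket ?x ^^ m) y))"
      by (simp only: descend_sum descend_linear(4))
    finally show "?t = \<dots>" .
  qed
qed

lemma generic_coefficients_order_two:
  "generic_coefficients 2 (\<lambda>_. 1 :: 'k::field_char_0)"
  unfolding generic_coefficients_def
proof (intro allI impI)
  fix \<alpha> \<beta> \<gamma> \<delta> :: "'k alg_closure"
  assume *: "\<alpha> ^ 2 = 1 \<and> \<beta> ^ 2 = 1 \<and> \<gamma> ^ 2 = 1 \<and> \<delta> ^ 2 = 1 \<and> \<alpha> \<noteq> \<beta> \<and>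
     cyclic_eigenvalue 2 (\<lambda>_. 1 :: 'k) \<alpha> - cyclic_eigenvalue 2 (\<lambda>_. 1 :: 'k) \<beta>
   = cyclic_eigenvalue 2 (\<lambda>_. 1 :: 'k) \<gamma> - cyclic_eigenvalue 2 (\<lambda>_. 1 :: 'k) \<delta>"
  have "cyclic_eigenvalue 2 (\<lambda>_. 1 :: 'k) z = z" for z by (simp add: cyclic_eigenvalue_def)
  hence eq: "\<alpha> - \<beta> = \<gamma> - \<delta>" using * by metis
  have roots: "\<alpha> ^ 2 = 1" "\<beta> ^ 2 = 1" "\<gamma> ^ 2 = 1" "\<delta> ^ 2 = 1" "\<alpha> \<noteq> \<beta>" using * by blast+
  show "\<alpha> = \<gamma> \<and> \<beta> = \<delta>"
  proof (rule root_of_unity_difference_pattern[of 2])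
    fix i :: nat assume "i \<in> {1..2 - 1}"
    hence "i = 1" by simp
    thus "\<alpha> ^ i - \<beta> ^ i - \<gamma> ^ i + \<delta> ^ i = 0" using eq by simp
  qed (use roots in simp_all)
qed

text \<open>A coincidence of two differences is a linear equation for the coefficients; it is nontrivial by
  \<open>root_of_unity_difference_pattern\<close>.\<close>

lemma not_generic_coefficients:
  fixes a :: "nat \<Rightarrow> 'k::field_char_0"
  assumes "e > 0" "\<not> generic_coefficients e a"
  obtains \<alpha> \<beta> \<gamma> \<delta> where "\<alpha> ^ e = 1" "\<beta> ^ e = 1" "\<gamma> ^ e = 1" "\<delta> ^ e = 1"
    "\<exists>i\<in>{1..e - 1}. \<alpha> ^ i - \<beta> ^ i - \<gamma> ^ i + \<delta> ^ i \<noteq> 0"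
    "(\<Sum>i = 1..e - 1. to_ac (a i) * (\<alpha> ^ i - \<beta> ^ i - \<gamma> ^ i + \<delta> ^ i)) = 0"
proof -
  obtain \<alpha> \<beta> \<gamma> \<delta> where *: "\<alpha> ^ e = 1" "\<beta> ^ e = 1" "\<gamma> ^ e = 1" "\<delta> ^ e = 1" "\<alpha> \<noteq> \<beta>"
     "cyclic_eigenvalue e a \<alpha> - cyclic_eigenvalue e a \<beta> = cyclic_eigenvalue e a \<gamma> - cyclic_eigenvalue e a \<delta>"
     "\<not> (\<alpha> = \<gamma> \<and> \<beta> = \<delta>)"
    using assms(2) unfolding generic_coefficients_def not_all not_imp
    by (elim exE conjE) (rule that)
  have "\<exists>i\<in>{1..e - 1}. \<alpha> ^ i - \<beta> ^ i - \<gamma> ^ i + \<delta> ^ i \<noteq> 0"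
    using root_of_unity_difference_pattern[OF assms(1) *(1-5)] *(7) by blast
  moreover have "(\<Sum>i = 1..e - 1. to_ac (a i) * (\<alpha> ^ i - \<beta> ^ i - \<gamma> ^ i + \<delta> ^ i)) = 0"
  proof -
    have "(\<Sum>i = 1..e - 1. to_ac (a i) * (\<alpha> ^ i - \<beta> ^ i - \<gamma> ^ i + \<delta> ^ i))
        = cyclic_eigenvalue e a \<alpha> - cyclic_eigenvalue e a \<beta> - cyclic_eigenvalue e a \<gamma> + cyclic_eigenvalue e a \<delta>"
      by (simp add: cyclic_eigenvalue_def ring_distribs sum.distrib sum_subtractf)
    thus ?thesis by (simp only: *(6)) simp
  qed
  ultimately show ?thesis by (intro that[OF *(1-4)])
qed

section \<open>Reflections and their powers\<close>

locale complex_reflection_group = V: finite_dimensional_vector_space sc B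
  for sc :: "complex \<Rightarrow> 'v::ab_group_add \<Rightarrow> 'v" and B +
  fixes W S :: "('v \<Rightarrow> 'v) set"
  assumes refl_group: "reflection_group sc W" and refl_system: "reflection_system sc W S"
begin

abbreviation "R \<equiv> reflections sc W"

lemma group_GL: "group (GL sc)"
proof (rule groupI)
  fix f assume "f \<in> carrier (GL sc)"
  hence f: "Vector_Spaces.linear sc sc f" "bij f" by (auto simp: GL_def)
  have "Vector_Spaces.linear sc sc (invf f)"
    using f by (auto simp: Vector_Spaces.linear_iff bij_is_surj bij_is_inj surj_f_inv_f
        intro!: Hilbert_Choice.inv_f_eq)
  thus "\<exists>g\<in>carrier (GL sc). g \<otimes>\<^bsub>GL sc\<^esub> f = \<one>\<^bsub>GL sc\<^esub>"
    using f by (intro bexI[of _ "invf f"]) (auto simp: GL_def bij_imp_bij_inv inv_o_cancel bij_is_inj)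
qed (auto simp: GL_def comp_assoc V.linear_id bij_comp intro: Vector_Spaces.linear_compose)

sublocale GL: group "GL sc" by (rule group_GL)

lemma W_subset: "W \<subseteq> carrier (GL sc)" and W_subgroup: "subgroup W (GL sc)"
  using refl_group subgroup.subset unfolding reflection_group_def by blast+

sublocale transformation_group W
proof
  show "finite W" using refl_group by (simp add: reflection_group_def)
  show "id \<in> W" using subgroup.one_closed[OF W_subgroup] by (simp add: GL_def)
  show "u \<circ> w \<in> W" if "u \<in> W" "w \<in> W" for u w
    using subgroup.m_closed[OF W_subgroup that] by (simp add: GL_def)
  show "\<exists>w'\<in>W. w \<circ> w' = id \<and> w' \<circ> w = id" if "w \<in> W" for w
  proof (intro bexI conjI)
    have w: "w \<in> carrier (GL sc)" using that W_subset by blast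
    show "w \<circ> inv\<^bsub>GL sc\<^esub> w = id" "inv\<^bsub>GL sc\<^esub> w \<circ> w = id"
      using GL.r_inv[OF w] GL.l_inv[OF w] by (simp_all add: GL_def)
    show "inv\<^bsub>GL sc\<^esub> w \<in> W" by (rule subgroup.m_inv_closed[OF W_subgroup that])
  qed
qed

lemma linear_W: "w \<in> W \<Longrightarrow> Vector_Spaces.linear sc sc w"
  using W_subset by (auto simp: GL_def)

lemma W_add: "w \<in> W \<Longrightarrow> w (x + y) = w x + w y" and W_scale: "w \<in> W \<Longrightarrow> w (sc a x) = sc a (w x)"
  using linear_W[of w] by (auto simp: Vector_Spaces.linear_iff)

lemma GL_pow: "s [^]\<^bsub>GL sc\<^esub> (n::nat) = s ^^ n"
  by (induction n) (auto simp: GL_def nat_pow_def funpow_swap1 comp_def fun_eq_iff)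

lemma GL_one: "\<one>\<^bsub>GL sc\<^esub> = id"
  by (simp add: GL_def)

lemma pow_in_W: "w \<in> W \<Longrightarrow> w ^^ n \<in> W"
  by (induction n) (auto simp: id_in_W[unfolded id_def] id_in_W intro: comp_in_W)

abbreviation "refl_order \<equiv> group.ord (GL sc)"

lemma pow_eq_id_iff:
  assumes "w \<in> W" shows "w ^^ n = id \<longleftrightarrow> refl_order w dvd n"
  using GL.pow_eq_id[of w n] W_subset assms unfolding GL_pow GL_one by blast

lemma pow_refl_order: "w \<in> W \<Longrightarrow> w ^^ refl_order w = id"
  by (simp add: pow_eq_id_iff)

lemma funpow_cancel:
  assumes w: "w \<in> W" and ij: "i \<le> j" "w ^^ i = w ^^ j"
  shows "w ^^ (j - i) = id"
proof
  fix x
  have "w ^^ i \<circ> w ^^ (j - i) = w ^^ i"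
    using ij by (metis funpow_add le_add_diff_inverse)
  hence "(w ^^ i) ((w ^^ (j - i)) x) = (w ^^ i) x" by (metis comp_apply)
  thus "(w ^^ (j - i)) x = id x"
    using bij_is_inj[OF bij_W[OF pow_in_W[OF w, of i]]] by (simp add: inj_eq)
qed

lemma refl_order_pos:
  assumes w: "w \<in> W" shows "refl_order w > 0"
proof -
  have "finite (range (\<lambda>n. w ^^ n))"
    using finite_W pow_in_W[OF w] by (auto intro: finite_subset)
  hence "\<not> inj (\<lambda>n. w ^^ n)" using range_inj_infinite by blast
  then obtain i j where ij: "i < j" "w ^^ i = w ^^ j" by (metis injI linorder_neqE_nat)
  hence "w ^^ (j - i) = id" using funpow_cancel[OF w] by simp
  thus ?thesis using ij pow_eq_id_iff[OF w] by (auto intro!: Nat.gr0I)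
qed

lemma invf_eq_pow:
  assumes w: "w \<in> W" shows "invf w = w ^^ (refl_order w - 1)"
proof -
  have "w \<circ> w ^^ (refl_order w - 1) = id"
    using pow_refl_order[OF w] refl_order_pos[OF w] by (metis Suc_pred' funpow.simps(2))
  hence "invf w \<circ> (w \<circ> w ^^ (refl_order w - 1)) = invf w" by simp
  thus ?thesis using inv_comp[OF w] by (simp flip: comp_assoc)
qed

text \<open>The inverse of a generator is a power of it, since \<open>W\<close> is finite.\<close>

lemma generated_induct [consumes 1, case_names id generator comp]:
  assumes "w \<in> W" "P id" "\<And>s. s \<in> S \<Longrightarrow> P s"
    and comp: "\<And>u w. u \<in> W \<Longrightarrow> w \<in> W \<Longrightarrow> P u \<Longrightarrow> P w \<Longrightarrow> P (u \<circ> w)"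
  shows "P w"
proof -
  have gen: "generate (GL sc) S = W" and SW: "S \<subseteq> W"
    using refl_system by (auto simp: reflection_system_def reflections_def)
  have "P w" if "w \<in> generate (GL sc) S" for w
    using that
  proof (induction rule: generate.induct)
    case one
    show ?case using assms(2) unfolding GL_one .
  next
    case (incl s)
    thus ?case by (rule assms(3))
  next
    case (inv s)
    hence s: "s \<in> W" using SW by blast
    have pow: "P (s ^^ n)" for n
    proof (induction n)
      case 0
      show ?case using assms(2) unfolding funpow.simps(1) .
    next
      case (Suc n)
      thus ?case using comp[OF s pow_in_W[OF s] assms(3)[OF inv]] unfolding funpow.simps by blast
    qed
    have "s \<otimes>\<^bsub>GL sc\<^esub> invf s = \<one>\<^bsub>GL sc\<^esub>" using comp_inv[OF s] by (simp add: GL_def)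
    hence "inv\<^bsub>GL sc\<^esub> s = invf s"
      using s inv_in_W[OF s] W_subset by (intro GL.inv_equality[OF GL.inv_comm]) auto
    thus ?case using pow invf_eq_pow[OF s] by simp
  next
    case (eng u w)
    have "u \<otimes>\<^bsub>GL sc\<^esub> w = u \<circ> w" by (simp add: GL_def)
    thus ?case using comp[of u w] eng gen by metis
  qed
  thus ?thesis using assms(1) gen by blast
qed

lemma R_in_W: "r \<in> R \<Longrightarrow> r \<in> W"
  by (simp add: reflections_def)

lemma S_in_R: "s \<in> S \<Longrightarrow> s \<in> R" and S_in_W: "s \<in> S \<Longrightarrow> s \<in> W"
  using refl_system by (auto simp: reflection_system_def reflections_def)

lemma finite_S: "finite S"
  using S_in_W finite_W by (auto intro: finite_subset)

lemma R_not_id: "r \<in> R \<Longrightarrow> r \<noteq> id"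
  by (simp add: reflections_def pseudo_reflection_def)

lemma refl_order_ge_2: "r \<in> R \<Longrightarrow> refl_order r \<ge> 2"
  using refl_order_pos[of r] pow_refl_order[of r] R_not_id[of r] R_in_W[of r]
  by (cases "refl_order r = 1") auto

lemma conj_in_S: "s \<in> S \<Longrightarrow> w \<in> W \<Longrightarrow> w \<circ> s \<circ> invf w \<in> S"
  using refl_system by (auto simp: reflection_system_def conj_class_def)

lemma fixed_space_inj: "s \<in> S \<Longrightarrow> t \<in> S \<Longrightarrow> fixed_space s = fixed_space t \<Longrightarrow> s = t"
  using refl_system by (auto simp: reflection_system_def bij_betw_def inj_on_def)

lemma fixed_space_surj: "r \<in> R \<Longrightarrow> \<exists>s\<in>S. fixed_space s = fixed_space r"
proof -
  assume "r \<in> R"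
  hence "fixed_space r \<in> fixed_space ` S"
    using refl_system by (auto simp: reflection_system_def bij_betw_def)
  thus ?thesis by auto
qed

lemma subspace_fixed_space: "w \<in> W \<Longrightarrow> V.subspace (fixed_space w)"
  using W_scale[of w 0 0] by (auto simp: V.subspace_def fixed_space_def W_add W_scale)

lemma fixed_space_maximal:
  assumes "r \<in> R" "V.subspace U" "fixed_space r \<subseteq> U" "U \<noteq> UNIV"
  shows "U = fixed_space r"
proof -
  obtain H where H: "hyperplane_of sc UNIV H" "\<And>v. v \<in> H \<Longrightarrow> r v = v"
    using assms(1) by (auto simp: reflections_def pseudo_reflection_def)
  have "H \<subseteq> fixed_space r" using H(2) by (auto simp: fixed_space_def)
  hence "V.dim H \<le> V.dim (fixed_space r)" by (rule V.dim_subset)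
  moreover have "V.dim H + 1 = V.dim (UNIV :: 'v set)" using H(1) by (simp only: hyperplane_of_def)
  moreover have "V.dim U < V.dim (UNIV :: 'v set)"
    using assms(2,4) by (intro V.dim_psubset) (auto simp: V.span_eq_iff[THEN iffD2])
  ultimately have "V.dim U \<le> V.dim (fixed_space r)" by linarith
  thus ?thesis
    using V.subspace_dim_equal[OF subspace_fixed_space[OF R_in_W[OF assms(1)]] assms(2,3)] by simp
qed

lemma fixed_space_UNIV_iff: "fixed_space w = UNIV \<longleftrightarrow> w = id"
  by (auto simp: fixed_space_def fun_eq_iff)

lemma fixed_space_subset_pow: "fixed_space w \<subseteq> fixed_space (w ^^ n)"
  by (induction n) (auto simp: fixed_space_def)

lemma fixed_space_pow:
  assumes "r \<in> R" "r ^^ n \<noteq> id"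
  shows "fixed_space (r ^^ n) = fixed_space r"
  using assms fixed_space_UNIV_iff
  by (intro fixed_space_maximal subspace_fixed_space pow_in_W R_in_W fixed_space_subset_pow) auto

lemma pow_in_R:
  assumes "r \<in> R" "r ^^ n \<noteq> id"
  shows "r ^^ n \<in> R"
proof -
  obtain H where "hyperplane_of sc UNIV H" "\<And>v. v \<in> H \<Longrightarrow> r v = v"
    using assms(1) by (auto simp: reflections_def pseudo_reflection_def)
  moreover have "(r ^^ n) v = v" if "r v = v" for v
    using fixed_space_subset_pow[of r n] that by (auto simp: fixed_space_def)
  moreover have "r ^^ n \<in> W" "r ^^ n \<in> carrier (GL sc)"
    using pow_in_W[OF R_in_W[OF assms(1)]] W_subset by blast+
  ultimately show ?thesis using assms(2) by (auto simp: reflections_def pseudo_reflection_def)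
qed

lemma conj_pow:
  assumes w: "w \<in> W" shows "(w \<circ> s \<circ> invf w) ^^ n = w \<circ> s ^^ n \<circ> invf w"
proof (induction n)
  case 0
  show ?case using comp_inv[OF w] by (simp add: id_def)
next
  case (Suc n)
  have "(w \<circ> s \<circ> invf w) ^^ Suc n = w \<circ> s \<circ> (invf w \<circ> w) \<circ> s ^^ n \<circ> invf w"
    by (simp only: funpow.simps Suc) (simp only: comp_assoc)
  also have "\<dots> = w \<circ> s ^^ Suc n \<circ> invf w"
    by (simp only: inv_comp[OF w] comp_id funpow.simps comp_assoc)
  finally show ?case .
qed

lemma conj_eq_id_iff:
  assumes w: "w \<in> W" shows "w \<circ> s \<circ> invf w = id \<longleftrightarrow> s = id"
proof
  assume "w \<circ> s \<circ> invf w = id"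
  hence "invf w \<circ> (w \<circ> s \<circ> invf w) \<circ> w = invf w \<circ> id \<circ> w" by simp
  moreover have "invf w \<circ> (w \<circ> s \<circ> invf w) \<circ> w = (invf w \<circ> w) \<circ> s \<circ> (invf w \<circ> w)"
    by (simp only: comp_assoc)
  ultimately show "s = id" by (simp add: inv_comp[OF w])
qed (simp add: comp_inv[OF w])

lemma refl_order_conj:
  assumes "w \<in> W" "s \<in> W" shows "refl_order (w \<circ> s \<circ> invf w) = refl_order s"
proof -
  have "w \<circ> s \<circ> invf w \<in> W" using assms by (intro comp_in_W inv_in_W)
  hence "refl_order (w \<circ> s \<circ> invf w) dvd n \<longleftrightarrow> refl_order s dvd n" for n
    using assms by (simp only: conj_pow conj_eq_id_iff flip: pow_eq_id_iff)
  thus ?thesis by (meson dvd_antisym dvd_refl)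
qed

lemma fixed_space_conj:
  assumes w: "w \<in> W" shows "fixed_space (w \<circ> s \<circ> invf w) = w ` fixed_space s"
proof -
  have wi: "w (invf w x) = x" "invf w (w x) = x" for x
    using comp_inv[OF w] inv_comp[OF w] by (metis comp_apply id_apply)+
  show ?thesis
  proof
    show "fixed_space (w \<circ> s \<circ> invf w) \<subseteq> w ` fixed_space s"
    proof
      fix x assume "x \<in> fixed_space (w \<circ> s \<circ> invf w)"
      hence "w (s (invf w x)) = x" by (simp add: fixed_space_def)
      hence "s (invf w x) = invf w x" using wi(2) by metis
      thus "x \<in> w ` fixed_space s" using wi(1)[of x] by (force simp: fixed_space_def)
    qed
  qed (auto simp: fixed_space_def wi)
qed

lemma pow_injective:
  assumes "s \<in> S" "t \<in> S" "0 < i" "i < refl_order s" "0 < j" "j < refl_order t" "s ^^ i = t ^^ j"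
  shows "s = t \<and> i = j"
proof -
  have nid: "s ^^ i \<noteq> id" "t ^^ j \<noteq> id"
    using assms by (auto simp: pow_eq_id_iff S_in_W dest: nat_dvd_not_less)
  have "fixed_space s = fixed_space t"
    using fixed_space_pow[OF S_in_R nid(1)] fixed_space_pow[OF S_in_R nid(2)] assms by simp
  hence st: "s = t" using assms fixed_space_inj by blast
  have sW: "s \<in> W" using assms S_in_W by blast
  have "i = j" if ij: "i \<le> j" "s ^^ i = s ^^ j" "j < refl_order s" for i j
  proof -
    have "refl_order s dvd j - i" using funpow_cancel[OF sW ij(1,2)] pow_eq_id_iff[OF sW] by blast
    thus ?thesis using ij dvd_imp_le[of "refl_order s" "j - i"] by (cases "j - i = 0") auto
  qed
  from this[of i j] this[of j i] show ?thesis using assms st by (metis linorder_linear)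
qed

section \<open>Every reflection is a power of a distinguished one\<close>

lemma exists_hyperplane_form:
  assumes "s \<in> S"
  shows "\<exists>\<phi>. (\<forall>x y. \<phi> (x + y) = \<phi> x + \<phi> y) \<and> (\<forall>a x. \<phi> (sc a x) = a * \<phi> x) \<and>
    (\<forall>x. (\<phi> x :: complex) = 0 \<longleftrightarrow> x \<in> fixed_space s)"
proof -
  let ?U = "fixed_space s"
  have s: "s \<in> R" "s \<in> W" using assms S_in_R S_in_W by auto
  have U: "V.subspace ?U" by (rule subspace_fixed_space[OF s(2)])
  obtain v where v: "v \<notin> ?U" using R_not_id[OF s(1)] fixed_space_UNIV_iff[of s] by blast
  obtain C where C: "C \<subseteq> ?U" "V.independent C" "?U \<subseteq> V.span C" using V.basis_exists by metis
  have vC: "v \<notin> V.span C" using C(1) U v V.span_minimal by blast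
  have ind: "V.independent (insert v C)" by (rule V.independent_insertI[OF vC C(2)])
  define E where "E = V.extend_basis (insert v C)"
  have E: "V.independent E" "V.span E = UNIV" "insert v C \<subseteq> E"
    unfolding E_def using V.independent_extend_basis[OF ind] V.span_extend_basis[OF ind]
      V.extend_basis_superset[OF ind] by auto
  define \<phi> where "\<phi> x = V.representation E x v" for x
  have add: "\<phi> (x + y) = \<phi> x + \<phi> y" and scale: "\<phi> (sc a x) = a * \<phi> x" for x y a
    unfolding \<phi>_def by (simp_all add: V.representation_add V.representation_scale E)
  have \<phi>C: "\<phi> b = 0" if "b \<in> C" for b
  proof -
    have "b \<noteq> v" using that vC V.span_base by blast
    thus ?thesis using E(3) that by (simp add: \<phi>_def V.representation_basis[OF E(1)] subset_iff)
  qed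
  have \<phi>v: "\<phi> v = 1" using E(3) by (simp add: \<phi>_def V.representation_basis[OF E(1)])
  have K: "V.subspace {x. \<phi> x = 0}"
    using scale[of 0 0] by (auto simp: V.subspace_def add scale)
  have "?U \<subseteq> {x. \<phi> x = 0}"
    using C(3) V.span_minimal[OF _ K, of C] \<phi>C by auto
  moreover have "{x. \<phi> x = 0} \<noteq> UNIV" using \<phi>v by (metis (mono_tags) UNIV_I mem_Collect_eq zero_neq_one)
  ultimately have "{x. \<phi> x = 0} = ?U" using fixed_space_maximal[OF s(1) K] by blast
  thus ?thesis using add scale by (intro exI[of _ \<phi>]) auto
qed

definition hyperplanes :: "'v set set" where
  "hyperplanes = fixed_space ` S"

text \<open>Only the kernel of this linear form is prescribed.  The free scalar is the reason why products of
  such forms are semi-invariants of \<open>W\<close> and not invariants.\<close>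

definition form :: "'v set \<Rightarrow> 'v \<Rightarrow> complex" where
  "form U = (SOME \<phi>. (\<forall>x y. \<phi> (x + y) = \<phi> x + \<phi> y) \<and> (\<forall>a x. \<phi> (sc a x) = a * \<phi> x) \<and>
     (\<forall>x. \<phi> x = 0 \<longleftrightarrow> x \<in> U))"

lemma form:
  assumes "U \<in> hyperplanes"
  shows "form U (x + y) = form U x + form U y" "form U (sc a x) = a * form U x" "form U x = 0 \<longleftrightarrow> x \<in> U"
proof -
  from assms obtain s where "s \<in> S" "U = fixed_space s" by (auto simp: hyperplanes_def)
  hence "\<exists>\<phi> :: 'v \<Rightarrow> complex. (\<forall>x y. \<phi> (x + y) = \<phi> x + \<phi> y) \<and> (\<forall>a x. \<phi> (sc a x) = a * \<phi> x) \<and>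
     (\<forall>x. \<phi> x = 0 \<longleftrightarrow> x \<in> U)"
    using exists_hyperplane_form[of s] by blast
  from someI_ex[OF this, folded form_def]
  show "form U (x + y) = form U x + form U y" "form U (sc a x) = a * form U x" "form U x = 0 \<longleftrightarrow> x \<in> U"
    by blast+
qed

lemma hyperplane_not_UNIV: "U \<in> hyperplanes \<Longrightarrow> U \<noteq> UNIV"
  using R_not_id S_in_R fixed_space_UNIV_iff by (auto simp: hyperplanes_def)

lemma hyperplane_image:
  assumes "U \<in> hyperplanes" "w \<in> W" shows "w ` U \<in> hyperplanes"
  using assms conj_in_S fixed_space_conj[OF assms(2)] unfolding hyperplanes_def by (metis imageE imageI)

lemma proportional_if_kernel_subset:
  fixes \<phi> \<psi> :: "'v \<Rightarrow> complex"
  assumes "\<And>x y. \<phi> (x + y) = \<phi> x + \<phi> y" "\<And>a x. \<phi> (sc a x) = a * \<phi> x"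
    and "\<And>x y. \<psi> (x + y) = \<psi> x + \<psi> y" "\<And>a x. \<psi> (sc a x) = a * \<psi> x"
    and ker: "\<And>x. \<phi> x = 0 \<Longrightarrow> \<psi> x = 0"
  shows "\<exists>c. \<forall>x. \<psi> x = c * \<phi> x"
proof (cases "\<exists>v. \<phi> v \<noteq> 0")
  case True
  then obtain v where v: "\<phi> v \<noteq> 0" by blast
  have "\<psi> x = \<psi> v / \<phi> v * \<phi> x" for x
  proof -
    define a where "a = - \<phi> x / \<phi> v"
    have "\<phi> (x + sc a v) = 0" using v by (simp only: assms) (simp add: a_def)
    hence "\<psi> x + a * \<psi> v = 0" using ker[of "x + sc a v"] by (simp only: assms)
    thus ?thesis by (simp add: a_def)
  qed
  thus ?thesis by blast
next
  case False
  thus ?thesis using ker by auto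
qed

lemma form_image_proportional:
  assumes "U \<in> hyperplanes" "w \<in> W"
  shows "\<exists>c. \<forall>x. form (w ` U) (w x) = c * form U x"
  using form[OF assms(1)] form[OF hyperplane_image[OF assms]] assms(2)
  by (intro proportional_if_kernel_subset) (auto simp: W_add W_scale)

text \<open>The group element permutes the hyperplanes in \<open>Q\<close>, hence permutes the factors up to scalars.\<close>

lemma prod_form_semiinvariant:
  assumes Q: "finite Q" "Q \<subseteq> hyperplanes" and w: "w \<in> W" and stable: "\<And>U. U \<in> Q \<Longrightarrow> w ` U \<in> Q"
  shows "\<exists>C. \<forall>x. (\<Prod>U\<in>Q. form U (w x)) = C * (\<Prod>U\<in>Q. form U x)"
proof -
  have "inj_on (image w) Q"
    using bij_is_inj[OF bij_W[OF w]] by (auto simp: inj_on_def inj_image_eq_iff)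
  moreover have "image w ` Q \<subseteq> Q" using stable by blast
  ultimately have bij: "bij_betw (image w) Q Q"
    using endo_inj_surj[OF Q(1)] by (auto simp: bij_betw_def)
  have "\<forall>U\<in>Q. \<exists>c. \<forall>x. form (w ` U) (w x) = c * form U x"
    using form_image_proportional[OF _ w] Q(2) by blast
  then obtain c where c: "\<And>U x. U \<in> Q \<Longrightarrow> form (w ` U) (w x) = c U * form U x" by metis
  have "(\<Prod>U\<in>Q. form U (w x)) = (\<Prod>U\<in>Q. c U) * (\<Prod>U\<in>Q. form U x)" for x
  proof -
    have "(\<Prod>U\<in>Q. form U (w x)) = (\<Prod>U\<in>Q. form (w ` U) (w x))"
      by (rule prod.reindex_bij_betw[OF bij, symmetric])
    thus ?thesis by (simp add: c prod.distrib)
  qed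
  thus ?thesis by blast
qed

text \<open>A subspace over an infinite field is not covered by finitely many proper subspaces.  If \<open>p\<close>
  avoids \<open>Q\<close> but not \<open>U\<close>, it is moved in a direction \<open>q\<close> outside \<open>U\<close>, by a multiple that avoids
  finitely many values.\<close>

lemma exists_point_off_hyperplanes:
  assumes "finite Q" "Q \<subseteq> hyperplanes" "V.subspace A" "\<And>U. U \<in> Q \<Longrightarrow> \<not> A \<subseteq> U"
  shows "\<exists>p\<in>A. \<forall>U\<in>Q. form U p \<noteq> 0"
  using assms
proof (induction Q rule: finite_induct)
  case empty
  thus ?case using V.subspace_0 by blast
next
  case (insert U Q)
  then obtain p where p: "p \<in> A" "\<forall>U\<in>Q. form U p \<noteq> 0" by auto
  have U: "U \<in> hyperplanes" and Q: "Q \<subseteq> hyperplanes" using insert.prems by auto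
  obtain q where q: "q \<in> A" "form U q \<noteq> 0" using insert.prems(3)[of U] form(3)[OF U] by blast
  show ?case
  proof (cases "form U p = 0")
    case False
    thus ?thesis using p by auto
  next
    case True
    have "finite (insert 0 ((\<lambda>U'. - form U' p / form U' q) ` Q))" using insert.hyps by simp
    then obtain t where t: "t \<notin> insert 0 ((\<lambda>U'. - form U' p / form U' q) ` Q)"
      using ex_new_if_finite[OF infinite_UNIV_char_0] by blast
    have "form U' (p + sc t q) \<noteq> 0" if "U' \<in> Q" for U'
    proof
      assume "form U' (p + sc t q) = 0"
      hence eq: "form U' p + t * form U' q = 0" using form(1,2)[of U'] that Q by auto
      hence "form U' q \<noteq> 0" using p(2) that by auto
      hence "t = - form U' p / form U' q" using eq by (simp add: field_simps eq_neg_iff_add_eq_0 add.commute)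
      thus False using t that by auto
    qed
    moreover have "form U (p + sc t q) \<noteq> 0" using form(1,2)[OF U] True t q by simp
    moreover have "p + sc t q \<in> A" using p q insert.prems(2) by (simp add: V.subspace_add V.subspace_scale)
    ultimately show ?thesis by auto
  qed
qed

lemma fixed_space_in_hyperplanes: "r \<in> R \<Longrightarrow> fixed_space r \<in> hyperplanes"
  using fixed_space_surj[of r] by (metis hyperplanes_def image_eqI)

text \<open>The factors other than the equation of the hyperplane of \<open>r\<close> are permuted up to scalars, so their
  product is multiplied by a constant.  Evaluation at a point of the hyperplane of \<open>r\<close> that lies on
  none of the other hyperplanes shows that the constant is 1, as \<open>r\<close> fixes this point.\<close>

lemma reflection_semiinvariant:
  assumes r: "r \<in> R" and Q: "finite Q" "Q \<subseteq> hyperplanes" and stable: "\<And>U. U \<in> Q \<Longrightarrow> r ` U \<in> Q"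
    and \<rho>: "\<And>x. form (fixed_space r) (r x) = \<rho> * form (fixed_space r) x"
  shows "(\<Prod>U\<in>Q. form U (r x)) = (if fixed_space r \<in> Q then \<rho> else 1) * (\<Prod>U\<in>Q. form U x)"
proof -
  let ?U = "fixed_space r"
  have rW: "r \<in> W" by (rule R_in_W[OF r])
  have rU: "r ` ?U = ?U" by (auto simp: fixed_space_def image_iff)
  define Q' where "Q' = Q - {?U}"
  have Q': "finite Q'" "Q' \<subseteq> hyperplanes" using Q by (auto simp: Q'_def)
  have "r ` U' \<noteq> ?U" if "U' \<noteq> ?U" for U'
    using that rU bij_is_inj[OF bij_W[OF rW]] by (metis inj_image_eq_iff)
  hence "r ` U' \<in> Q'" if "U' \<in> Q'" for U' using that stable by (auto simp: Q'_def)
  from prod_form_semiinvariant[OF Q' rW this]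
  obtain C where C: "\<And>x. (\<Prod>U\<in>Q'. form U (r x)) = C * (\<Prod>U\<in>Q'. form U x)" by auto
  have "\<not> ?U \<subseteq> U'" if "U' \<in> Q'" for U'
  proof
    assume "?U \<subseteq> U'"
    moreover have U': "U' \<in> hyperplanes" using that Q'(2) by blast
    then obtain t where "t \<in> S" "U' = fixed_space t" by (auto simp: hyperplanes_def)
    hence "V.subspace U'" using subspace_fixed_space[OF S_in_W] by simp
    ultimately have "U' = ?U" using fixed_space_maximal[OF r] hyperplane_not_UNIV[OF U'] by simp
    thus False using that by (simp add: Q'_def)
  qed
  then obtain p where p: "p \<in> ?U" "\<forall>U\<in>Q'. form U p \<noteq> 0"
    using exists_point_off_hyperplanes[OF Q' subspace_fixed_space[OF rW]] by blast
  have "(\<Prod>U\<in>Q'. form U p) \<noteq> 0" using p(2) Q'(1) by simp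
  hence C1: "C = 1" using C[of p] p(1) by (simp add: fixed_space_def)
  show ?thesis
  proof (cases "?U \<in> Q")
    case True
    hence "Q = insert ?U Q'" "?U \<notin> Q'" by (auto simp: Q'_def)
    thus ?thesis using Q'(1) C[of x] C1 \<rho>[of x] by simp
  next
    case False
    hence "Q = Q'" by (auto simp: Q'_def)
    thus ?thesis using False C[of x] C1 by simp
  qed
qed

text \<open>Here \<open>t\<^sup>k x = x + k (t x - x)\<close>, and \<open>t\<close> has finite order.\<close>

lemma unipotent_is_id:
  assumes t: "t \<in> W" and fixed: "\<And>x. t (t x - x) = t x - x"
  shows "t = id"
proof
  fix x
  have "(t ^^ k) x = x + sc (of_nat k) (t x - x)" for k
  proof (induction k)
    case (Suc k)
    have "(t ^^ Suc k) x = t x + sc (of_nat k) (t x - x)"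
      by (simp add: Suc W_add[OF t] W_scale[OF t] fixed)
    also have "\<dots> = x + sc (of_nat (Suc k)) (t x - x)"
      by (simp add: V.scale_left_distrib)
    finally show ?case .
  qed simp
  from this[of "refl_order t"] have "sc (of_nat (refl_order t)) (t x - x) = 0"
    by (simp add: pow_refl_order[OF t])
  thus "t x = id x" using refl_order_pos[OF t] by simp
qed

text \<open>Let \<open>P\<close> be the product of the equations of the hyperplanes of the conjugates of \<open>s\<close>.  The
  conjugates of \<open>s\<close> multiply \<open>P\<close> by the same scalar \<open>\<sigma>\<close> as \<open>s\<close>, and the other elements of \<open>S\<close> fix \<open>P\<close>.
  As \<open>S\<close> generates \<open>W\<close>, each element of \<open>W\<close>, and \<open>r\<close> in particular, multiplies \<open>P\<close> by a power \<open>\<sigma>\<^sup>n\<close>.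
  For \<open>r\<close> and \<open>s\<close> the scalar is also the one by which they multiply the equation of their common
  hyperplane.  Thus \<open>r\<close> and \<open>s\<^sup>n\<close> differ by a unipotent element of \<open>W\<close>, which is trivial.\<close>

theorem reflection_is_power:
  assumes r: "r \<in> R" and s: "s \<in> S" and same: "fixed_space s = fixed_space r"
  shows "\<exists>n. r = s ^^ n"
proof -
  let ?U = "fixed_space r"
  define Q where "Q = fixed_space ` conj_class W s"
  have rW: "r \<in> W" and sW: "s \<in> W" using r s R_in_W S_in_W by auto
  have conj_S: "conj_class W s \<subseteq> S" using conj_in_S[OF s] by (auto simp: conj_class_def)
  have Q: "finite Q" "Q \<subseteq> hyperplanes"
    using conj_S finite_W by (auto simp: Q_def hyperplanes_def conj_class_def)
  have stable: "w ` U \<in> Q" if "w \<in> W" "U \<in> Q" for w U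
  proof -
    from that obtain u where u: "u \<in> W" "U = fixed_space (u \<circ> s \<circ> invf u)" by (auto simp: Q_def conj_class_def)
    have "w ` U = fixed_space ((w \<circ> u) \<circ> s \<circ> invf (w \<circ> u))"
      using that u by (simp only: fixed_space_conj comp_in_W image_comp)
    thus ?thesis using that u comp_in_W by (auto simp: Q_def conj_class_def)
  qed
  have UQ: "?U \<in> Q"
  proof -
    have "s = id \<circ> s \<circ> invf id" by simp
    hence "s \<in> conj_class W s" unfolding conj_class_def using id_in_W by blast
    thus ?thesis unfolding Q_def same[symmetric] by (rule imageI)
  qed
  have UH: "?U \<in> hyperplanes" using Q UQ by blast
  define P where "P x = (\<Prod>U\<in>Q. form U x)" for x
  obtain \<sigma> where \<sigma>: "\<And>x. form ?U (s x) = \<sigma> * form ?U x"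
  proof -
    have "s ` ?U = ?U" unfolding same[symmetric] by (auto simp: fixed_space_def image_iff)
    thus ?thesis using form_image_proportional[OF UH sW] that by auto
  qed
  obtain \<rho> where \<rho>: "\<And>x. form ?U (r x) = \<rho> * form ?U x"
  proof -
    have "r ` ?U = ?U" by (auto simp: fixed_space_def image_iff)
    thus ?thesis using form_image_proportional[OF UH rW] that by auto
  qed
  have P_s: "P (s x) = \<sigma> * P x" for x
  proof -
    have "(\<Prod>U\<in>Q. form U (s x)) = (if fixed_space s \<in> Q then \<sigma> else 1) * (\<Prod>U\<in>Q. form U x)"
      by (rule reflection_semiinvariant[OF S_in_R[OF s] Q]) (rule stable[OF sW], assumption, unfold same, rule \<sigma>)
    also have "(if fixed_space s \<in> Q then \<sigma> else 1) = \<sigma>" using UQ same by metis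
    finally show ?thesis unfolding P_def .
  qed
  have P_r: "P (r x) = \<rho> * P x" for x
  proof -
    have "(\<Prod>U\<in>Q. form U (r x)) = (if ?U \<in> Q then \<rho> else 1) * (\<Prod>U\<in>Q. form U x)"
      by (rule reflection_semiinvariant[OF r Q]) (rule stable[OF rW], assumption, rule \<rho>)
    also have "(if ?U \<in> Q then \<rho> else 1) = \<rho>" using UQ by metis
    finally show ?thesis unfolding P_def .
  qed
  have "\<exists>n. \<forall>x. P (w x) = \<sigma> ^ n * P x" if "w \<in> W" for w
    using that
  proof (induction w rule: generated_induct)
    case id
    show ?case by (intro exI[of _ 0]) simp
  next
    case (generator t)
    show ?case
    proof (cases "fixed_space t \<in> Q")
      case True
      then obtain w where w: "w \<in> W" "fixed_space t = fixed_space (w \<circ> s \<circ> invf w)"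
        by (auto simp: Q_def conj_class_def)
      hence t: "t = w \<circ> s \<circ> invf w" using fixed_space_inj generator conj_in_S[OF s] by blast
      obtain C where C: "\<And>x. P (w x) = C * P x"
        using prod_form_semiinvariant[OF Q w(1) stable[OF w(1)]] by (auto simp: P_def)
      have "P (t x) = \<sigma> ^ 1 * P x" for x
      proof -
        have "P (t x) = \<sigma> * P (w (invf w x))" by (simp add: t C P_s)
        also have "w (invf w x) = x" using comp_inv[OF w(1)] by (metis comp_apply id_apply)
        finally show ?thesis by simp
      qed
      thus ?thesis by blast
    next
      case False
      obtain \<tau> where \<tau>: "\<And>x. form (fixed_space t) (t x) = \<tau> * form (fixed_space t) x"
      proof -
        have "t ` fixed_space t = fixed_space t" by (auto simp: fixed_space_def image_iff)
        thus ?thesis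
          using form_image_proportional[OF fixed_space_in_hyperplanes[OF S_in_R[OF generator]] S_in_W[OF generator]]
            that by auto
      qed
      have "P (t x) = \<sigma> ^ 0 * P x" for x
      proof -
        have "(\<Prod>U\<in>Q. form U (t x)) = (if fixed_space t \<in> Q then \<tau> else 1) * (\<Prod>U\<in>Q. form U x)"
          by (rule reflection_semiinvariant[OF S_in_R[OF generator] Q])
            (rule stable[OF S_in_W[OF generator]], assumption, rule \<tau>)
        also have "(if fixed_space t \<in> Q then \<tau> else 1) = \<sigma> ^ 0" using False by (metis power_0)
        finally show ?thesis unfolding P_def .
      qed
      thus ?thesis by blast
    qed
  next
    case (comp u w)
    then obtain m n where "\<And>x. P (u x) = \<sigma> ^ m * P x" "\<And>x. P (w x) = \<sigma> ^ n * P x" by blast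
    hence "P ((u \<circ> w) x) = \<sigma> ^ (m + n) * P x" for x by (simp add: power_add)
    thus ?case by blast
  qed
  then obtain n where n: "\<And>x. P (r x) = \<sigma> ^ n * P x" using rW by blast
  have "\<not> UNIV \<subseteq> U" if "U \<in> Q" for U using that Q hyperplane_not_UNIV by blast
  then obtain p where "\<forall>U\<in>Q. form U p \<noteq> 0"
    using exists_point_off_hyperplanes[OF Q V.subspace_UNIV] by blast
  hence "P p \<noteq> 0" using Q(1) by (simp add: P_def)
  hence \<rho>\<sigma>: "\<rho> = \<sigma> ^ n" using n[of p] P_r[of p] by simp
  have "\<sigma> \<noteq> 0"
  proof
    assume "\<sigma> = 0"
    obtain v where v: "v \<notin> ?U" using hyperplane_not_UNIV[OF UH] by blast
    have "form ?U (s (invf s v)) = 0" using \<sigma> \<open>\<sigma> = 0\<close> by simp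
    moreover have "s (invf s v) = v" using comp_inv[OF sW] by (metis comp_apply id_apply)
    ultimately show False using v form(3)[OF UH] by simp
  qed
  define u where "u = s ^^ n"
  have uW: "u \<in> W" unfolding u_def by (rule pow_in_W[OF sW])
  have form_u: "form ?U (u x) = \<sigma> ^ n * form ?U x" for x
    unfolding u_def by (induction n) (auto simp: \<sigma>)
  define t where "t = invf u \<circ> r"
  have tW: "t \<in> W" unfolding t_def by (intro comp_in_W inv_in_W uW rW)
  have ut: "u (t x) = r x" for x using comp_inv[OF uW] by (metis t_def comp_apply id_apply)
  have fixes_U: "t v = v" if "v \<in> ?U" for v
  proof -
    have "v \<in> fixed_space (s ^^ n)" using subsetD[OF fixed_space_subset_pow[of s n], of v] that same by simp
    hence "u v = v" by (simp add: u_def fixed_space_def)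
    hence "invf u v = v" using inv_comp[OF uW] by (metis comp_apply id_apply)
    thus ?thesis using that by (simp add: t_def fixed_space_def)
  qed
  have "t x - x \<in> ?U" for x
  proof -
    have "\<sigma> ^ n * form ?U (t x) = \<sigma> ^ n * form ?U x"
      by (simp only: form_u[symmetric] ut) (simp only: \<rho> \<rho>\<sigma> form_u)
    hence "form ?U (t x) = form ?U x" using \<open>\<sigma> \<noteq> 0\<close> by simp
    moreover have "form ?U (t x) = form ?U (t x - x) + form ?U x"
      using form(1)[OF UH, of "t x - x" x] by simp
    ultimately show ?thesis using form(3)[OF UH] by simp
  qed
  hence "t = id" by (intro unipotent_is_id tW fixes_U)
  hence "r = u" using ut by (auto simp: fun_eq_iff)
  thus ?thesis unfolding u_def by blast
qed

corollary reflections_eq_powers: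
  "R = {s ^^ i | s i. s \<in> S \<and> i \<in> {1..refl_order s - 1}}"
proof
  show "R \<subseteq> {s ^^ i | s i. s \<in> S \<and> i \<in> {1..refl_order s - 1}}"
  proof
    fix r assume r: "r \<in> R"
    then obtain s where s: "s \<in> S" "fixed_space s = fixed_space r" using fixed_space_surj by blast
    then obtain n where n: "r = s ^^ n" using reflection_is_power[OF r] by blast
    let ?e = "refl_order s" and ?i = "n mod refl_order s"
    have sW: "s \<in> W" by (rule S_in_W[OF s(1)])
    have "s ^^ n = s ^^ ?i \<circ> (s ^^ ?e) ^^ (n div ?e)"
      by (metis funpow_add funpow_mult mod_mult_div_eq mult.commute)
    moreover have "(s ^^ ?e) ^^ k = id" for k
      unfolding pow_refl_order[OF sW] by (induction k) auto
    ultimately have eq: "r = s ^^ ?i" by (simp add: n)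
    moreover have "?i \<noteq> 0" using R_not_id[OF r] eq by (intro notI) simp
    moreover have "?i < ?e" using refl_order_pos[OF sW] by simp
    ultimately show "r \<in> {s ^^ i | s i. s \<in> S \<and> i \<in> {1..refl_order s - 1}}" using s(1) by force
  qed
  show "{s ^^ i | s i. s \<in> S \<and> i \<in> {1..refl_order s - 1}} \<subseteq> R"
  proof clarify
    fix s i assume s: "s \<in> S" and i: "i \<in> {1..refl_order s - 1}"
    have "\<not> refl_order s dvd i" using i by (intro nat_dvd_not_less) auto
    hence "s ^^ i \<noteq> id" using pow_eq_id_iff[OF S_in_W[OF s]] by blast
    thus "s ^^ i \<in> R" by (rule pow_in_R[OF S_in_R[OF s]])
  qed
qed

end

section \<open>Hyperplanes in the parameter space\<close>

text \<open>The condition has coefficients in the algebraic closure and may cut out a smaller subspace over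
  \<open>'k\<close>.  A linear functional that maps one of the coefficients to 1 turns it into a single nonzero
  linear form over \<open>'k\<close>.\<close>

lemma zero_set_in_hyperplane:
  fixes \<gamma> :: "'i \<Rightarrow> 'k::field alg_closure" and I :: "'i set"
  defines "V \<equiv> {lam :: 'i \<Rightarrow>\<^sub>0 'k. Poly_Mapping.keys lam \<subseteq> I}"
  assumes I: "finite I" "p \<in> I" and nz: "\<gamma> p \<noteq> 0"
  obtains H where "hyperplane_of fscale V H"
    "\<And>lam. lam \<in> V \<Longrightarrow> (\<Sum>q\<in>I. to_ac (Poly_Mapping.lookup lam q) * \<gamma> q) = 0 \<Longrightarrow> lam \<in> H"
proof -
  interpret coefficient_extension "to_ac :: 'k \<Rightarrow> 'k alg_closure"
    by unfold_locales auto
  obtain \<psi> where \<psi>: "\<And>x y. \<psi> (x + y) = \<psi> x + \<psi> y" "\<And>a x. \<psi> (to_ac a * x) = a * \<psi> x" "\<psi> (\<gamma> p) = 1"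
    using exists_semilinear_functional[OF nz] by metis
  have \<psi>0: "\<psi> 0 = 0" by (metis add_cancel_right_right \<psi>(1))
  define f where "f lam = (\<Sum>q\<in>I. Poly_Mapping.lookup lam q * \<psi> (\<gamma> q))" for lam
  have f_eq: "f lam = \<psi> (\<Sum>q\<in>I. to_ac (Poly_Mapping.lookup lam q) * \<gamma> q)" for lam
  proof -
    have "\<psi> (\<Sum>q\<in>J. to_ac (Poly_Mapping.lookup lam q) * \<gamma> q) = (\<Sum>q\<in>J. Poly_Mapping.lookup lam q * \<psi> (\<gamma> q))" for J
      by (induction J rule: infinite_finite_induct) (auto simp: \<psi> \<psi>0)
    thus ?thesis by (simp add: f_def)
  qed
  have f_linear: "f (x + y) = f x + f y" "f (fscale a x) = a * f x" "f (x - y) = f x - f y" for x y a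
    by (simp_all add: f_def lookup_add lookup_minus ring_distribs sum.distrib sum_distrib_left mult_ac sum_subtractf)
  define v where "v = (Poly_Mapping.single p 1 :: 'i \<Rightarrow>\<^sub>0 'k)"
  have fv: "f v = 1"
  proof -
    have "f v = (\<Sum>q\<in>I. if q = p then 1 else 0)"
      unfolding f_def by (intro sum.cong) (auto simp: v_def lookup_single when_def \<psi>(3))
    thus ?thesis using I by simp
  qed
  define H where "H = {lam \<in> V. f lam = 0}"
  have V: "free.subspace V"
    unfolding V_def free.subspace_def by (auto simp: in_keys_iff lookup_add subset_iff) (metis add_0)
  have vV: "v \<in> V" using I by (simp add: V_def v_def)
  have H: "free.subspace H"
    using V f_linear(2)[of 0] by (auto simp: H_def free.subspace_def f_linear)
  let ?A = "(\<lambda>q. Poly_Mapping.single q 1) ` I :: ('i \<Rightarrow>\<^sub>0 'k) set"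
  have "V \<subseteq> free.span ?A"
  proof
    fix x assume "x \<in> V"
    hence keys: "Poly_Mapping.lookup x q = 0" if "q \<notin> I" for q using that by (auto simp: V_def in_keys_iff)
    have x: "x = (\<Sum>q\<in>I. fscale (Poly_Mapping.lookup x q) (Poly_Mapping.single q 1))"
      using I keys by (intro poly_mapping_eqI) (auto simp: lookup_sum lookup_single when_def)
    show "x \<in> free.span ?A"
      by (subst x, rule free.span_sum, rule free.span_scale, rule free.span_base, erule imageI)
  qed
  hence "H \<subseteq> free.span ?A" by (auto simp: H_def)
  then obtain C where C: "finite C" "C \<subseteq> H" "free.independent C" "free.span C = H" "card C = free.dim H"
    using free.finite_basis_of_subspace[OF H] I by (metis finite_imageI)
  have vC: "v \<notin> free.span C" using fv by (simp add: C(4) H_def)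
  have "free.independent (insert v C)" by (rule free.independent_insertI[OF vC C(3)])
  moreover have "V \<subseteq> free.span (insert v C)"
  proof
    fix x assume x: "x \<in> V"
    have "x - fscale (f x) v \<in> H"
      using x vV V fv by (simp add: H_def f_linear free.subspace_diff free.subspace_scale)
    thus "x \<in> free.span (insert v C)" unfolding free.span_insert C(4) by blast
  qed
  moreover have "insert v C \<subseteq> V" using C(2) vV by (auto simp: H_def)
  ultimately have "card (insert v C) = free.dim V" by (intro free.basis_card_eq_dim)
  moreover have "v \<notin> C" using vC free.span_base by blast
  ultimately have "free.dim H + 1 = free.dim V" using C(1,5) by simp
  hence "hyperplane_of fscale V H" using H by (auto simp: hyperplane_of_def H_def)
  thus ?thesis by (rule that) (simp add: H_def f_eq \<psi>0)
qed

section \<open>The centre of the group algebra\<close>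

context transformation_group
begin

lemma basis_elem_inverse_mult:
  assumes "w \<in> W"
  shows "gmult (basis_elem (invf w)) (basis_elem w) = basis_elem id"
    and "gmult (basis_elem w) (basis_elem (invf w)) = basis_elem id"
  by (simp_all only: gmult_single comp_inv[OF assms] inv_comp[OF assms] mult_1)

lemma conj_stable_lie_generated:
  assumes T: "T \<subseteq> group_algebra W" "\<And>w x. w \<in> W \<Longrightarrow> x \<in> T \<Longrightarrow> conj_by w x \<in> T"
    and w: "w \<in> W" and x: "x \<in> lie_generated (group_algebra W) T"
  shows "conj_by w x \<in> lie_generated (group_algebra W) T"
proof -
  let ?G = "group_algebra W" and ?H = "lie_generated (group_algebra W) T"
  have H: "lie_subalgebra ?H ?G"
    by (rule lie_subalgebra_lie_generated[OF T(1) lie_subalgebra_group_algebra])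
  have "lie_subalgebra {x \<in> ?G. conj_by w x \<in> ?H} ?G"
    using H lie_subalgebra_group_algebra[unfolded lie_subalgebra_def] w unfolding lie_subalgebra_def
    by (auto simp: free.subspace_def conj_by_bracket)
  moreover have "T \<subseteq> {x \<in> ?G. conj_by w x \<in> ?H}"
    using T w lie_generated_superset[of T ?G] by blast
  ultimately show ?thesis using lie_generated_minimal x by blast
qed

definition commutes_with_group where
  "commutes_with_group x \<longleftrightarrow> (\<forall>w\<in>W. lie_bracket x (basis_elem w) = 0)"

lemma commutes_with_group_bracket:
  assumes "commutes_with_group x" "y \<in> group_algebra W"
  shows "lie_bracket x y = 0" "lie_bracket y x = 0"
  using central_if_commutes_with_group[of x y] assms lie_bracket_minus_swap[of y x]
  by (auto simp: commutes_with_group_def)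

lemma commutes_with_group_diff:
  "commutes_with_group x \<Longrightarrow> commutes_with_group y \<Longrightarrow> commutes_with_group (x - y)"
  by (simp add: commutes_with_group_def lie_bracket_diff_left)

lemma subspace_commutes_with_group: "free.subspace {x. commutes_with_group x}"
  by (simp add: free.subspace_def commutes_with_group_def lie_bracket_add_left)

lemma commutes_with_group_if_conj_invariant:
  fixes x :: "('v, 'k::field) group_ring"
  assumes "\<And>w. w \<in> W \<Longrightarrow> conj_by w x = x"
  shows "commutes_with_group x"
  unfolding commutes_with_group_def
proof
  fix w assume w: "w \<in> W"
  have "gmult x (basis_elem w) = gmult (conj_by w x) (basis_elem w)" by (simp only: assms[OF w])
  also have "\<dots> = gmult (basis_elem w) x"
    by (simp only: conj_by_def gmult_assoc basis_elem_inverse_mult[OF w] gmult_id_right)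
  finally show "lie_bracket x (basis_elem w) = 0" by (simp add: lie_bracket_def)
qed

text \<open>Averaging over \<open>W\<close> by conjugation kills commutators, since \<open>g y\<close> is the conjugate of \<open>y g\<close> by
  \<open>g\<close>, and multiplies central elements by the order of \<open>W\<close>.\<close>

lemma central_commutator_eq_zero:
  fixes z :: "('v, 'k::field_char_0) group_ring"
  assumes z: "z \<in> lie_derived (group_algebra W)" and central: "commutes_with_group z"
  shows "z = 0"
proof -
  define E where "E x = (\<Sum>w\<in>W. conj_by w x)" for x :: "('v, 'k) group_ring"
  have E_linear: "E (x + y) = E x + E y" "E (fscale a x) = fscale a (E x)" "E 0 = 0" "E (x - y) = E x - E y" for x y a
    by (simp_all add: E_def sum.distrib fscale_sum sum_subtractf)
  have right_bij: "bij_betw (\<lambda>w. w \<circ> g) W W" if "g \<in> W" for g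
  proof (rule bij_betwI[where g = "\<lambda>w. w \<circ> invf g"])
    show "(w \<circ> g) \<circ> invf g = w" "(w \<circ> invf g) \<circ> g = w" for w
      using that by (simp_all add: comp_assoc comp_inv inv_comp)
  qed (use that in \<open>auto intro: comp_in_W inv_in_W\<close>)
  have E_conj: "E (conj_by g x) = E x" if "g \<in> W" for g x
  proof -
    have "E (conj_by g x) = (\<Sum>w\<in>W. conj_by (w \<circ> g) x)"
      unfolding E_def using that by (intro sum.cong) (auto simp: conj_by_conj_by)
    also have "\<dots> = E x" unfolding E_def by (rule sum.reindex_bij_betw[OF right_bij[OF that]])
    finally show ?thesis .
  qed
  have E_bracket: "E (lie_bracket x y) = 0" if "x \<in> group_algebra W" for x y
    using that
  proof (induction x rule: group_algebra_induct)
    case (basis g)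
    have "conj_by g (gmult y (basis_elem g)) = gmult (basis_elem g) y"
      by (simp only: conj_by_def gmult_assoc basis_elem_inverse_mult[OF basis] gmult_id_right)
    hence "E (gmult (basis_elem g) y) = E (gmult y (basis_elem g))"
      using E_conj[OF basis] by metis
    thus ?case by (simp add: lie_bracket_def E_linear)
  qed (simp_all add: lie_bracket_add_left E_linear)
  have "E z = 0"
    using z unfolding lie_derived_def
    by (induction rule: free.span_induct) (auto simp: free.subspace_def E_linear E_bracket)
  moreover have "conj_by w z = z" if w: "w \<in> W" for w
  proof -
    have "gmult z (basis_elem (invf w)) = gmult (basis_elem (invf w)) z"
      using central inv_in_W[OF w] by (auto simp: commutes_with_group_def lie_bracket_eq_0_iff)
    thus ?thesis using basis_elem_inverse(1)[OF w] by (simp only: conj_by_def)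
  qed
  hence "E z = (\<Sum>w\<in>W. z)" unfolding E_def by (rule sum.cong[OF refl])
  ultimately show ?thesis using card_W_pos by (simp add: free.sum_constant_scale)
qed

end

lemma independent_if_pivots:
  fixes z :: "'c \<Rightarrow> ('g \<Rightarrow>\<^sub>0 'k::field)"
  assumes "finite I" and piv: "\<And>c. c \<in> I \<Longrightarrow> Poly_Mapping.lookup (z c) (p c) \<noteq> 0"
    and zero: "\<And>c d. c \<in> I \<Longrightarrow> d \<in> I \<Longrightarrow> c \<noteq> d \<Longrightarrow> Poly_Mapping.lookup (z c) (p d) = 0"
  shows "inj_on z I" "free.independent (z ` I)"
proof -
  show inj: "inj_on z I" using piv zero by (metis inj_onI)
  show "free.independent (z ` I)"
  proof (rule free.independent_if_scalars_zero)
    fix u x assume sum: "(\<Sum>x\<in>z ` I. fscale (u x) x) = 0" and "x \<in> z ` I"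
    then obtain d where d: "d \<in> I" "x = z d" by auto
    have "0 = Poly_Mapping.lookup (\<Sum>c\<in>I. fscale (u (z c)) (z c)) (p d)"
      using sum inj by (simp add: sum.reindex)
    also have "\<dots> = (\<Sum>c\<in>I. if c = d then u (z d) * Poly_Mapping.lookup (z d) (p d) else 0)"
      unfolding lookup_sum using zero d(1) by (intro sum.cong) auto
    also have "\<dots> = u (z d) * Poly_Mapping.lookup (z d) (p d)" using d(1) assms(1) by simp
    finally show "u x = 0" using piv[OF d(1)] d(2) by auto
  qed (use assms(1) in simp)
qed

section \<open>Lie algebras generated by generic elements\<close>

context complex_reflection_group
begin

text \<open>For \<open>s\<close> of order 2 the coefficient of \<open>s\<close> is 1, so that \<open>S\<^sub>0\<close> and \<open>S\<^sub>+\<close> can be treated alike.\<close>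

definition coeffs :: "(('v, 'k::field) parameter) \<Rightarrow> ('v \<Rightarrow> 'v) \<Rightarrow> nat \<Rightarrow> 'k" where
  "coeffs lam s = (if refl_order s = 2 then \<lambda>_. 1 else (\<lambda>i. Poly_Mapping.lookup lam (conj_class W s, i)))"

definition lie_generator :: "(('v, 'k::field) parameter) \<Rightarrow> ('v \<Rightarrow> 'v) \<Rightarrow> (('v, 'k) group_ring)" where
  "lie_generator lam s = cyclic_element (refl_order s) (coeffs lam s) s"

lemma conj_class_self: "s \<in> conj_class W s"
proof -
  have "s = id \<circ> s \<circ> invf id" by simp
  thus ?thesis unfolding conj_class_def using id_in_W by blast
qed

lemma conj_class_conj:
  assumes w: "w \<in> W" shows "conj_class W (w \<circ> s \<circ> invf w) = conj_class W s"
proof -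
  have sub: "conj_class W (w \<circ> s \<circ> invf w) \<subseteq> conj_class W s" if w: "w \<in> W" for w s
  proof
    fix t assume "t \<in> conj_class W (w \<circ> s \<circ> invf w)"
    then obtain u where u: "u \<in> W" "t = u \<circ> (w \<circ> s \<circ> invf w) \<circ> invf u" by (auto simp: conj_class_def)
    hence "t = (u \<circ> w) \<circ> s \<circ> invf (u \<circ> w)" using w by (simp only: inv_comp_W comp_assoc)
    thus "t \<in> conj_class W s" using comp_in_W[OF u(1) w] by (auto simp: conj_class_def)
  qed
  have "s = invf w \<circ> (w \<circ> s \<circ> invf w) \<circ> invf (invf w)"
  proof -
    have "invf w \<circ> (w \<circ> s \<circ> invf w) \<circ> invf (invf w) = (invf w \<circ> w) \<circ> s \<circ> (invf w \<circ> w)"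
      by (simp only: inv_inv_W[OF w] comp_assoc)
    thus ?thesis by (simp add: inv_comp[OF w])
  qed
  hence "conj_class W s \<subseteq> conj_class W (w \<circ> s \<circ> invf w)"
    using sub[OF inv_in_W[OF w], of "w \<circ> s \<circ> invf w"] by simp
  thus ?thesis using sub[OF w] by blast
qed

lemma conj_class_eq: "t \<in> conj_class W s \<Longrightarrow> conj_class W t = conj_class W s"
  using conj_class_conj by (auto simp: conj_class_def[of W s])

lemma refl_order_conj_class: "s \<in> S \<Longrightarrow> t \<in> conj_class W s \<Longrightarrow> refl_order t = refl_order s"
  using refl_order_conj S_in_W by (auto simp: conj_class_def)

lemma conj_class_subset: "s \<in> S \<Longrightarrow> conj_class W s \<subseteq> S"
  using conj_in_S by (auto simp: conj_class_def)

lemma class_order_conj_class: "s \<in> S \<Longrightarrow> class_order sc (conj_class W s) = refl_order s"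
proof -
  assume s: "s \<in> S"
  have "refl_order ` conj_class W s = {refl_order s}"
    using refl_order_conj_class[OF s] conj_class_self[of s] by blast
  thus ?thesis by (simp add: class_order_def)
qed

lemma lie_generator_order_two:
  assumes "refl_order s = 2" shows "lie_generator lam s = basis_elem s"
proof -
  have "{1..2 - 1 :: nat} = {1}" by auto
  thus ?thesis using assms by (simp add: lie_generator_def cyclic_element_def coeffs_def)
qed

lemma hecke_lie_param_eq:
  "hecke_lie_param sc W S lam = lie_generated (group_algebra W) (lie_generator lam ` S)"
proof -
  have plus: "s \<in> S_plus sc S \<longleftrightarrow> s \<in> S \<and> refl_order s \<noteq> 2" for s
    using refl_order_ge_2[OF S_in_R, of s] by (auto simp: S_plus_def)
  have gen: "(\<Sum>i = 1..class_order sc c - 1. fscale (Poly_Mapping.lookup lam (c, i)) (basis_elem (s ^^ i))) = lie_generator lam s"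
    if "s \<in> S" "refl_order s \<noteq> 2" "c = conj_class W s" for c s
    using that by (simp add: lie_generator_def cyclic_element_def coeffs_def class_order_conj_class)
  have classes: "c \<in> C_plus sc W S \<and> s \<in> c \<longleftrightarrow> s \<in> S \<and> refl_order s \<noteq> 2 \<and> c = conj_class W s" for c s
  proof
    assume *: "c \<in> C_plus sc W S \<and> s \<in> c"
    then obtain t where t: "t \<in> S" "refl_order t \<noteq> 2" "c = conj_class W t"
      by (auto simp: C_plus_def conj_classes_def plus)
    thus "s \<in> S \<and> refl_order s \<noteq> 2 \<and> c = conj_class W s"
      using * conj_class_eq[of s t] refl_order_conj_class[of t s] conj_class_subset[of t] by auto
  next
    assume "s \<in> S \<and> refl_order s \<noteq> 2 \<and> c = conj_class W s"
    thus "c \<in> C_plus sc W S \<and> s \<in> c" by (auto simp: C_plus_def conj_classes_def plus conj_class_self)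
  qed
  have "basis_elem ` S_zero sc S = lie_generator lam ` {s \<in> S. refl_order s = 2}"
    by (auto simp: S_zero_def lie_generator_order_two image_iff)
  moreover have "{\<Sum>i = 1..class_order sc c - 1. fscale (Poly_Mapping.lookup lam (c, i)) (basis_elem (s ^^ i))
        | c s. c \<in> C_plus sc W S \<and> s \<in> c} = lie_generator lam ` {s \<in> S. refl_order s \<noteq> 2}" (is "?A = ?B")
  proof
    show "?A \<subseteq> ?B"
    proof clarify
      fix c s assume "c \<in> C_plus sc W S" "s \<in> c"
      hence s: "s \<in> S" "refl_order s \<noteq> 2" "c = conj_class W s" using classes by blast+
      show "(\<Sum>i = 1..class_order sc c - 1. fscale (Poly_Mapping.lookup lam (c, i)) (basis_elem (s ^^ i))) \<in> ?B"
        unfolding gen[OF s] using s by blast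
    qed
    show "?B \<subseteq> ?A"
    proof clarify
      fix s assume s: "s \<in> S" "refl_order s \<noteq> 2"
      hence "conj_class W s \<in> C_plus sc W S \<and> s \<in> conj_class W s"
        using classes[of "conj_class W s" s] by simp
      thus "\<exists>c t. lie_generator lam s = (\<Sum>i = 1..class_order sc c - 1.
          fscale (Poly_Mapping.lookup lam (c, i)) (basis_elem (t ^^ i))) \<and> c \<in> C_plus sc W S \<and> t \<in> c"
        by (intro exI[of _ "conj_class W s"] exI[of _ s] conjI gen[OF s refl, symmetric]) auto
    qed
  qed
  moreover have "lie_generator lam ` S
      = lie_generator lam ` {s \<in> S. refl_order s = 2} \<union> lie_generator lam ` {s \<in> S. refl_order s \<noteq> 2}"
    by blast
  ultimately show ?thesis unfolding hecke_lie_param_def by (simp only:)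
qed

lemma lie_generator_conj:
  assumes w: "w \<in> W" and s: "s \<in> S"
  shows "conj_by w (lie_generator lam s) = lie_generator lam (w \<circ> s \<circ> invf w)"
  by (simp only: lie_generator_def cyclic_element_def conj_by_sum conj_by_linear conj_by_basis_elem
      refl_order_conj[OF w S_in_W[OF s]] conj_pow[OF w] coeffs_def conj_class_conj[OF w])

lemma lie_generator_in: "s \<in> S \<Longrightarrow> lie_generator lam s \<in> group_algebra W"
  unfolding lie_generator_def cyclic_element_def
  by (rule free.subspace_sum[OF subspace_group_algebra], rule free.subspace_scale[OF subspace_group_algebra],
      rule basis_elem_in, rule pow_in_W, rule S_in_W)

lemma lie_subalgebra_param: "lie_subalgebra (hecke_lie_param sc W S lam) (group_algebra W)"
  unfolding hecke_lie_param_eq using lie_generator_in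
  by (intro lie_subalgebra_lie_generated lie_subalgebra_group_algebra) auto

lemma conj_stable_param:
  "w \<in> W \<Longrightarrow> x \<in> hecke_lie_param sc W S lam \<Longrightarrow> conj_by w x \<in> hecke_lie_param sc W S lam"
  unfolding hecke_lie_param_eq using lie_generator_in
  by (intro conj_stable_lie_generated) (auto simp: lie_generator_conj conj_in_S)

lemma lie_subalgebra_hecke: "lie_subalgebra (hecke_lie sc W) (group_algebra W)"
  unfolding hecke_lie_def
  by (intro lie_subalgebra_lie_generated lie_subalgebra_group_algebra) (auto intro: basis_elem_in R_in_W)

lemma R_conj:
  assumes "r \<in> R" "w \<in> W" shows "w \<circ> r \<circ> invf w \<in> R"
proof -
  obtain s i where s: "s \<in> S" "i \<in> {1..refl_order s - 1}" "r = s ^^ i"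
    using assms(1) unfolding reflections_eq_powers by blast
  have "w \<circ> r \<circ> invf w = (w \<circ> s \<circ> invf w) ^^ i" by (simp only: s(3) conj_pow[OF assms(2)])
  moreover have "i \<in> {1..refl_order (w \<circ> s \<circ> invf w) - 1}"
    using s by (simp only: refl_order_conj[OF assms(2) S_in_W])
  ultimately show ?thesis unfolding reflections_eq_powers using conj_in_S[OF s(1) assms(2)] by blast
qed

lemma conj_stable_hecke: "w \<in> W \<Longrightarrow> x \<in> hecke_lie sc W \<Longrightarrow> conj_by w x \<in> hecke_lie sc W"
  unfolding hecke_lie_def
  by (intro conj_stable_lie_generated) (auto simp: conj_by_basis_elem R_conj intro: basis_elem_in R_in_W)

lemma R_inverse:
  assumes "r \<in> R" shows "invf r \<in> R"
proof -
  have "invf r \<noteq> id" using R_not_id[OF assms] inv_comp[OF R_in_W[OF assms]] by auto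
  thus ?thesis using pow_in_R[OF assms] invf_eq_pow[OF R_in_W[OF assms]] by simp
qed

lemma commutes_with_group_if_commutes_with_S:
  assumes "\<And>s. s \<in> S \<Longrightarrow> lie_bracket x (basis_elem s) = 0"
  shows "commutes_with_group x"
  unfolding commutes_with_group_def
proof
  fix w assume "w \<in> W"
  thus "lie_bracket x (basis_elem w) = 0"
  proof (induction w rule: generated_induct)
    case id
    show ?case unfolding lie_bracket_def gmult_id_left gmult_id_right by (rule diff_self)
  next
    case (comp u w)
    thus ?case by (simp only: basis_elem_comp lie_bracket_leibniz) simp
  qed (rule assms)
qed

end

context complex_reflection_group
begin

definition generic :: "(('v, 'k::field_char_0) parameter) \<Rightarrow> bool" where
  "generic lam \<longleftrightarrow> (\<forall>s\<in>S. generic_coefficients (refl_order s) (coeffs lam s))"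

definition class_sum :: "(('v, 'k::field) parameter) \<Rightarrow> ('v \<Rightarrow> 'v) set \<Rightarrow> (('v, 'k) group_ring)" where
  "class_sum lam c = (\<Sum>s\<in>c. lie_generator lam s)"

lemma generic_power_operator:
  fixes lam :: "('v, 'k::field_char_0) parameter"
  assumes "generic lam" "s \<in> S"
  obtains n r where "r 0 = 0"
    "\<And>y. gmult (lie_bracket (basis_elem (s ^^ i)) y) (basis_elem (s ^^ l))
        = (\<Sum>m\<le>n. fscale (r m) ((lie_bracket (lie_generator lam s) ^^ m) y))"
proof -
  have e: "refl_order s > 0" "s ^^ refl_order s = id"
    using refl_order_pos pow_refl_order S_in_W[OF assms(2)] by blast+
  have coeffs: "generic_coefficients (refl_order s) (coeffs lam s)" using assms by (simp add: generic_def)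
  obtain n r where r: "r 0 = 0"
    "\<And>y. gmult (lie_bracket (basis_elem (s ^^ i)) y) (basis_elem (s ^^ l))
        = (\<Sum>m\<le>n. fscale (r m) ((lie_bracket (cyclic_element (refl_order s) (coeffs lam s) s) ^^ m) y))"
    by (rule power_operator_is_polynomial_in_adjoint[OF e coeffs, where i = i and l = l]) (rule that)
  show ?thesis by (rule that[of r n, OF r(1)]) (simp only: r(2) lie_generator_def)
qed

text \<open>A polynomial without constant term in \<open>ad x\<^sub>s\<close> kills whatever \<open>ad x\<^sub>s\<close> kills.\<close>

lemma commutes_with_group_if_commutes_with_generators:
  fixes lam :: "('v, 'k::field_char_0) parameter"
  assumes gen: "generic lam" and comm: "\<And>s. s \<in> S \<Longrightarrow> lie_bracket (lie_generator lam s) y = 0"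
  shows "commutes_with_group y"
proof (rule commutes_with_group_if_commutes_with_S)
  fix s assume s: "s \<in> S"
  obtain n r where r: "r 0 = 0" "\<And>y. gmult (lie_bracket (basis_elem (s ^^ 1)) y) (basis_elem (s ^^ 0))
        = (\<Sum>m\<le>n. fscale (r m) ((lie_bracket (lie_generator lam s) ^^ m) y))"
    by (rule generic_power_operator[OF gen s, where i = 1 and l = 0]) (rule that)
  have zero: "(lie_bracket (lie_generator lam s) ^^ Suc m) y = 0" for m
    by (induction m) (simp_all add: comm[OF s])
  have "gmult (lie_bracket (basis_elem (s ^^ 1)) y) (basis_elem (s ^^ 0)) = 0"
    unfolding r(2)
  proof (rule sum.neutral, rule ballI)
    fix m
    show "fscale (r m) ((lie_bracket (lie_generator lam s) ^^ m) y) = 0"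
      using r(1) zero by (cases m) (simp, simp only: free.scale_zero_right)
  qed
  hence "lie_bracket (basis_elem s) y = 0"
    unfolding funpow.simps gmult_id_right One_nat_def comp_id .
  thus "lie_bracket y (basis_elem s) = 0" by (simp add: lie_bracket_minus_swap[of y])
qed

context
  fixes lam :: "('v, 'k::field_char_0) parameter"
  assumes gen: "generic lam"
begin

abbreviation "L \<equiv> hecke_lie_param sc W S lam"
abbreviation "D \<equiv> lie_derived (hecke_lie_param sc W S lam)"
abbreviation H :: "(('v, 'k) group_ring) set" where "H \<equiv> hecke_lie sc W"

lemma L_subset: "L \<subseteq> group_algebra W" and subspace_L: "free.subspace L"
  and L_bracket: "x \<in> L \<Longrightarrow> y \<in> L \<Longrightarrow> lie_bracket x y \<in> L"
  using lie_subalgebra_param[of lam] by (auto simp: lie_subalgebra_def)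

lemma H_subset: "H \<subseteq> group_algebra W" and subspace_H: "free.subspace H"
  and H_bracket: "x \<in> H \<Longrightarrow> y \<in> H \<Longrightarrow> lie_bracket x y \<in> H"
  using lie_subalgebra_hecke by (auto simp: lie_subalgebra_def)

lemma generator_in_L: "s \<in> S \<Longrightarrow> lie_generator lam s \<in> L"
  unfolding hecke_lie_param_eq by (rule subsetD[OF lie_generated_superset imageI])

lemma R_in_H: "r \<in> R \<Longrightarrow> basis_elem r \<in> H"
  unfolding hecke_lie_def by (rule subsetD[OF lie_generated_superset imageI])

lemma D_subset_L: "D \<subseteq> L"
  by (rule lie_derived_subset[OF subspace_L L_bracket])

text \<open>Each positive power of \<open>ad x\<^sub>s\<close> maps \<open>L\<close> into \<open>D\<close>.\<close>

lemma power_operator_in_D: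
  assumes s: "s \<in> S" and y: "y \<in> L"
  shows "gmult (lie_bracket (basis_elem (s ^^ i)) y) (basis_elem (s ^^ l)) \<in> D"
proof -
  obtain n r where r: "r 0 = 0" "\<And>y. gmult (lie_bracket (basis_elem (s ^^ i)) y) (basis_elem (s ^^ l))
        = (\<Sum>m\<le>n. fscale (r m) ((lie_bracket (lie_generator lam s) ^^ m) y))"
    by (rule generic_power_operator[OF gen s, where i = i and l = l]) (rule that)
  have pow_L: "(lie_bracket (lie_generator lam s) ^^ m) y \<in> L" for m
    by (induction m) (use y L_bracket[OF generator_in_L[OF s]] in auto)
  have "fscale (r m) ((lie_bracket (lie_generator lam s) ^^ m) y) \<in> D" for m
  proof (cases m)
    case 0
    thus ?thesis using r(1) free.subspace_0[OF subspace_lie_derived] by simp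
  next
    case (Suc m')
    have "(lie_bracket (lie_generator lam s) ^^ m) y \<in> D"
      unfolding Suc funpow.simps comp_apply by (rule lie_bracket_in_derived[OF generator_in_L[OF s] pow_L])
    thus ?thesis by (rule free.subspace_scale[OF subspace_lie_derived])
  qed
  thus ?thesis unfolding r(2) by (intro free.subspace_sum subspace_lie_derived)
qed

text \<open>The elements of the group algebra that map \<open>L\<close> into \<open>D\<close> form a Lie algebra, and it contains the
  reflections because they are the powers of the elements of \<open>S\<close>.\<close>

lemma H_bracket_L: 
  assumes "x \<in> H" "y \<in> L" shows "lie_bracket x y \<in> D"
proof -
  have "lie_subalgebra {x \<in> group_algebra W. \<forall>y\<in>L. lie_bracket x y \<in> D} (group_algebra W)"
    by (rule lie_subalgebra_transporter[OF lie_subalgebra_group_algebra subspace_lie_derived D_subset_L])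
  moreover have "basis_elem ` R \<subseteq> {x \<in> group_algebra W. \<forall>y\<in>L. lie_bracket x y \<in> D}"
  proof clarify
    fix r assume r: "r \<in> R"
    then obtain s i where s: "s \<in> S" "r = s ^^ i" unfolding reflections_eq_powers by blast
    have "lie_bracket (basis_elem r) y \<in> D" if "y \<in> L" for y
      using power_operator_in_D[OF s(1) that, of i 0] unfolding funpow.simps(1) gmult_id_right s(2) .
    thus "basis_elem r \<in> group_algebra W \<and> (\<forall>y\<in>L. lie_bracket (basis_elem r) y \<in> D)"
      using basis_elem_in[OF R_in_W[OF r]] by blast
  qed
  ultimately have "H \<subseteq> {x \<in> group_algebra W. \<forall>y\<in>L. lie_bracket x y \<in> D}"
    unfolding hecke_lie_def by (rule lie_generated_minimal)
  thus ?thesis using assms by blast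
qed

lemma L_subset_H: "L \<subseteq> H"
  unfolding hecke_lie_param_eq
proof (rule lie_generated_minimal[OF lie_subalgebra_hecke], clarify)
  fix s assume s: "s \<in> S"
  have "basis_elem (s ^^ i) \<in> H" if "i \<in> {1..refl_order s - 1}" for i
    using that s by (intro R_in_H) (auto simp: reflections_eq_powers)
  thus "lie_generator lam s \<in> H"
    unfolding lie_generator_def cyclic_element_def
    by (intro free.subspace_sum[OF subspace_H] free.subspace_scale[OF subspace_H])
qed

text \<open>For a generator \<open>s\<close> of \<open>W\<close> the difference is \<open>[s, y] s\<^sup>-\<^sup>1\<close>.\<close>

lemma conj_congruent:
  assumes w: "w \<in> W" and y: "y \<in> L" shows "conj_by w y - y \<in> D"
  using w y
proof (induction w arbitrary: y rule: generated_induct)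
  case (id y)
  show ?case by (simp add: free.subspace_0[OF subspace_lie_derived] del: id_apply)
next
  case (generator s y)
  have sW: "s \<in> W" by (rule S_in_W[OF generator(1)])
  have "conj_by s y - y = gmult (lie_bracket (basis_elem s) y) (basis_elem (invf s))"
    by (simp only: lie_bracket_def conj_by_def gmult_diff_left gmult_assoc basis_elem_inverse_mult[OF sW] gmult_id_right)
  thus ?case using power_operator_in_D[OF generator, of 1 "refl_order s - 1"]
    unfolding invf_eq_pow[OF sW] by simp
next
  case (comp u w y)
  have wy: "conj_by w y \<in> L" by (rule conj_stable_param[OF comp(2) comp(5)])
  have eq: "conj_by (u \<circ> w) y - y = (conj_by u (conj_by w y) - conj_by w y) + (conj_by w y - y)"
    by (simp only: conj_by_conj_by[OF comp(1,2)]) simp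
  show ?case unfolding eq by (rule free.subspace_add[OF subspace_lie_derived comp(3)[OF wy] comp(4)[OF comp(5)]])
qed

lemma finite_conj_class: "finite (conj_class W s)"
  using finite_W by (simp add: conj_class_def)

lemma class_sum_central:
  assumes s: "s \<in> S" shows "commutes_with_group (class_sum lam (conj_class W s))"
proof (rule commutes_with_group_if_conj_invariant)
  fix w assume w: "w \<in> W"
  let ?f = "\<lambda>t. w \<circ> t \<circ> invf w"
  have "inj_on ?f (conj_class W s)"
  proof (rule inj_onI)
    fix t u assume "?f t = ?f u"
    hence "invf w \<circ> ?f t \<circ> w = invf w \<circ> ?f u \<circ> w" by simp
    moreover have "invf w \<circ> ?f t \<circ> w = (invf w \<circ> w) \<circ> t \<circ> (invf w \<circ> w)" for t by (simp only: comp_assoc)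
    ultimately show "t = u" by (simp add: inv_comp[OF w])
  qed
  moreover have "?f ` conj_class W s \<subseteq> conj_class W s"
    using conj_class_conj[OF w] conj_class_eq conj_class_self by blast
  ultimately have bij: "bij_betw ?f (conj_class W s) (conj_class W s)"
    using endo_inj_surj[OF finite_conj_class] by (auto simp: bij_betw_def)
  have "conj_by w (class_sum lam (conj_class W s)) = (\<Sum>t\<in>conj_class W s. lie_generator lam (?f t))"
    unfolding class_sum_def conj_by_sum using conj_class_subset[OF s]
    by (intro sum.cong refl lie_generator_conj[OF w]) blast
  also have "\<dots> = class_sum lam (conj_class W s)"
    unfolding class_sum_def by (rule sum.reindex_bij_betw[OF bij])
  finally show "conj_by w (class_sum lam (conj_class W s)) = class_sum lam (conj_class W s)" .
qed

abbreviation "Z \<equiv> free.span (class_sum lam ` conj_classes W S)"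

lemma class_sum_in_L: "s \<in> S \<Longrightarrow> class_sum lam (conj_class W s) \<in> L"
  unfolding class_sum_def using conj_class_subset generator_in_L
  by (intro free.subspace_sum[OF subspace_L]) blast

lemma Z_subset_L: "Z \<subseteq> L"
  using class_sum_in_L by (intro free.span_minimal subspace_L) (auto simp: conj_classes_def)

lemma Z_central: "z \<in> Z \<Longrightarrow> commutes_with_group z"
  using class_sum_central
  by (intro subsetD[OF free.span_minimal[OF _ subspace_commutes_with_group], simplified])
    (auto simp: conj_classes_def)

text \<open>Modulo \<open>D\<close> all generators in one conjugacy class coincide, so each of them is congruent to the
  class sum divided by the size of the class.\<close>

lemma L_decomposition:
  assumes "y \<in> L" obtains d z where "d \<in> D" "z \<in> Z" "y = d + z"
proof -
  let ?M = "free.span (D \<union> Z)"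
  have M_L: "?M \<subseteq> L" using D_subset_L Z_subset_L by (intro free.span_minimal subspace_L) blast
  have D_M: "D \<subseteq> ?M" and Z_M: "Z \<subseteq> ?M" using free.span_superset[of "D \<union> Z"] by blast+
  have "lie_subalgebra ?M (group_algebra W)"
    unfolding lie_subalgebra_def
  proof (intro conjI ballI)
    show "?M \<subseteq> group_algebra W" using M_L L_subset by blast
    show "lie_bracket x y \<in> ?M" if "x \<in> ?M" "y \<in> ?M" for x y
      using that M_L D_M lie_bracket_in_derived[of x L y] by blast
  qed simp
  moreover have "lie_generator lam ` S \<subseteq> ?M"
  proof clarify
    fix s assume s: "s \<in> S"
    let ?c = "conj_class W s"
    have "lie_generator lam s - lie_generator lam t \<in> D" if t: "t \<in> ?c" for t
    proof -
      obtain w where w: "w \<in> W" "t = w \<circ> s \<circ> invf w" using t by (auto simp: conj_class_def)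
      have "- (conj_by w (lie_generator lam s) - lie_generator lam s) \<in> D"
        by (rule free.subspace_neg[OF subspace_lie_derived conj_congruent[OF w(1) generator_in_L[OF s]]])
      thus ?thesis by (simp add: lie_generator_conj[OF w(1) s] w(2))
    qed
    hence "(\<Sum>t\<in>?c. lie_generator lam s - lie_generator lam t) \<in> D"
      by (rule free.subspace_sum[OF subspace_lie_derived])
    moreover have "(\<Sum>t\<in>?c. lie_generator lam s - lie_generator lam t)
        = fscale (of_nat (card ?c)) (lie_generator lam s) - class_sum lam ?c"
      by (simp add: sum_subtractf class_sum_def free.sum_constant_scale)
    ultimately have "fscale (of_nat (card ?c)) (lie_generator lam s) - class_sum lam ?c \<in> ?M"
      using D_M by auto
    moreover have "class_sum lam ?c \<in> Z"
      using s by (intro free.span_base imageI) (simp add: conj_classes_def)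
    hence "class_sum lam ?c \<in> ?M" using Z_M by blast
    ultimately have "(fscale (of_nat (card ?c)) (lie_generator lam s) - class_sum lam ?c) + class_sum lam ?c \<in> ?M"
      by (rule free.span_add)
    hence "fscale (of_nat (card ?c)) (lie_generator lam s) \<in> ?M" by simp
    hence "fscale (inverse (of_nat (card ?c))) (fscale (of_nat (card ?c)) (lie_generator lam s)) \<in> ?M"
      by (rule free.span_scale)
    moreover have "card ?c \<noteq> 0" using finite_conj_class[of s] conj_class_self[of s] by (auto simp: card_eq_0_iff)
    ultimately show "lie_generator lam s \<in> ?M" by simp
  qed
  ultimately have "lie_generated (group_algebra W) (lie_generator lam ` S) \<subseteq> ?M"
    by (rule lie_generated_minimal)
  from subsetD[OF this[folded hecke_lie_param_eq] assms]
  have "y \<in> {x + y | x y. x \<in> free.span D \<and> y \<in> free.span Z}" unfolding free.span_Un .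
  moreover have "free.span D = D" "free.span Z = Z" by (simp_all only: free.span_eq_iff subspace_lie_derived free.subspace_span)
  ultimately have "y \<in> {x + y | x y. x \<in> D \<and> y \<in> Z}" by (simp only:)
  then obtain d z where "d \<in> D" "z \<in> Z" "y = d + z" by blast
  thus ?thesis by (rule that)
qed

lemma D_subset_derived: "D \<subseteq> lie_derived (group_algebra W)"
  by (rule lie_derived_mono[OF L_subset])

lemma D_subset_G: "D \<subseteq> group_algebra W"
  using D_subset_L L_subset by blast

text \<open>The radical \<open>N\<close> of the form on \<open>D\<close> is an ideal of \<open>H\<close>.  It is abelian: \<open>[N, N]\<close> is orthogonal to
  \<open>H\<close> because \<open>([m, n], h) = (m, [n, h])\<close> with \<open>[n, h] \<in> D\<close>, and the form is nondegenerate on \<open>H\<close>.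
  An abelian ideal is central, and a central element of \<open>D\<close> vanishes.\<close>

lemma trace_form_nondegenerate_on_D:
  assumes d: "d \<in> D" and orth: "\<And>d'. d' \<in> D \<Longrightarrow> trace_form d d' = 0"
  shows "d = 0"
proof -
  define N where "N = {d \<in> D. \<forall>d'\<in>D. trace_form d d' = 0}"
  have ND: "N \<subseteq> D" by (auto simp: N_def)
  have subN: "free.subspace N"
    using subspace_lie_derived[of L] by (auto simp: N_def free.subspace_def)
  have ideal: "lie_bracket h n \<in> N" if h: "h \<in> H" and n: "n \<in> N" for h n
  proof -
    have nG: "n \<in> group_algebra W" and hG: "h \<in> group_algebra W"
      using n ND D_subset_G h H_subset by blast+
    have "lie_bracket h n \<in> D" using H_bracket_L h n ND D_subset_L by blast
    moreover have "trace_form (lie_bracket h n) d' = 0" if "d' \<in> D" for d'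
    proof -
      have "trace_form (lie_bracket n h) d' = trace_form n (lie_bracket h d')"
        using that D_subset_G by (intro trace_form_invariant nG hG) blast
      also have "\<dots> = 0" using n H_bracket_L[OF h] that D_subset_L by (auto simp: N_def)
      finally show ?thesis
        by (simp add: lie_bracket_minus_swap[of n h] trace_form_def lie_bracket_def gmult_distrib lookup_minus)
    qed
    ultimately show ?thesis by (auto simp: N_def)
  qed
  have NH: "N \<subseteq> H" using ND D_subset_L L_subset_H by blast
  have abelian: "lie_bracket m n = 0" if m: "m \<in> N" and n: "n \<in> N" for m n
  proof (rule trace_form_nondegenerate[of R])
    show "R \<subseteq> W" using R_in_W by blast
    show "invf r \<in> R" if "r \<in> R" for r by (rule R_inverse[OF that])
    show "lie_bracket m n \<in> lie_generated (group_algebra W) (basis_elem ` R)"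
      unfolding hecke_lie_def[symmetric] using H_bracket NH m n by blast
    show "trace_form (lie_bracket m n) y = 0" if "y \<in> lie_generated (group_algebra W) (basis_elem ` R)" for y
    proof -
      have y: "y \<in> H" using that unfolding hecke_lie_def .
      have "lie_bracket y n \<in> D" using ideal[OF y n] ND by blast
      hence "lie_bracket n y \<in> D"
        using free.subspace_neg[OF subspace_lie_derived] lie_bracket_minus_swap[of n y] by metis
      moreover have "trace_form (lie_bracket m n) y = trace_form m (lie_bracket n y)"
        using m n y NH H_subset by (intro trace_form_invariant) blast+
      ultimately show ?thesis using m by (simp add: N_def)
    qed
  qed
  have "N \<subseteq> lie_center H"
  proof (rule abelian_ideal_central[OF H_subset conj_stable_hecke])
    show "lie_ideal N H" using NH subN ideal by (simp add: lie_ideal_def)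
  qed (use abelian in auto)
  moreover have "d \<in> N" using d orth by (auto simp: N_def)
  ultimately have "lie_bracket d (basis_elem s) = 0" if "s \<in> S" for s
    using R_in_H[OF S_in_R[OF that]] by (auto simp: lie_center_def)
  hence "commutes_with_group d" by (rule commutes_with_group_if_commutes_with_S)
  thus ?thesis using central_commutator_eq_zero d D_subset_derived by blast
qed

text \<open>The component \<open>b\<close> of \<open>r\<close> orthogonal to \<open>D\<close> commutes with \<open>D\<close>, since \<open>[b, D]\<close> lies in \<open>D\<close> and is
  orthogonal to \<open>D\<close>.  It also commutes with the central elements of \<open>Z\<close>, hence with all generators.\<close>

lemma reflection_decomposition:
  assumes r: "r \<in> R" obtains d where "d \<in> D" "commutes_with_group (basis_elem r - d)"
proof -
  obtain d where d: "d \<in> D" "\<And>d'. d' \<in> D \<Longrightarrow> trace_form (basis_elem r - d) d' = 0"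
    using orthogonal_projection[OF subspace_lie_derived D_subset_G trace_form_nondegenerate_on_D] by metis
  define b where "b = basis_elem r - d"
  have bH: "b \<in> H" unfolding b_def
    using R_in_H[OF r] d(1) D_subset_L L_subset_H by (intro free.subspace_diff[OF subspace_H]) auto
  have bD: "lie_bracket b d' = 0" if d': "d' \<in> D" for d'
  proof (rule trace_form_nondegenerate_on_D)
    show "lie_bracket b d' \<in> D" using H_bracket_L[OF bH] d' D_subset_L by blast
    show "trace_form (lie_bracket b d') d'' = 0" if "d'' \<in> D" for d''
    proof -
      have "trace_form (lie_bracket b d') d'' = trace_form b (lie_bracket d' d'')"
        using bH H_subset d' that D_subset_G by (intro trace_form_invariant) blast+
      thus ?thesis using d(2)[OF lie_bracket_in_derived[of d' L d'']] d' that D_subset_L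
        unfolding b_def by auto
    qed
  qed
  have "lie_bracket (lie_generator lam s) b = 0" if s: "s \<in> S" for s
  proof -
    obtain d' z where dz: "d' \<in> D" "z \<in> Z" "lie_generator lam s = d' + z"
      using L_decomposition[OF generator_in_L[OF s]] by blast
    have "lie_bracket z b = 0"
      using commutes_with_group_bracket(1)[OF Z_central[OF dz(2)]] bH H_subset by blast
    thus ?thesis using bD[OF dz(1)] lie_bracket_minus_swap[of d' b] by (simp add: dz(3) lie_bracket_add_left)
  qed
  hence "commutes_with_group b" by (rule commutes_with_group_if_commutes_with_generators[OF gen])
  thus ?thesis using that d(1) by (simp add: b_def)
qed

text \<open>The sum of \<open>D\<close> and the centre of the group algebra is a Lie algebra that contains all reflections,
  hence contains \<open>H\<close>, and its brackets lie in \<open>D\<close>.\<close>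

theorem derived_eq: "D = lie_derived H"
proof
  show "D \<subseteq> lie_derived H" by (rule lie_derived_mono[OF L_subset_H])
  define M where "M = {x \<in> group_algebra W. \<exists>d\<in>D. commutes_with_group (x - d)}"
  have bracket: "lie_bracket x y \<in> D" if x: "x \<in> M" and y: "y \<in> M" for x y
  proof -
    obtain d where d: "d \<in> D" "commutes_with_group (x - d)" using x by (auto simp: M_def)
    obtain d' where d': "d' \<in> D" "commutes_with_group (y - d')" using y by (auto simp: M_def)
    have "lie_bracket (x - d) y = 0" using commutes_with_group_bracket(1)[OF d(2)] y by (simp add: M_def)
    hence "lie_bracket x y = lie_bracket d y" by (simp add: lie_bracket_diff_left)
    moreover have "lie_bracket d (y - d') = 0"
      using commutes_with_group_bracket(2)[OF d'(2)] d(1) D_subset_G by blast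
    hence "lie_bracket d y = lie_bracket d d'" by (simp add: lie_bracket_diff_right)
    moreover have "lie_bracket d d' \<in> D"
      using lie_bracket_in_derived[of d L d'] d(1) d'(1) D_subset_L by blast
    ultimately show ?thesis by simp
  qed
  have "lie_subalgebra M (group_algebra W)"
    unfolding lie_subalgebra_def
  proof (intro conjI ballI)
    show "M \<subseteq> group_algebra W" by (auto simp: M_def)
    show "free.subspace M"
    proof (rule free.subspaceI)
      have zero: "commutes_with_group 0" by (simp add: commutes_with_group_def)
      show "0 \<in> M" using free.subspace_0[OF subspace_lie_derived] free.subspace_0[OF subspace_group_algebra] zero
        by (auto simp: M_def intro!: bexI[of _ 0])
      show "x + y \<in> M" if "x \<in> M" "y \<in> M" for x y
      proof -
        obtain d d' where d: "d \<in> D" "commutes_with_group (x - d)" "d' \<in> D" "commutes_with_group (y - d')"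
          using \<open>x \<in> M\<close> \<open>y \<in> M\<close> by (auto simp: M_def)
        have eq: "x + y - (d + d') = (x - d) + (y - d')" by simp
        have "commutes_with_group (x + y - (d + d'))"
          unfolding eq
          using free.subspace_add[OF subspace_commutes_with_group CollectI[where P = commutes_with_group, OF d(2)]
            CollectI[where P = commutes_with_group, OF d(4)]] by (rule CollectD)
        moreover have "x + y \<in> group_algebra W"
          using that by (auto simp: M_def intro: free.subspace_add)
        ultimately show ?thesis unfolding M_def
          using free.subspace_add[OF subspace_lie_derived d(1,3)] by blast
      qed
      show "fscale a x \<in> M" if "x \<in> M" for a x
      proof -
        obtain d where d: "d \<in> D" "commutes_with_group (x - d)" using \<open>x \<in> M\<close> by (auto simp: M_def)
        have "commutes_with_group (fscale a x - fscale a d)"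
          using free.subspace_scale[OF subspace_commutes_with_group, of "x - d" a] d
          by (simp add: free.scale_right_diff_distrib)
        moreover have "fscale a x \<in> group_algebra W"
          using that by (auto simp: M_def intro: free.subspace_scale)
        ultimately show ?thesis unfolding M_def
          using free.subspace_scale[OF subspace_lie_derived d(1)] by blast
      qed
    qed
    show "lie_bracket x y \<in> M" if "x \<in> M" "y \<in> M" for x y
    proof -
      have "commutes_with_group (lie_bracket x y - lie_bracket x y)" by (simp add: commutes_with_group_def)
      thus ?thesis using bracket[OF that] D_subset_G unfolding M_def by blast
    qed
  qed
  moreover have "basis_elem ` R \<subseteq> M"
  proof clarify
    fix r assume r: "r \<in> R"
    obtain d where "d \<in> D" "commutes_with_group (basis_elem r - d)" using reflection_decomposition[OF r] .
    thus "basis_elem r \<in> M" using basis_elem_in[OF R_in_W[OF r]] by (auto simp: M_def)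
  qed
  ultimately have "H \<subseteq> M" unfolding hecke_lie_def by (rule lie_generated_minimal)
  thus "lie_derived H \<subseteq> D"
    using bracket by (intro lie_derived_subset[OF subspace_lie_derived]) blast
qed

text \<open>A central element of \<open>L\<close> is central in the group algebra, and so is its component in \<open>D\<close>, which
  is therefore zero.\<close>

lemma center_eq: "lie_center L = Z"
proof
  show "Z \<subseteq> lie_center L"
    using Z_subset_L commutes_with_group_bracket(1)[OF Z_central] L_subset
    unfolding lie_center_def by blast
  show "lie_center L \<subseteq> Z"
  proof
    fix x assume x: "x \<in> lie_center L"
    hence xL: "x \<in> L" by (simp add: lie_center_def)
    have "lie_bracket (lie_generator lam s) x = 0" if "s \<in> S" for s
      using x generator_in_L[OF that] lie_bracket_minus_swap[of "lie_generator lam s" x]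
      by (simp add: lie_center_def)
    hence xc: "commutes_with_group x" by (rule commutes_with_group_if_commutes_with_generators[OF gen])
    obtain d z where dz: "d \<in> D" "z \<in> Z" "x = d + z" using L_decomposition[OF xL] .
    have "commutes_with_group (x - z)" by (rule commutes_with_group_diff[OF xc Z_central[OF dz(2)]])
    hence "commutes_with_group d" by (simp add: dz(3))
    hence "d = 0" using central_commutator_eq_zero dz(1) D_subset_derived by blast
    thus "x \<in> Z" using dz by simp
  qed
qed

text \<open>If all coefficients vanished, so would all differences of eigenvalues, although there are at least
  two roots of unity of exponent \<open>e \<ge> 2\<close>.\<close>

lemma exists_nonzero_coefficient:
  assumes s: "s \<in> S" shows "\<exists>i\<in>{1..refl_order s - 1}. coeffs lam s i \<noteq> 0"
proof (rule ccontr)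
  assume "\<not> ?thesis"
  hence zero: "cyclic_eigenvalue (refl_order s) (coeffs lam s) \<alpha> = 0" for \<alpha>
    by (simp add: cyclic_eigenvalue_def)
  have e: "refl_order s \<ge> 2" by (rule refl_order_ge_2[OF S_in_R[OF s]])
  let ?Z = "{z :: 'k alg_closure. z ^ refl_order s = 1}"
  have "\<not> ?Z \<subseteq> {1}"
  proof
    assume "?Z \<subseteq> {1}"
    hence "card ?Z \<le> 1" using card_mono[of "{1}" ?Z] by simp
    thus False using card_roots_of_unity(2)[where 'a = "'k alg_closure", of "refl_order s"] e by simp
  qed
  then obtain \<beta> :: "'k alg_closure" where \<beta>: "\<beta> ^ refl_order s = 1" "\<beta> \<noteq> 1" by blast
  have "generic_coefficients (refl_order s) (coeffs lam s)" using gen s by (simp add: generic_def)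
  from this[unfolded generic_coefficients_def, rule_format, of 1 \<beta> \<beta> 1] \<beta> show False
    by (simp add: zero)
qed

lemma lookup_lie_generator:
  assumes "s \<in> S" "t \<in> S" "i \<in> {1..refl_order s - 1}"
  shows "Poly_Mapping.lookup (lie_generator lam t) (s ^^ i) = (if t = s then coeffs lam s i else 0)"
proof -
  have "Poly_Mapping.lookup (lie_generator lam t) (s ^^ i)
      = (\<Sum>j = 1..refl_order t - 1. if t = s \<and> j = i then coeffs lam s i else 0)"
    unfolding lie_generator_def cyclic_element_def lookup_sum
  proof (rule sum.cong)
    fix j assume j: "j \<in> {1..refl_order t - 1}"
    have "t ^^ j = s ^^ i \<longleftrightarrow> t = s \<and> j = i"
      using pow_injective[OF assms(2,1), of j i] assms(3) j by auto
    thus "Poly_Mapping.lookup (fscale (coeffs lam t j) (basis_elem (t ^^ j))) (s ^^ i)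
        = (if t = s \<and> j = i then coeffs lam s i else 0)"
      by (auto simp: lookup_single when_def)
  qed simp
  also have "\<dots> = (if t = s then coeffs lam s i else 0)" using assms(3) by (cases "t = s") simp_all
  finally show ?thesis .
qed

lemma lookup_class_sum:
  assumes "s \<in> S" "c \<in> conj_classes W S" "i \<in> {1..refl_order s - 1}"
  shows "Poly_Mapping.lookup (class_sum lam c) (s ^^ i) = (if s \<in> c then coeffs lam s i else 0)"
proof -
  obtain t where t: "t \<in> S" "c = conj_class W t" using assms(2) by (auto simp: conj_classes_def)
  have fin: "finite c" using finite_conj_class t by simp
  have "Poly_Mapping.lookup (class_sum lam c) (s ^^ i) = (\<Sum>u\<in>c. if u = s then coeffs lam s i else 0)"
    unfolding class_sum_def lookup_sum using assms conj_class_subset[OF t(1)] t(2)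
    by (intro sum.cong refl lookup_lie_generator) auto
  thus ?thesis using fin by simp
qed

text \<open>The class sums have disjoint supports: \<open>s\<^sup>i = t\<^sup>j\<close> forces \<open>s = t\<close>, as both sides have the same
  hyperplane.\<close>

theorem dim_center: "free.dim (lie_center L) = card (conj_classes W S)"
proof -
  have "\<forall>c\<in>conj_classes W S. \<exists>s i. s \<in> S \<and> c = conj_class W s \<and> i \<in> {1..refl_order s - 1} \<and> coeffs lam s i \<noteq> 0"
    using exists_nonzero_coefficient by (force simp: conj_classes_def)
  then obtain s i where si: "\<And>c. c \<in> conj_classes W S \<Longrightarrow>
      s c \<in> S \<and> c = conj_class W (s c) \<and> i c \<in> {1..refl_order (s c) - 1} \<and> coeffs lam (s c) (i c) \<noteq> 0"
    by metis
  have fin: "finite (conj_classes W S)" using finite_S by (simp add: conj_classes_def)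
  have piv: "Poly_Mapping.lookup (class_sum lam c) (s d ^^ i d) = (if c = d then coeffs lam (s d) (i d) else 0)"
    if c: "c \<in> conj_classes W S" and d: "d \<in> conj_classes W S" for c d
  proof -
    have "s d \<in> c \<longleftrightarrow> c = d"
      using si[OF c] si[OF d] conj_class_eq[of "s d" "s c"] conj_class_self[of "s d"] by auto
    thus ?thesis using lookup_class_sum[of "s d" c "i d"] si[OF d] c by simp
  qed
  have inj: "inj_on (class_sum lam) (conj_classes W S)" and ind: "free.independent (class_sum lam ` conj_classes W S)"
    using independent_if_pivots[OF fin, of "class_sum lam" "\<lambda>c. s c ^^ i c"] piv si by auto
  thus ?thesis
    unfolding center_eq using free.dim_span_eq_card_independent[OF ind] card_image[OF inj] by simp
qed

end

text \<open>The conditions to be avoided are indexed by a class in \<open>S\<^sub>+\<close> together with a quadruple of roots of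
  unity.\<close>

theorem generic_outside_hyperplanes:
  obtains Hs :: "(('v, 'k::field_char_0) parameter) set set"
  where "finite Hs" "\<And>H. H \<in> Hs \<Longrightarrow> hyperplane_of fscale (param_space sc W S) H"
    "\<And>lam. lam \<in> param_space sc W S - \<Union>Hs \<Longrightarrow> generic lam"
proof -
  let ?P = "param_space sc W S :: (('v, 'k) parameter) set"
  define I where "I = (SIGMA c:C_plus sc W S. {1..class_order sc c - 1})"
  have finC: "finite (C_plus sc W S)"
    using finite_S by (auto simp: C_plus_def conj_classes_def S_plus_def)
  hence finI: "finite I" by (auto simp: I_def)
  define Z where "Z c = {z :: 'k alg_closure. z ^ class_order sc c = 1}" for c
  define \<gamma> where "\<gamma> = (\<lambda>(c :: ('v \<Rightarrow> 'v) set, \<alpha>, \<beta>, \<gamma>, \<delta>) (c', i :: nat). if c' = c then \<alpha> ^ i - \<beta> ^ i - \<gamma> ^ i + \<delta> ^ i else 0 :: 'k alg_closure)"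
  define T where "T = {x \<in> (SIGMA c:C_plus sc W S. Z c \<times> Z c \<times> Z c \<times> Z c). \<exists>p\<in>I. \<gamma> x p \<noteq> 0}"
  have order: "class_order sc c > 0" if "c \<in> C_plus sc W S" for c
    using that refl_order_pos[OF S_in_W] by (auto simp: C_plus_def conj_classes_def S_plus_def class_order_conj_class)
  have finZ: "finite (Z c)" if "c \<in> C_plus sc W S" for c
    unfolding Z_def by (rule card_roots_of_unity(1)[OF order[OF that]])
  have "finite (SIGMA c:C_plus sc W S. Z c \<times> Z c \<times> Z c \<times> Z c)"
    by (intro finite_SigmaI finC finite_cartesian_product finZ)
  hence finT: "finite T" unfolding T_def by (rule finite_subset[rotated]) blast
  have P: "?P = {lam. Poly_Mapping.keys lam \<subseteq> I}" by (simp add: param_space_def I_def)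
  have "\<forall>x\<in>T. \<exists>H. hyperplane_of fscale ?P H \<and>
      (\<forall>lam\<in>?P. (\<Sum>q\<in>I. to_ac (Poly_Mapping.lookup lam q) * \<gamma> x q) = 0 \<longrightarrow> lam \<in> H)"
  proof
    fix x assume "x \<in> T"
    then obtain p where p: "p \<in> I" "\<gamma> x p \<noteq> 0" by (auto simp: T_def)
    show "\<exists>H. hyperplane_of fscale ?P H \<and>
      (\<forall>lam\<in>?P. (\<Sum>q\<in>I. to_ac (Poly_Mapping.lookup lam q) * \<gamma> x q) = 0 \<longrightarrow> lam \<in> H)"
      unfolding P by (rule zero_set_in_hyperplane[where \<gamma> = "\<gamma> x" and p = p, OF finI p]) blast
  qed
  from bchoice[OF this] obtain h where hT: "\<forall>x\<in>T. hyperplane_of fscale ?P (h x) \<and>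
      (\<forall>lam\<in>?P. (\<Sum>q\<in>I. to_ac (Poly_Mapping.lookup lam q) * \<gamma> x q) = 0 \<longrightarrow> lam \<in> h x)" ..
  have h: "hyperplane_of fscale ?P (h x)"
      "lam \<in> ?P \<Longrightarrow> (\<Sum>q\<in>I. to_ac (Poly_Mapping.lookup lam q) * \<gamma> x q) = 0 \<Longrightarrow> lam \<in> h x"
    if "x \<in> T" for x lam
    using bspec[OF hT that] by simp_all
  have generic: "generic lam" if lam: "lam \<in> ?P - \<Union>(h ` T)" for lam
    unfolding generic_def
  proof (rule ballI, rule ccontr)
    fix s assume s: "s \<in> S" and not: "\<not> generic_coefficients (refl_order s) (coeffs lam s)"
    have ne: "refl_order s \<noteq> 2"
      using not generic_coefficients_order_two by (auto simp: coeffs_def)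
    define c where "c = conj_class W s"
    have c: "c \<in> C_plus sc W S" and ord: "class_order sc c = refl_order s"
      using s ne refl_order_ge_2[OF S_in_R[OF s]]
      by (auto simp: c_def C_plus_def conj_classes_def S_plus_def class_order_conj_class)
    obtain \<alpha> \<beta> \<gamma>' \<delta> where *: "\<alpha> ^ refl_order s = 1" "\<beta> ^ refl_order s = 1" "\<gamma>' ^ refl_order s = 1" "\<delta> ^ refl_order s = 1"
      "\<exists>i\<in>{1..refl_order s - 1}. \<alpha> ^ i - \<beta> ^ i - \<gamma>' ^ i + \<delta> ^ i \<noteq> 0"
      "(\<Sum>i = 1..refl_order s - 1. to_ac (coeffs lam s i) * (\<alpha> ^ i - \<beta> ^ i - \<gamma>' ^ i + \<delta> ^ i)) = 0"
      using not_generic_coefficients[OF refl_order_pos[OF S_in_W[OF s]] not] .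
    define x where "x = (c, \<alpha>, \<beta>, \<gamma>', \<delta>)"
    have \<gamma>x: "\<gamma> x (c', i) = (if c' = c then \<alpha> ^ i - \<beta> ^ i - \<gamma>' ^ i + \<delta> ^ i else 0)" for c' i
      by (simp add: \<gamma>_def x_def)
    obtain i where i: "i \<in> {1..refl_order s - 1}" "\<alpha> ^ i - \<beta> ^ i - \<gamma>' ^ i + \<delta> ^ i \<noteq> 0" using *(5) by blast
    have "(c, i) \<in> I" using c i(1) ord by (simp add: I_def)
    moreover have "\<gamma> x (c, i) \<noteq> 0" using i(2) by (simp add: \<gamma>x)
    ultimately have "x \<in> T" using *(1-4) c unfolding T_def by (auto simp: x_def Z_def ord)
    moreover have "(\<Sum>q\<in>I. to_ac (Poly_Mapping.lookup lam q) * \<gamma> x q) = 0"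
    proof -
      have "(\<Sum>q\<in>I. to_ac (Poly_Mapping.lookup lam q) * \<gamma> x q)
          = (\<Sum>q\<in>{c} \<times> {1..refl_order s - 1}. to_ac (Poly_Mapping.lookup lam q) * \<gamma> x q)"
      proof (rule sum.mono_neutral_right[OF finI])
        show "{c} \<times> {1..refl_order s - 1} \<subseteq> I" using c ord by (auto simp: I_def)
        show "\<forall>q\<in>I - {c} \<times> {1..refl_order s - 1}. to_ac (Poly_Mapping.lookup lam q) * \<gamma> x q = 0"
        proof
          fix q assume q: "q \<in> I - {c} \<times> {1..refl_order s - 1}"
          obtain c' i where ci: "q = (c', i)" by (cases q)
          have "c' \<noteq> c" using q ord unfolding ci I_def by auto
          thus "to_ac (Poly_Mapping.lookup lam q) * \<gamma> x q = 0" unfolding ci \<gamma>x by simp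
        qed
      qed
      also have "\<dots> = (\<Sum>i = 1..refl_order s - 1. to_ac (Poly_Mapping.lookup lam (c, i)) * (\<alpha> ^ i - \<beta> ^ i - \<gamma>' ^ i + \<delta> ^ i))"
      proof -
        have "{c} \<times> {1..refl_order s - 1} = Pair c ` {1..refl_order s - 1}" by auto
        moreover have "inj_on (Pair c) {1..refl_order s - 1}" by (simp add: inj_on_def)
        ultimately show ?thesis by (simp add: sum.reindex \<gamma>x)
      qed
      also have "\<dots> = 0" using *(6) ne by (simp add: coeffs_def c_def)
      finally show ?thesis .
    qed
    ultimately have "lam \<in> h x" using h(2)[of x lam] lam by blast
    thus False using lam \<open>x \<in> T\<close> by blast
  qed
  show ?thesis
  proof (rule that[of "h ` T"])
    show "finite (h ` T)" using finT by simp
    show "hyperplane_of fscale ?P H" if "H \<in> h ` T" for H using that h(1) by (elim imageE) simp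
  qed (rule generic)
qed

end

theorem theorem2:
  fixes sc :: "complex \<Rightarrow> 'v::ab_group_add \<Rightarrow> 'v"
    and B :: "'v set"
    and W S :: "('v \<Rightarrow> 'v) set"
  assumes "finite_dimensional_vector_space sc B"
    and "reflection_group sc W"
    and "irreducible_on sc W"
    and "\<not> two_reflection_group sc W"
    and "reflection_system sc W S"
    and "all_irreps_realizable TYPE('k::field_char_0) W"
  shows "lie_reductive (hecke_lie sc W :: (('v \<Rightarrow> 'v) \<Rightarrow>\<^sub>0 'k) set) \<and>
    (\<forall>lam :: ('v \<Rightarrow> 'v) set \<times> nat \<Rightarrow>\<^sub>0 'k. lam \<in> param_space sc W S \<longrightarrow>
           lie_reductive (hecke_lie_param sc W S lam)) \<and>
    (\<exists>Hs :: (('v \<Rightarrow> 'v) set \<times> nat \<Rightarrow>\<^sub>0 'k) set set.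
           finite Hs \<and>
           (\<forall>H\<in>Hs. hyperplane_of fscale (param_space sc W S) H) \<and>
           (\<forall>lam \<in> param_space sc W S - \<Union>Hs.
              free.dim (lie_center (hecke_lie_param sc W S lam)) = card (conj_classes W S) \<and>
              lie_derived (hecke_lie_param sc W S lam) = lie_derived (hecke_lie sc W)))"
proof -
  interpret complex_reflection_group sc B W S
    by (intro complex_reflection_group.intro complex_reflection_group_axioms.intro assms(1,2,5))
  have "lie_reductive (hecke_lie sc W :: (('v, 'k) group_ring) set)"
    by (rule reductive_if_conj_stable[OF lie_subalgebra_hecke conj_stable_hecke])
  moreover have "lie_reductive (hecke_lie_param sc W S lam)" for lam :: "('v, 'k) parameter"
    by (rule reductive_if_conj_stable[OF lie_subalgebra_param conj_stable_param])
  moreover have "\<exists>Hs :: (('v, 'k) parameter) set set.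
           finite Hs \<and>
           (\<forall>H\<in>Hs. hyperplane_of fscale (param_space sc W S) H) \<and>
           (\<forall>lam \<in> param_space sc W S - \<Union>Hs.
              free.dim (lie_center (hecke_lie_param sc W S lam)) = card (conj_classes W S) \<and>
              lie_derived (hecke_lie_param sc W S lam) = lie_derived (hecke_lie sc W))"
  proof (rule generic_outside_hyperplanes[where 'k = 'k], intro exI conjI ballI)
    fix Hs H :: "_ set" and lam :: "('v, 'k) parameter"
    assume Hs: "finite Hs" "\<And>H. H \<in> Hs \<Longrightarrow> hyperplane_of fscale (param_space sc W S) H"
      "\<And>lam :: ('v, 'k) parameter. lam \<in> param_space sc W S - \<Union>Hs \<Longrightarrow> generic lam"
    show "finite Hs" by (rule Hs(1))
    show "hyperplane_of fscale (param_space sc W S) H" if "H \<in> Hs" by (rule Hs(2)[OF that])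
    show "free.dim (lie_center (hecke_lie_param sc W S lam)) = card (conj_classes W S)"
      "lie_derived (hecke_lie_param sc W S lam) = lie_derived (hecke_lie sc W)"
      if "lam \<in> param_space sc W S - \<Union>Hs"
      using dim_center[OF Hs(3)[OF that]] derived_eq[OF Hs(3)[OF that]] by simp_all
  qed
  ultimately show ?thesis by (intro conjI allI impI)
qed

end
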